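(* Let $X$ be a compact metric space, $\varepsilon>0$, and $c\in C(X\times X;[0,\infty))$ symmetric such that $k_c=\exp(-c/\varepsilon)$ is a positive definite universal kernel. The function $\mathsf{d}_S$ is a metric on $\mathcal{P}(X)$ that metrizes the weak-$*$ topology. Further, for all $\mu_0,\mu_1\in\mathcal{P}(X)$, with $\beta_0=B(\mu_0)$ and $\beta_1=B(\mu_1)$, $$\sqrt{\frac\varepsilon2}\,\|\beta_0-\beta_1\|_{\mathcal{H}_c}\le\mathsf{d}_S(\mu_0,\mu_1)\le\frac\pi2\sqrt{\frac\varepsilon2 C}\,\|\beta_0-\beta_1\|_{\mathcal{H}_c},\qquad C=1+2\exp\left(\frac{11}{2\varepsilon}\|c\|_\infty\right).$$
   Context: $\mathcal{P}(X)$: Radon probability measures. A kernel is universal if its reproducing kernel Hilbert space (RKHS) is dense in $C(X)$. For $\mu\in\mathcal{P}(X)$, $f_{\mu,\mu}\in C(X)$ is the unique function with $\int_X\exp\left(\frac1\varepsilon(f_{\mu,\mu}(x)+f_{\mu,\mu}(y)-c(x,y))\right)d\mu(x)=1$ for all $y\in X$; $a_\mu=\exp(f_{\mu,\mu}/\varepsilon)$; $k_\mu(x,y)=a_\mu(x)a_\mu(y)k_c(x,y)$; $K_\mu[\phi](y)=\int_X\phi(x)k_\mu(x,y)\,d\mu(x)$. $\mathcal{H}_c$ is the RKHS of $k_c$ and $B(\mu)=\int_X a_\mu(x)k_c(x,\cdot)\,d\mu(x)=\exp(-f_{\mu,\mu}/\varepsilon)\in\mathcal{H}_c$. For $\dot\beta\in\mathcal{H}_c$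 with $\langle B(\mu),\dot\beta\rangle_{\mathcal{H}_c}=0$ (equivalently $\int a_\mu\dot\beta\,d\mu=0$), $$\tilde{\mathbf{g}}_\mu(\dot\beta,\dot\beta)=\frac\varepsilon2\left(\|\dot\beta\|_{\mathcal{H}_c}^2+2\left\langle a_\mu\dot\beta,(\mathrm{id}-K_\mu)^{-1}[a_\mu\dot\beta]\right\rangle_{L^2(X,\mu)}\right),$$ with $(\mathrm{id}-K_\mu)^{-1}$ taken on $L^2(X,\mu)/\mathbb{R}$ (quotient by constants), where $\mathrm{id}-K_\mu$ is boundedly invertible. A path $(\mu_t)_{t\in[0,1]}$ in $\mathcal{P}(X)$ is admissible if $(\beta_t)_t=(B(\mu_t))_t$ belongs to the Sobolev space $H^1((0,1);\mathcal{H}_c)$ of $\mathcal{H}_c$-valued functions ($L^2$ functions with distributional derivative $\dot\beta$ in $L^2$), and is continuous on $[0,1]$ (i.e. it is the continuous representative, including endpoints). For an admissible path, $\langle\beta_t,\dot\beta_t\rangle_{\mathcal{H}_c}=0$ for a.e. $t$, and its energy is $E((\mu_t)_t)=\int_0^1\tilde{\mathbf{g}}_{\mu_t}(\dot\beta_t,\dot\beta_t)\,dt$. Finally $$\mathsf{d}_S(\mu_0,\mu_1)=\Big(\inf E((\mu_t)_t)\Big)^{1/2},$$ the infimum over admissible paths from $\mu_0$ to $\mu_1$. *)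

theory Defs
  imports "HOL-Analysis.Analysis" "HOL-Probability.Probability"
begin

section \<open>Compact metric spaces and Radon probability measures\<close>

class compact_metric_space = metric_space +
  assumes compact_space_UNIV: "compact (UNIV :: 'a set)"

text \<open>
  The Borel \<open>\<sigma>\<close>-algebra of a product is the product of the Borel \<open>\<sigma>\<close>-algebras, and every Borel
  probability measure is Radon, because a compact metric space is Polish.
\<close>

instance compact_metric_space \<subseteq> polish_space
proof
  show "convergent X" if "Cauchy X" for X :: "nat \<Rightarrow> 'a"
    using compact_imp_complete[OF compact_space_UNIV] that
    unfolding complete_def convergent_def by auto
next
  have "\<exists>F::'a set. finite F \<and> UNIV \<subseteq> (\<Union>x\<in>F. ball x (1 / real (Suc n)))" for n
    using compact_space_UNIV[where 'a='a] unfolding compact_eq_totally_bounded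
    by (metis of_nat_0_less_iff zero_less_Suc zero_less_divide_1_iff)
  then obtain F :: "nat \<Rightarrow> 'a set"
    where F: "\<And>n. finite (F n)" "\<And>n. UNIV \<subseteq> (\<Union>x\<in>F n. ball x (1 / real (Suc n)))"
    by metis
  define B where "B = (\<Union>n. (\<lambda>x. ball x (1 / real (Suc n))) ` F n)"
  have cB: "countable B"
    unfolding B_def using F(1) by (intro countable_UN) (auto intro: countable_finite)
  have oB: "open b" if "b \<in> B" for b
    using that unfolding B_def by auto
  have "topological_basis B"
  proof (rule topological_basisI)
    fix b assume "b \<in> B" then show "open b" by (rule oB)
  next
    fix U :: "'a set" and x assume U: "open U" "x \<in> U"
    then obtain e where e: "e > 0" "ball x e \<subseteq> U"
      using open_contains_ball by blast
    obtain n where n: "1 / real (Suc n) < e / 2"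
      using nat_approx_posE[of "e / 2"] e(1) by auto
    obtain y where y: "y \<in> F n" "x \<in> ball y (1 / real (Suc n))"
      using F(2)[of n] by blast
    have "ball y (1 / real (Suc n)) \<subseteq> ball x e"
    proof
      fix z assume "z \<in> ball y (1 / real (Suc n))"
      then have "dist y z < e / 2" "dist y x < e / 2" using y n by auto
      moreover have "dist x z \<le> dist y x + dist y z" by (rule dist_triangle3)
      ultimately show "z \<in> ball x e" by simp
    qed
    then show "\<exists>b\<in>B. x \<in> b \<and> b \<subseteq> U"
      using y e unfolding B_def by blast
  qed
  then show "\<exists>B::'a set set. countable B \<and> open = generate_topology B"
    using cB topological_basis_imp_subbasis by blast
qed

definition radon_prob :: "'a::metric_space measure set" where
  "radon_prob = {\<mu>. sets \<mu> = sets borel \<and> prob_space \<mu> \<and>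
     (\<forall>A\<in>sets borel. emeasure \<mu> A = (SUP K\<in>{K. compact K \<and> K \<subseteq> A}. emeasure \<mu> K))}"

lemma radon_prob_iff_borel_prob:
  fixes \<mu> :: "'a::compact_metric_space measure"
  shows "\<mu> \<in> radon_prob \<longleftrightarrow> sets \<mu> = sets borel \<and> prob_space \<mu>"
proof -
  have "emeasure \<mu> A = (SUP K\<in>{K. compact K \<and> K \<subseteq> A}. emeasure \<mu> K)"
    if "sets \<mu> = sets borel" "prob_space \<mu>" "A \<in> sets borel" for A
  proof -
    interpret prob_space \<mu> by fact
    show ?thesis
      using inner_regular[of \<mu> A] that emeasure_finite[of "space \<mu>"]
      by (auto simp: conj_commute)
  qed
  then show ?thesis unfolding radon_prob_def by auto
qed

text \<open>The coarsest topology for which all maps \<open>\<mu> \<mapsto> \<integral> f d\<mu>\<close>, \<open>f \<in> C(X)\<close>, are continuous.\<close>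

definition weak_star_topology :: "'a::metric_space measure topology" where
  "weak_star_topology = topology_generated_by
     {{\<mu> \<in> radon_prob. (\<integral>x. f x \<partial>\<mu>) \<in> U} | (f :: 'a \<Rightarrow> real) U. continuous_on UNIV f \<and> open U}"

section \<open>Kernels and reproducing kernel Hilbert spaces\<close>

definition positive_definite_kernel :: "('a \<Rightarrow> 'a \<Rightarrow> real) \<Rightarrow> bool" where
  "positive_definite_kernel k \<longleftrightarrow> (\<forall>x y. k x y = k y x) \<and>
     (\<forall>S (r :: 'a \<Rightarrow> real). finite S \<longrightarrow> 0 \<le> (\<Sum>x\<in>S. \<Sum>y\<in>S. r x * r y * k x y))"

text \<open>
  The RKHS of a kernel is only determined as a set of functions that depends on the kernel, so it
  cannot be a type by itself.  It is represented by a Hilbert space \<open>'h\<close> together with an injective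
  linear map \<open>\<iota>\<close> that identifies each \<open>h :: 'h\<close> with the function \<open>\<iota> h\<close> on \<open>X\<close>.  By the
  Moore--Aronszajn theorem, \<open>('h, \<iota>)\<close> is unique up to a unique isometry.  For a continuous kernel
  on a compact metric space the RKHS is separable, so \<open>'h\<close> may be taken second countable,
  as the Bochner integral of the library requires.
\<close>

definition is_rkhs ::
  "('a \<Rightarrow> 'a \<Rightarrow> real) \<Rightarrow> ('h::{real_inner, complete_space} \<Rightarrow> 'a \<Rightarrow> real) \<Rightarrow> bool" where
  "is_rkhs k \<iota> \<longleftrightarrow> (\<forall>x. linear (\<lambda>h. \<iota> h x)) \<and> inj \<iota> \<and>
     (\<forall>x. \<exists>\<kappa>. \<iota> \<kappa> = k x \<and> (\<forall>h. \<iota> h x = h \<bullet> \<kappa>))"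

text \<open>The type \<open>'a \<Rightarrow>\<^sub>C real\<close> is \<open>C(X)\<close> with the supremum norm, as \<open>X\<close> is compact.\<close>

definition universal_rkhs :: "('h \<Rightarrow> 'a::compact_metric_space \<Rightarrow> real) \<Rightarrow> bool" where
  "universal_rkhs \<iota> \<longleftrightarrow> (\<forall>h. continuous_on UNIV (\<iota> h)) \<and>
     closure {f :: 'a \<Rightarrow>\<^sub>C real. apply_bcontfun f \<in> range \<iota>} = UNIV"

definition gibbs_kernel :: "real \<Rightarrow> ('a \<Rightarrow> 'a \<Rightarrow> real) \<Rightarrow> 'a \<Rightarrow> 'a \<Rightarrow> real" where
  "gibbs_kernel \<epsilon> c x y = exp (- c x y / \<epsilon>)"

section \<open>Schroedinger potentials, the operator \<open>K\<close> and the map \<open>B\<close>\<close>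

definition schroedinger_potential ::
  "real \<Rightarrow> ('a::topological_space \<Rightarrow> 'a \<Rightarrow> real) \<Rightarrow> 'a measure \<Rightarrow> 'a \<Rightarrow> real" where
  "schroedinger_potential \<epsilon> c \<mu> = (THE f. continuous_on UNIV f \<and>
     (\<forall>y. (\<integral>x. exp (1 / \<epsilon> * (f x + f y - c x y)) \<partial>\<mu>) = 1))"

definition a_fun ::
  "real \<Rightarrow> ('a::topological_space \<Rightarrow> 'a \<Rightarrow> real) \<Rightarrow> 'a measure \<Rightarrow> 'a \<Rightarrow> real" where
  "a_fun \<epsilon> c \<mu> x = exp (schroedinger_potential \<epsilon> c \<mu> x / \<epsilon>)"

definition k_mu ::
  "real \<Rightarrow> ('a::topological_space \<Rightarrow> 'a \<Rightarrow> real) \<Rightarrow> 'a measure \<Rightarrow> 'a \<Rightarrow> 'a \<Rightarrow> real" where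
  "k_mu \<epsilon> c \<mu> x y = a_fun \<epsilon> c \<mu> x * a_fun \<epsilon> c \<mu> y * gibbs_kernel \<epsilon> c x y"

definition K_op ::
  "real \<Rightarrow> ('a::topological_space \<Rightarrow> 'a \<Rightarrow> real) \<Rightarrow> 'a measure \<Rightarrow> ('a \<Rightarrow> real) \<Rightarrow> 'a \<Rightarrow> real" where
  "K_op \<epsilon> c \<mu> \<phi> y = (\<integral>x. \<phi> x * k_mu \<epsilon> c \<mu> x y \<partial>\<mu>)"

text \<open>\<open>inv \<iota> (gibbs_kernel \<epsilon> c x)\<close> is \<open>k\<^sub>c(x, \<cdot>)\<close> as an element of the RKHS.\<close>

definition B_map ::
  "('h::{real_inner, banach, second_countable_topology} \<Rightarrow> 'a \<Rightarrow> real) \<Rightarrow> real \<Rightarrow>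
   ('a::topological_space \<Rightarrow> 'a \<Rightarrow> real) \<Rightarrow> 'a measure \<Rightarrow> 'h" where
  "B_map \<iota> \<epsilon> c \<mu> = (\<integral>x. a_fun \<epsilon> c \<mu> x *\<^sub>R inv \<iota> (gibbs_kernel \<epsilon> c x) \<partial>\<mu>)"

section \<open>The metric tensor\<close>

definition L2_funs :: "'x measure \<Rightarrow> ('x \<Rightarrow> 'b::{real_normed_vector, second_countable_topology}) set" where
  "L2_funs M = {f \<in> borel_measurable M. integrable M (\<lambda>x. (norm (f x))\<^sup>2)}"

text \<open>
  A representative of the class \<open>(id - K\<^sub>\<mu>)\<^sup>-\<^sup>1[\<phi>]\<close> in the quotient of \<open>L\<^sup>2(X,\<mu>)\<close> by the constants:
  the equation \<open>(id - K\<^sub>\<mu>) \<psi> = \<phi>\<close> is required up to an additive constant and up to null sets.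
  Two representatives differ by a constant, which does not affect the \<open>L\<^sup>2\<close> inner product with
  a function of zero mean.
\<close>

definition id_minus_K_inv ::
  "real \<Rightarrow> ('a::topological_space \<Rightarrow> 'a \<Rightarrow> real) \<Rightarrow> 'a measure \<Rightarrow> ('a \<Rightarrow> real) \<Rightarrow> 'a \<Rightarrow> real" where
  "id_minus_K_inv \<epsilon> c \<mu> \<phi> = (SOME \<psi>. \<psi> \<in> L2_funs \<mu> \<and>
     (\<exists>r. AE y in \<mu>. \<psi> y - K_op \<epsilon> c \<mu> \<psi> y = \<phi> y + r))"

definition metric_tensor ::
  "('h::real_inner \<Rightarrow> 'a \<Rightarrow> real) \<Rightarrow> real \<Rightarrow>
   ('a::topological_space \<Rightarrow> 'a \<Rightarrow> real) \<Rightarrow> 'a measure \<Rightarrow> 'h \<Rightarrow> real" where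
  "metric_tensor \<iota> \<epsilon> c \<mu> b = (let \<phi> = (\<lambda>x. a_fun \<epsilon> c \<mu> x * \<iota> b x) in
     \<epsilon> / 2 * ((norm b)\<^sup>2 + 2 * (\<integral>x. \<phi> x * id_minus_K_inv \<epsilon> c \<mu> \<phi> x \<partial>\<mu>)))"

section \<open>Sobolev paths, energy and distance\<close>

definition test_function :: "(real \<Rightarrow> real) \<Rightarrow> bool" where
  "test_function \<phi> \<longleftrightarrow> (\<forall>n t. (deriv ^^ n) \<phi> differentiable (at t)) \<and>
     closure {t. \<phi> t \<noteq> 0} \<subseteq> {0<..<1}"

text \<open>\<open>\<beta> \<in> H\<^sup>1((0,1); H)\<close> with distributional derivative \<open>\<beta>'\<close>.\<close>

definition has_sobolev_deriv ::
  "(real \<Rightarrow> 'h::{real_inner, banach, second_countable_topology}) \<Rightarrow> (real \<Rightarrow> 'h) \<Rightarrow> bool" where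
  "has_sobolev_deriv \<beta> \<beta>' \<longleftrightarrow>
     \<beta> \<in> L2_funs (lebesgue_on {0<..<1}) \<and> \<beta>' \<in> L2_funs (lebesgue_on {0<..<1}) \<and>
     (\<forall>\<phi>. test_function \<phi> \<longrightarrow>
        (\<integral>t. deriv \<phi> t *\<^sub>R \<beta> t \<partial>lebesgue_on {0<..<1}) =
        - (\<integral>t. \<phi> t *\<^sub>R \<beta>' t \<partial>lebesgue_on {0<..<1}))"

definition sobolev_deriv ::
  "(real \<Rightarrow> 'h::{real_inner, banach, second_countable_topology}) \<Rightarrow> real \<Rightarrow> 'h" where
  "sobolev_deriv \<beta> = (SOME \<beta>'. has_sobolev_deriv \<beta> \<beta>')"

definition admissible_path ::
  "('h::{real_inner, banach, second_countable_topology} \<Rightarrow> 'a \<Rightarrow> real) \<Rightarrow> real \<Rightarrow>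
   ('a::metric_space \<Rightarrow> 'a \<Rightarrow> real) \<Rightarrow> (real \<Rightarrow> 'a measure) \<Rightarrow> bool" where
  "admissible_path \<iota> \<epsilon> c \<mu> \<longleftrightarrow> (\<forall>t\<in>{0..1}. \<mu> t \<in> radon_prob) \<and>
     continuous_on {0..1} (\<lambda>t. B_map \<iota> \<epsilon> c (\<mu> t)) \<and>
     (\<exists>\<beta>'. has_sobolev_deriv (\<lambda>t. B_map \<iota> \<epsilon> c (\<mu> t)) \<beta>')"

definition path_energy ::
  "('h::{real_inner, banach, second_countable_topology} \<Rightarrow> 'a \<Rightarrow> real) \<Rightarrow> real \<Rightarrow>
   ('a::metric_space \<Rightarrow> 'a \<Rightarrow> real) \<Rightarrow> (real \<Rightarrow> 'a measure) \<Rightarrow> ennreal" where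
  "path_energy \<iota> \<epsilon> c \<mu> =
     (\<integral>\<^sup>+t. ennreal (metric_tensor \<iota> \<epsilon> c (\<mu> t) (sobolev_deriv (\<lambda>s. B_map \<iota> \<epsilon> c (\<mu> s)) t))
        \<partial>lebesgue_on {0<..<1})"

text \<open>
  The convention \<open>enn2real \<infinity> = 0\<close> plays no role: any two measures are joined by an admissible path of
  finite energy, and a vanishing distance between distinct measures would contradict the metric
  axioms.
\<close>

definition sinkhorn_dist ::
  "('h::{real_inner, banach, second_countable_topology} \<Rightarrow> 'a \<Rightarrow> real) \<Rightarrow> real \<Rightarrow>
   ('a::metric_space \<Rightarrow> 'a \<Rightarrow> real) \<Rightarrow> 'a measure \<Rightarrow> 'a measure \<Rightarrow> real" where
  "sinkhorn_dist \<iota> \<epsilon> c \<mu>0 \<mu>1 = sqrt (enn2real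
     (INF \<mu> \<in> {\<mu>. admissible_path \<iota> \<epsilon> c \<mu> \<and> \<mu> 0 = \<mu>0 \<and> \<mu> 1 = \<mu>1}. path_energy \<iota> \<epsilon> c \<mu>))"

definition sup_norm :: "('a \<Rightarrow> 'a \<Rightarrow> real) \<Rightarrow> real" where
  "sup_norm c = (SUP p. \<bar>c (fst p) (snd p)\<bar>)"

end

theory Submission
  imports Defs
begin

text \<open>
  Write \<open>\<kappa>\<^sub>x\<close> for the element \<open>k\<^sub>c(x, \<cdot>)\<close> of the RKHS, so that every function in it is \<open>h \<bullet> \<kappa>\<^sub>x\<close>.  The image
  \<open>\<beta> = B(\<mu>)\<close> is the unique solution with \<open>\<beta> \<bullet> \<kappa>\<^sub>x > 0\<close> of the strongly monotone equation
  \<open>\<beta> = \<integral> \<kappa>\<^sub>x / (\<beta> \<bullet> \<kappa>\<^sub>x) d\<mu>(x)\<close>; it satisfies \<open>\<parallel>\<beta>\<parallel> = 1\<close>, \<open>a\<^sub>\<mu> = 1 / (\<beta> \<bullet> \<kappa>\<^sub>x)\<close> and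
  \<open>q \<le> \<beta> \<bullet> \<kappa>\<^sub>x \<le> 1\<close> with \<open>q = exp (-\<parallel>c\<parallel>\<^sub>\<infinity>/\<epsilon>)\<close>.  The kernel \<open>k\<^sub>\<mu>\<close> is bounded below by \<open>q\<close>, which gives \<open>id - K\<^sub>\<mu>\<close>
  the spectral gap \<open>q\<close> and hence \<open>\<epsilon>/2 \<parallel>b\<parallel>\<^sup>2 \<le> g\<^sub>\<mu>(b, b) \<le> \<epsilon>/2 (1 + 2 q\<^sup>-\<^sup>3) \<parallel>b\<parallel>\<^sup>2\<close>.

  The lower bound on the distance is Jensen's inequality along a path.  For the upper bound, the segment from
  \<open>\<beta>\<^sub>0\<close> to \<open>\<beta>\<^sub>1\<close> is normalized to a curve in the unit sphere, whose points are again images of probability measures.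
  Since \<open>\<beta>\<^sub>0 \<bullet> \<beta>\<^sub>1 > 0\<close>, its speed is at most \<open>\<surd>2 \<parallel>\<beta>\<^sub>0 - \<beta>\<^sub>1\<parallel>\<close>, and \<open>\<surd>2 \<le> \<pi>/2\<close>.  The triangle inequality comes from
  concatenating paths with the optimal splitting of the time interval.

  Thus the metric is equivalent to \<open>\<parallel>B(\<mu>) - B(\<nu>)\<parallel>\<close>.  Monotonicity of the equation bounds this norm
  by \<open>\<parallel>\<integral> \<kappa>\<^sub>x / (\<beta>\<^sub>0 \<bullet> \<kappa>\<^sub>x) d(\<mu> - \<mu>\<^sub>0)\<parallel>\<close>, which is weak-* continuous; conversely universality shows that \<open>B(\<mu>)\<close> controls
  the integrals of all continuous functions.
\<close>

section \<open>Integration over the unit interval\<close>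

text \<open>The energy is a lower integral: \<open>nn_integral\<close> is a supremum over simple
  minorants, and neither the measures \<open>p t\<close> of a path nor the representatives chosen by
  \<open>id_minus_K_inv\<close> come with measurability in t. Time reversal and concatenation are
  therefore inequalities, proved by passing to measurable minorants. Derivatives are given by
  duality with smooth functions supported in the open unit interval; an explicit family of such
  functions turns this into the integral representation \<open>has_L2_deriv\<close>, which reaches
  the endpoints and can be glued. Since B has norm 1 along a path, the derivative is orthogonal to
  the path; this makes a times the derivative a function of mean zero, on which the tensor can be
  estimated. In the upper bound for the tensor two factors 1/q come from the square of a and one
  from the spectral gap: the exponent obtained is 3, and the 11/2 of the statement is
  larger.\<close>

abbreviation leb01 :: "real measure" where
  "leb01 \<equiv> lebesgue_on {0<..<1}"

lemma prob_space_leb01: "prob_space leb01"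
  by (rule prob_spaceI) (simp add: emeasure_restrict_space)

interpretation leb01: prob_space leb01
  by (rule prob_space_leb01)

lemma L2_funs_integrable:
  fixes f :: "'x \<Rightarrow> 'b::{banach, second_countable_topology}"
  assumes "finite_measure M" "f \<in> L2_funs M"
  shows "integrable M f"
proof -
  interpret finite_measure M by fact
  show ?thesis
  proof (rule Bochner_Integration.integrable_bound)
    show "integrable M (\<lambda>x. 1 + (norm (f x))\<^sup>2)" using assms(2) by (auto simp: L2_funs_def)
    show "f \<in> borel_measurable M" using assms(2) by (auto simp: L2_funs_def)
    have "u \<le> 1 + u\<^sup>2" for u :: real
      using zero_le_power2[of "u - 1/2"] by (simp add: power2_eq_square algebra_simps)
    then show "AE x in M. norm (f x) \<le> norm (1 + (norm (f x))\<^sup>2)"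
      by (simp add: abs_of_nonneg)
  qed
qed

lemma L2_funs_integrable_inner:
  fixes f g :: "'x \<Rightarrow> 'b::{real_inner, banach, second_countable_topology}"
  assumes "f \<in> L2_funs M" "g \<in> L2_funs M"
  shows "integrable M (\<lambda>x. f x \<bullet> g x)"
proof (rule Bochner_Integration.integrable_bound)
  show "integrable M (\<lambda>x. (norm (f x))\<^sup>2 + (norm (g x))\<^sup>2)" using assms by (auto simp: L2_funs_def)
  show "(\<lambda>x. f x \<bullet> g x) \<in> borel_measurable M" using assms by (auto simp: L2_funs_def)
  have "u * v \<le> u\<^sup>2 + v\<^sup>2" if "u \<ge> 0" "v \<ge> 0" for u v :: real
    using sum_squares_bound[of u v] that mult_nonneg_nonneg[OF that] by linarith
  then have "norm (f x \<bullet> g x) \<le> norm ((norm (f x))\<^sup>2 + (norm (g x))\<^sup>2)" for x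
    using order_trans[OF Cauchy_Schwarz_ineq2[of "f x" "g x"]] by simp
  then show "AE x in M. norm (f x \<bullet> g x) \<le> norm ((norm (f x))\<^sup>2 + (norm (g x))\<^sup>2)" by simp
qed

lemma L2_funs_bounded:
  fixes f :: "'x \<Rightarrow> 'b::{banach, second_countable_topology}"
  assumes "finite_measure M" "f \<in> borel_measurable M" "\<And>x. x \<in> space M \<Longrightarrow> norm (f x) \<le> C"
  shows "f \<in> L2_funs M"
proof -
  interpret finite_measure M by fact
  have "integrable M (\<lambda>x. (norm (f x))\<^sup>2)"
  proof (rule Bochner_Integration.integrable_bound)
    show "integrable M (\<lambda>x. C\<^sup>2)" by simp
    show "(\<lambda>x. (norm (f x))\<^sup>2) \<in> borel_measurable M" using assms(2) by measurable
    show "AE x in M. norm ((norm (f x))\<^sup>2) \<le> norm (C\<^sup>2)"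
      using assms(3) by (auto intro!: AE_I2 power_mono)
  qed
  then show ?thesis using assms(2) by (simp add: L2_funs_def)
qed

lemma continuous_on_measurable_unit:
  fixes f :: "real \<Rightarrow> 'b::{second_countable_topology, real_normed_vector}"
  assumes "continuous_on {0..1} f"
  shows "f \<in> borel_measurable leb01"
proof -
  have "f \<in> borel_measurable (restrict_space lborel {0<..<1})"
    using borel_measurable_continuous_on_restrict[OF continuous_on_subset[OF assms, of "{0<..<1}"]]
      measurable_cong_sets[OF sets_restrict_space_cong[OF sets_lborel] refl]
    by (metis greaterThanLessThan_subseteq_atLeastAtMost_iff order_refl)
  then have "(\<lambda>x. indicator {0<..<1} x *\<^sub>R f x) \<in> borel_measurable lborel"
    by (subst (asm) borel_measurable_restrict_space_iff) auto
  then have "(\<lambda>x. indicator {0<..<1} x *\<^sub>R f x) \<in> borel_measurable lebesgue"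
    by (rule measurable_completion)
  then show ?thesis
    by (subst borel_measurable_restrict_space_iff) auto
qed

lemma set_integrable_integrable:
  fixes f :: "'x \<Rightarrow> 'b::{banach, second_countable_topology}"
  assumes "integrable M f" "A \<in> sets M"
  shows "set_integrable M A f"
  unfolding set_integrable_def
  by (rule integrable_mult_indicator[OF assms(2,1)])

text \<open>Open intervals form an intersection-stable generator of the Borel sets, so a Dynkin
  induction carries the vanishing to all Borel sets, and completion carries it to all Lebesgue sets.
  A Banach-valued function with zero integral over every measurable set vanishes almost
  everywhere.\<close>

lemma AE_zero_if_interval_integrals_zero:
  fixes f :: "real \<Rightarrow> 'b::{banach, second_countable_topology}"
  assumes f: "integrable leb01 f"
    and z: "\<And>s t. 0 \<le> s \<Longrightarrow> s \<le> t \<Longrightarrow> t \<le> 1 \<Longrightarrow> (LINT x:{s<..<t}|leb01. f x) = 0"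
  shows "AE x in leb01. f x = 0"
proof -
  \<comment> \<open>Extension by zero moves the problem to the whole line, where every box is
    available as a generator.\<close>
  define g where "g = (\<lambda>x. indicator {0<..<1} x *\<^sub>R f x)"
  have g: "integrable lebesgue g"
    using f unfolding g_def by (subst (asm) integrable_restrict_space) auto
  have red: "(LINT x:A|leb01. f x) = (LINT x:A|lebesgue. g x)" for A
    unfolding set_lebesgue_integral_def g_def
    by (subst integral_restrict_space) (auto simp: mult.commute intro!: Bochner_Integration.integral_cong)
  have gI: "set_integrable lebesgue A g" if "A \<in> sets lebesgue" for A
    using that by (rule set_integrable_integrable[OF g])
  have box: "(LINT x:box s t|lebesgue. g x) = 0" for s t :: real
  proof -
    have "(LINT x:box s t|lebesgue. g x) = (LINT x:{max 0 s<..<min 1 t}|lebesgue. g x)"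
      unfolding set_lebesgue_integral_def g_def
      by (rule Bochner_Integration.integral_cong) (auto simp: indicator_def)
    also have "\<dots> = 0"
    proof (cases "max 0 s \<le> min 1 t")
      case True
      then show ?thesis using z[of "max 0 s" "min 1 t"] red by simp
    next
      case False
      then have "{max 0 s<..<min 1 t} = {}" by auto
      then show ?thesis by (simp add: set_lebesgue_integral_def)
    qed
    finally show ?thesis .
  qed
  have bor: "(LINT x:A|lebesgue. g x) = 0" if "A \<in> sets borel" for A
  proof -
    have A: "A \<in> sigma_sets UNIV (range (\<lambda>(a, b). box a b))"
      using that by (simp add: borel_eq_box)
    have leb: "B \<in> sets lebesgue" if "B \<in> sigma_sets UNIV (range (\<lambda>(a, b). box a (b::real)))" for B
    proof -
      have "B \<in> sets borel" using that by (simp add: borel_eq_box)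
      then show ?thesis by (simp add: sets_completionI_sets)
    qed
    show ?thesis
    proof (rule sigma_sets_induct_disjoint[OF _ _ A, where P = "\<lambda>A. (LINT x:A|lebesgue. g x) = 0"])
      show "Int_stable (range (\<lambda>(a, b). box a (b::real)))"
        by (auto simp: Int_stable_def Int_interval box_Int_box image_iff)
      show "range (\<lambda>(a, b). box a (b::real)) \<subseteq> Pow UNIV" by simp
      show "(LINT x:B|lebesgue. g x) = 0" if "B \<in> range (\<lambda>(a, b). box a b)" for B
        using that box by auto
      show "(LINT x:{}|lebesgue. g x) = 0" by (simp add: set_lebesgue_integral_def)
      have U: "(LINT x:UNIV|lebesgue. g x) = 0"
      proof -
        have "(LINT x:UNIV|lebesgue. g x) = (LINT x:box 0 1|lebesgue. g x)"
          unfolding set_lebesgue_integral_def g_def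
          by (rule Bochner_Integration.integral_cong) (auto simp: indicator_def)
        then show ?thesis using box by simp
      qed
      show "(LINT x:UNIV - B|lebesgue. g x) = 0"
        if "B \<in> sigma_sets UNIV (range (\<lambda>(a, b). box a b))" "(LINT x:B|lebesgue. g x) = 0" for B
      proof -
        have "(LINT x:UNIV|lebesgue. g x) = (LINT x:B|lebesgue. g x) + (LINT x:UNIV - B|lebesgue. g x)"
          using set_integral_Un[of B "UNIV - B" lebesgue g] gI[OF leb[OF that(1)]]
            gI[OF sets.compl_sets[OF leb[OF that(1)], simplified]] by simp
        then show ?thesis using U that by simp
      qed
      show "(LINT x:(\<Union>i. B i)|lebesgue. g x) = 0"
        if "disjoint_family B" "range B \<subseteq> sigma_sets UNIV (range (\<lambda>(a, b). box a b))"
          "\<And>i. (LINT x:B i|lebesgue. g x) = 0" for B :: "nat \<Rightarrow> real set"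
      proof -
        have B: "B i \<in> sets lebesgue" for i using that(2) leb by blast
        then have "(LINT x:(\<Union>i. B i)|lebesgue. g x) = (\<Sum>i. (LINT x:B i|lebesgue. g x))"
          using that(1) by (intro lebesgue_integral_countable_add gI) (auto simp: disjoint_family_on_def)
        then show ?thesis using that(3) by simp
      qed
    qed
  qed
  show ?thesis
  proof (rule leb01.density_unique_banach[OF f])
    fix A :: "real set" assume "A \<in> sets leb01"
    then have "A \<in> sets lebesgue" by (auto simp: sets_restrict_space)
    then obtain S N N' where A: "A = S \<union> N" "N \<subseteq> N'" "N' \<in> null_sets lborel" "S \<in> sets lborel"
      by (rule sets_completionE)
    have "(LINT x:A|lebesgue. g x) = (LINT x:S|lebesgue. g x)"
      unfolding set_lebesgue_integral_def
    proof (rule integral_cong_AE)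
      have "N' \<in> null_sets lebesgue" using A(3) by (rule null_sets_completionI)
      then have "AE x in lebesgue. x \<notin> N'" by (rule AE_not_in)
      then show "AE x in lebesgue. indicator A x *\<^sub>R g x = indicator S x *\<^sub>R g x"
        by (rule AE_mp) (use A in \<open>auto simp: indicator_def\<close>)
      show "(\<lambda>x. indicator A x *\<^sub>R g x) \<in> borel_measurable lebesgue"
        "(\<lambda>x. indicator S x *\<^sub>R g x) \<in> borel_measurable lebesgue"
        using gI[of A] gI[of S] \<open>A \<in> sets lebesgue\<close> A(4) by (auto simp: set_integrable_def)
    qed
    also have "\<dots> = 0" using bor A(4) by simp
    finally show "(LINT x:A|leb01. f x) = (LINT x:A|leb01. 0)"
      by (simp add: red)
  qed simp
qed

text \<open>\<open>nn_integral\<close> of an arbitrary function is the supremum over simple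
  functions below it, so an upper bound has to be checked on measurable minorants only. This is how
  energies are estimated without measurability of their density.\<close>

lemma nn_integral_le_measurable_minorants:
  assumes "\<And>s. s \<in> borel_measurable M \<Longrightarrow> (\<And>x. s x \<le> f x) \<Longrightarrow> (\<integral>\<^sup>+x. s x \<partial>M) \<le> C"
  shows "(\<integral>\<^sup>+x. f x \<partial>M) \<le> C"
  unfolding nn_integral_def[of M f]
proof (rule SUP_least)
  fix s assume "s \<in> {g. simple_function M g \<and> g \<le> f}"
  then show "integral\<^sup>S M s \<le> C"
    using assms[of s] nn_integral_eq_simple_integral[of M s]
    by (auto simp: le_fun_def borel_measurable_simple_function)
qed

text \<open>The exact transformation formula is applied to a measurable minorant of the composed
  function; after the inverse substitution this minorant lies below \<open>G\<close>.\<close>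

lemma nn_integral_real_affine_le:
  fixes G :: "real \<Rightarrow> ennreal"
  assumes "m \<noteq> 0"
  shows "(\<integral>\<^sup>+t. G (l + m * t) \<partial>lebesgue) \<le> ennreal (1 / \<bar>m\<bar>) * (\<integral>\<^sup>+t. G t \<partial>lebesgue)"
proof (rule nn_integral_le_measurable_minorants)
  fix s :: "real \<Rightarrow> ennreal" assume s: "s \<in> borel_measurable lebesgue" "\<And>x. s x \<le> G (l + m * x)"
  have "(\<integral>\<^sup>+t. s t \<partial>lebesgue) = ennreal \<bar>1 / m\<bar> * (\<integral>\<^sup>+t. s (- l / m + 1 / m * t) \<partial>lebesgue)"
    by (rule nn_integral_real_affine_lebesgue[OF s(1)]) (use assms in simp)
  also have "\<dots> \<le> ennreal \<bar>1 / m\<bar> * (\<integral>\<^sup>+t. G t \<partial>lebesgue)"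
  proof (intro mult_left_mono nn_integral_mono)
    fix x :: real
    have "l + m * (- l / m + 1 / m * x) = x" using assms by (simp add: field_simps)
    then show "s (- l / m + 1 / m * x) \<le> G x" using s(2)[of "- l / m + 1 / m * x"] by simp
  qed simp
  finally show "(\<integral>\<^sup>+t. s t \<partial>lebesgue) \<le> ennreal (1 / \<bar>m\<bar>) * (\<integral>\<^sup>+t. G t \<partial>lebesgue)" by simp
qed

lemma nn_integral_cmult_le:
  fixes f :: "'x \<Rightarrow> ennreal"
  assumes "0 < r"
  shows "(\<integral>\<^sup>+x. ennreal r * f x \<partial>M) \<le> ennreal r * (\<integral>\<^sup>+x. f x \<partial>M)"
proof (rule nn_integral_le_measurable_minorants)
  fix s assume s: "s \<in> borel_measurable M" "\<And>x. s x \<le> ennreal r * f x"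
  have rr: "ennreal r * (ennreal (1 / r) * u) = u" for u
    using assms by (simp flip: mult.assoc ennreal_mult)
  have rr': "ennreal (1 / r) * (ennreal r * u) = u" for u
    using assms by (simp flip: mult.assoc ennreal_mult)
  have "(\<integral>\<^sup>+x. s x \<partial>M) = (\<integral>\<^sup>+x. ennreal r * (ennreal (1 / r) * s x) \<partial>M)" by (simp add: rr)
  also have "\<dots> = ennreal r * (\<integral>\<^sup>+x. ennreal (1 / r) * s x \<partial>M)"
    by (rule nn_integral_cmult) (use s in measurable)
  also have "\<dots> \<le> ennreal r * (\<integral>\<^sup>+x. f x \<partial>M)"
    by (intro mult_left_mono nn_integral_mono) (use s(2) in \<open>auto simp: rr' dest: mult_left_mono[where c = "ennreal (1 / r)"]\<close>, metis mult_left_mono rr' s(2) zero_le)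
  finally show "(\<integral>\<^sup>+x. s x \<partial>M) \<le> ennreal r * (\<integral>\<^sup>+x. f x \<partial>M)" .
qed

lemma nn_integral_unit_concat_le:
  fixes g g1 g2 :: "real \<Rightarrow> ennreal"
  assumes th: "0 < \<theta>" "\<theta> < 1" and r: "0 < r1" "0 < r2"
    and g: "AE t in leb01. g t \<le>
      (if t < \<theta> then ennreal r1 * g1 (t / \<theta>) else ennreal r2 * g2 ((t - \<theta>) / (1 - \<theta>)))"
  shows "(\<integral>\<^sup>+t. g t \<partial>leb01) \<le>
    ennreal (\<theta> * r1) * (\<integral>\<^sup>+t. g1 t \<partial>leb01) + ennreal ((1 - \<theta>) * r2) * (\<integral>\<^sup>+t. g2 t \<partial>leb01)"
proof -
  define g' where "g' t = (if t < \<theta> then ennreal r1 * g1 (t / \<theta>) else ennreal r2 * g2 ((t - \<theta>) / (1 - \<theta>)))" for t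
  define J where "J = (indicator {0<..<1} :: real \<Rightarrow> ennreal)"
  have unit: "(\<integral>\<^sup>+t. f t \<partial>leb01) = (\<integral>\<^sup>+t. f t * J t \<partial>lebesgue)" for f :: "real \<Rightarrow> ennreal"
    unfolding J_def by (rule nn_integral_restrict_space) simp
  have piece: "(\<integral>\<^sup>+t. ennreal r * (f (- l / m + 1 / m * t) * J (- l / m + 1 / m * t)) \<partial>lebesgue)
      \<le> ennreal (m * r) * (\<integral>\<^sup>+t. f t \<partial>leb01)"
    if "m > 0" "r > 0" for l m r and f :: "real \<Rightarrow> ennreal"
  proof -
    have "(\<integral>\<^sup>+t. ennreal r * (f (- l / m + 1 / m * t) * J (- l / m + 1 / m * t)) \<partial>lebesgue)
        \<le> ennreal r * (\<integral>\<^sup>+t. f (- l / m + 1 / m * t) * J (- l / m + 1 / m * t) \<partial>lebesgue)"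
      by (rule nn_integral_cmult_le[OF \<open>r > 0\<close>])
    also have "\<dots> \<le> ennreal r * (ennreal (1 / \<bar>1 / m\<bar>) * (\<integral>\<^sup>+t. f t * J t \<partial>lebesgue))"
      using that by (intro mult_left_mono nn_integral_real_affine_le[where G = "\<lambda>t. f t * J t"]) auto
    also have "\<dots> = ennreal (m * r) * (\<integral>\<^sup>+t. f t \<partial>leb01)"
      using that by (simp add: unit ennreal_mult mult.assoc mult.left_commute)
    finally show ?thesis .
  qed
  have "(\<integral>\<^sup>+t. g t \<partial>leb01) \<le> (\<integral>\<^sup>+t. g' t \<partial>leb01)"
    unfolding g'_def by (rule nn_integral_mono_AE[OF g])
  also have "\<dots> \<le> ennreal (\<theta> * r1) * (\<integral>\<^sup>+t. g1 t \<partial>leb01) + ennreal ((1 - \<theta>) * r2) * (\<integral>\<^sup>+t. g2 t \<partial>leb01)"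
  proof (rule nn_integral_le_measurable_minorants)
    fix s assume s: "s \<in> borel_measurable leb01" "\<And>x. s x \<le> g' x"
    \<comment> \<open>The lower integral is additive only on measurable functions, so the split at
      \<theta> is carried out on a measurable minorant, cut off outside the unit interval.\<close>
    define S where "S t = s t * J t" for t
    have S[measurable]: "S \<in> borel_measurable lebesgue"
      using s(1) unfolding S_def J_def
      by (subst (asm) borel_measurable_restrict_space_iff_ennreal) auto
    have "(\<integral>\<^sup>+t. s t \<partial>leb01) = (\<integral>\<^sup>+t. S t * indicator {..<\<theta>} t + S t * indicator {\<theta>..} t \<partial>lebesgue)"
      unfolding unit S_def[symmetric] by (rule nn_integral_cong) (auto simp: indicator_def)
    also have "\<dots> = (\<integral>\<^sup>+t. S t * indicator {..<\<theta>} t \<partial>lebesgue) + (\<integral>\<^sup>+t. S t * indicator {\<theta>..} t \<partial>lebesgue)"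
      by (rule nn_integral_add) (use S in \<open>auto intro!: borel_measurable_times_ennreal borel_measurable_indicator\<close>)
    also have "(\<integral>\<^sup>+t. S t * indicator {..<\<theta>} t \<partial>lebesgue) \<le> (\<integral>\<^sup>+t. ennreal r1 * (g1 (- 0 / \<theta> + 1 / \<theta> * t) * J (- 0 / \<theta> + 1 / \<theta> * t)) \<partial>lebesgue)"
    proof (rule nn_integral_mono)
      fix t show "S t * indicator {..<\<theta>} t \<le> ennreal r1 * (g1 (- 0 / \<theta> + 1 / \<theta> * t) * J (- 0 / \<theta> + 1 / \<theta> * t))"
        using s(2)[of t] th unfolding S_def J_def g'_def
        by (auto simp: indicator_def field_simps split: if_splits)
    qed
    also have "\<dots> \<le> ennreal (\<theta> * r1) * (\<integral>\<^sup>+t. g1 t \<partial>leb01)"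
      by (rule piece[OF th(1) r(1)])
    also have "(\<integral>\<^sup>+t. S t * indicator {\<theta>..} t \<partial>lebesgue) \<le> (\<integral>\<^sup>+t. ennreal r2 * (g2 (- \<theta> / (1 - \<theta>) + 1 / (1 - \<theta>) * t) * J (- \<theta> / (1 - \<theta>) + 1 / (1 - \<theta>) * t)) \<partial>lebesgue)"
    proof (rule nn_integral_mono_AE)
      have eq: "- \<theta> / (1 - \<theta>) + 1 / (1 - \<theta>) * t = (t - \<theta>) / (1 - \<theta>)" for t
        by (simp add: diff_divide_distrib)
      \<comment> \<open>At t = \<theta> the rescaled time is 0, where \<open>J\<close> vanishes
        although \<open>g'\<close> need not; this point has to be discarded.\<close>
      have "AE t in lebesgue. t \<noteq> \<theta>" by (rule AE_completion[OF AE_lborel_singleton])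
      then show "AE t in lebesgue. S t * indicator {\<theta>..} t \<le> ennreal r2 * (g2 (- \<theta> / (1 - \<theta>) + 1 / (1 - \<theta>) * t) * J (- \<theta> / (1 - \<theta>) + 1 / (1 - \<theta>) * t))"
      proof eventually_elim
        case (elim t)
        show ?case unfolding eq
          using s(2)[of t] th elim unfolding S_def J_def g'_def
          by (auto simp: indicator_def field_simps split: if_splits)
      qed
    qed
    also have "\<dots> \<le> ennreal ((1 - \<theta>) * r2) * (\<integral>\<^sup>+t. g2 t \<partial>leb01)"
      by (rule piece) (use th r in auto)
    finally show "(\<integral>\<^sup>+t. s t \<partial>leb01) \<le> ennreal (\<theta> * r1) * (\<integral>\<^sup>+t. g1 t \<partial>leb01) + ennreal ((1 - \<theta>) * r2) * (\<integral>\<^sup>+t. g2 t \<partial>leb01)"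
      by (simp add: add_mono)
  qed
  finally show ?thesis .
qed

lemma nn_integral_unit_reverse_le:
  fixes g :: "real \<Rightarrow> ennreal"
  shows "(\<integral>\<^sup>+t. g (1 - t) \<partial>leb01) \<le> (\<integral>\<^sup>+t. g t \<partial>leb01)"
proof -
  define J where "J = (indicator {0<..<1} :: real \<Rightarrow> ennreal)"
  have unit: "(\<integral>\<^sup>+t. f t \<partial>leb01) = (\<integral>\<^sup>+t. f t * J t \<partial>lebesgue)" for f :: "real \<Rightarrow> ennreal"
    unfolding J_def by (rule nn_integral_restrict_space) simp
  have "J (1 - t) = J t" for t by (auto simp: J_def indicator_def)
  then show ?thesis
    using nn_integral_real_affine_le[of "-1" "\<lambda>t. g t * J t" 1] by (simp add: unit)
qed

section \<open>Fubini on the unit square and continuous functions on the unit interval\<close>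

interpretation unit_pair: pair_sigma_finite leb01 leb01 ..

lemma measurable_ident_unit [measurable]: "(\<lambda>x. x) \<in> borel_measurable leb01"
  by (rule measurable_restrict_space1, rule measurable_completion) simp

lemma unit_pair_integrable:
  fixes F :: "real \<Rightarrow> real \<Rightarrow> 'b::{banach, second_countable_topology}" and g h :: "real \<Rightarrow> real"
  assumes F: "case_prod F \<in> borel_measurable (leb01 \<Otimes>\<^sub>M leb01)"
    and g: "integrable leb01 g" and h: "integrable leb01 h"
    and le: "\<And>x y. norm (F x y) \<le> g x * h y"
  shows "integrable (leb01 \<Otimes>\<^sub>M leb01) (case_prod F)"
proof (rule Bochner_Integration.integrable_bound[OF _ F])
  have [measurable]: "g \<in> borel_measurable leb01" "h \<in> borel_measurable leb01"
    using g h by auto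
  show "integrable (leb01 \<Otimes>\<^sub>M leb01) (\<lambda>p. g (fst p) * h (snd p))"
  proof (rule unit_pair.Fubini_integrable)
    show "(\<lambda>p. g (fst p) * h (snd p)) \<in> borel_measurable (leb01 \<Otimes>\<^sub>M leb01)" by measurable
    show "integrable leb01 (\<lambda>x. LINT y|leb01. norm (g (fst (x, y)) * h (snd (x, y))))"
      using g by (simp add: abs_mult)
    show "AE x in leb01. integrable leb01 (\<lambda>y. g (fst (x, y)) * h (snd (x, y)))"
      using h by simp
  qed
  show "AE p in leb01 \<Otimes>\<^sub>M leb01. norm (case p of (x, y) \<Rightarrow> F x y) \<le> norm (g (fst p) * h (snd p))"
    using le by (auto intro!: AE_I2 order_trans[OF _ abs_ge_self])
qed

lemma continuous_on_L2_unit: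
  fixes f :: "real \<Rightarrow> 'b::{banach, second_countable_topology}"
  assumes "continuous_on {0..1} f"
  shows "f \<in> L2_funs leb01"
proof -
  have "bounded (f ` {0..1})"
    by (rule compact_imp_bounded[OF compact_continuous_image[OF assms compact_Icc]])
  then obtain C where C: "\<And>y. y \<in> f ` {0..1} \<Longrightarrow> norm y \<le> C" unfolding bounded_iff by blast
  show ?thesis
  proof (rule L2_funs_bounded[OF leb01.finite_measure_axioms continuous_on_measurable_unit[OF assms]])
    fix x assume "x \<in> space leb01"
    then have "f x \<in> f ` {0..1}" by (intro imageI) simp
    then show "norm (f x) \<le> C" by (rule C)
  qed
qed

section \<open>Sobolev functions of one variable\<close>

text \<open>The absolutely continuous form of an \<open>H\<^sup>1\<close> function. The increments
  are prescribed on the closed interval, endpoints included, so that \<beta> itself is fixed by one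
  value and its derivative; this is the form that survives gluing, reversal and rescaling.\<close>

definition has_L2_deriv ::
  "(real \<Rightarrow> 'h::{banach, second_countable_topology}) \<Rightarrow> (real \<Rightarrow> 'h) \<Rightarrow> bool" where
  "has_L2_deriv \<beta> v \<longleftrightarrow> v \<in> L2_funs leb01 \<and>
    (\<forall>s t. 0 \<le> s \<longrightarrow> s \<le> t \<longrightarrow> t \<le> 1 \<longrightarrow> \<beta> t - \<beta> s = (LINT x:{s<..<t}|leb01. v x))"

lemma has_L2_derivD:
  assumes "has_L2_deriv \<beta> v"
  shows "v \<in> L2_funs leb01" "integrable leb01 v" "v \<in> borel_measurable leb01"
    "\<And>s t. 0 \<le> s \<Longrightarrow> s \<le> t \<Longrightarrow> t \<le> 1 \<Longrightarrow> (LINT x:{s<..<t}|leb01. v x) = \<beta> t - \<beta> s"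
  using assms L2_funs_integrable[OF leb01.finite_measure_axioms]
  by (auto simp: has_L2_deriv_def L2_funs_def)

lemma set_interval_measurable_unit [measurable]: "{s<..<t::real} \<inter> {0<..<1} \<in> sets leb01"
  by (auto simp: sets_restrict_space_iff)

lemma set_integral_unit_Int:
  "(LINT x:A|leb01. f x) = (LINT x:A \<inter> {0<..<1}|leb01. f x)"
  unfolding set_lebesgue_integral_def
  by (rule Bochner_Integration.integral_cong) (auto simp: indicator_def)

lemma set_integrable_unit:
  fixes f :: "real \<Rightarrow> 'b::{banach, second_countable_topology}"
  assumes "integrable leb01 f"
  shows "integrable leb01 (\<lambda>x. indicator {s<..<t} x *\<^sub>R f x)"
proof -
  have "integrable leb01 (\<lambda>x. indicator ({s<..<t} \<inter> {0<..<1}) x *\<^sub>R f x)"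
    by (rule integrable_mult_indicator[OF _ assms]) measurable
  moreover have "indicat_real ({s<..<t} \<inter> {0<..<1}) x *\<^sub>R f x = indicat_real {s<..<t} x *\<^sub>R f x"
    if "x \<in> space leb01" for x
    using that by (simp add: indicator_def)
  then have "integrable leb01 (\<lambda>x. indicat_real ({s<..<t} \<inter> {0<..<1}) x *\<^sub>R f x) =
      integrable leb01 (\<lambda>x. indicat_real {s<..<t} x *\<^sub>R f x)"
    by (rule Bochner_Integration.integrable_cong[OF refl])
  ultimately show ?thesis by blast
qed

lemma has_L2_deriv_unique:
  fixes \<beta> :: "real \<Rightarrow> 'h::{banach, second_countable_topology}"
  assumes "has_L2_deriv \<beta> v" "has_L2_deriv \<beta> w"
  shows "AE t in leb01. v t = w t"
proof -
  have "AE t in leb01. v t - w t = 0"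
  proof (rule AE_zero_if_interval_integrals_zero)
    show "integrable leb01 (\<lambda>t. v t - w t)"
      using has_L2_derivD(2)[OF assms(1)] has_L2_derivD(2)[OF assms(2)] by simp
    fix s t :: real assume st: "0 \<le> s" "s \<le> t" "t \<le> 1"
    have "(LINT x:{s<..<t}|leb01. v x - w x) =
        (LINT x:{s<..<t}|leb01. v x) - (LINT x:{s<..<t}|leb01. w x)"
      using has_L2_derivD(2)[OF assms(1)] has_L2_derivD(2)[OF assms(2)]
      by (intro set_integral_diff) (simp_all add: set_integrable_def set_integrable_unit)
    then show "(LINT x:{s<..<t}|leb01. v x - w x) = 0"
      using has_L2_derivD(4)[OF assms(1) st] has_L2_derivD(4)[OF assms(2) st] by simp
  qed
  then show ?thesis by simp
qed

text \<open>
  Integrating \<open>v x \<bullet> v y\<close> over the triangle \<open>s < x < y < t\<close> in both orders gives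
  \<open>2 \<integral>\<^sub>s\<^sup>t \<beta> \<bullet> v = \<parallel>\<beta> t\<parallel>\<^sup>2 - \<parallel>\<beta> s\<parallel>\<^sup>2\<close>.
\<close>

lemma has_L2_deriv_orthogonal:
  fixes \<beta> :: "real \<Rightarrow> 'h::{real_inner, banach, second_countable_topology}"
  assumes \<beta>: "has_L2_deriv \<beta> v" and cont: "continuous_on {0..1} \<beta>"
    and nrm: "\<And>t. t \<in> {0..1} \<Longrightarrow> norm (\<beta> t) = 1"
  shows "AE t in leb01. \<beta> t \<bullet> v t = 0"
proof (rule AE_zero_if_interval_integrals_zero)
  have v: "integrable leb01 v" and [measurable]: "v \<in> borel_measurable leb01"
    by (rule has_L2_derivD[OF \<beta>])+
  have b: "\<beta> \<in> L2_funs leb01"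
    by (rule L2_funs_bounded[where C = 1])
      (auto simp: leb01.finite_measure_axioms nrm intro: continuous_on_measurable_unit[OF cont])
  show I: "integrable leb01 (\<lambda>t. \<beta> t \<bullet> v t)"
    by (rule L2_funs_integrable_inner[OF b has_L2_derivD(1)[OF \<beta>]])
  fix s t :: real assume st: "0 \<le> s" "s \<le> t" "t \<le> 1"
  define F where "F x y = (indicator {s<..<t} x * indicator {x<..<t} y) *\<^sub>R (v x \<bullet> v y)" for x y
  \<comment> \<open>The triangle s < x < y < t, rewritten so that x becomes the inner
    variable.\<close>
  have Feq: "F x y = (indicator {s<..<y} x * indicator {s<..<t} y) *\<^sub>R (v x \<bullet> v y)" for x y
    by (auto simp: F_def indicator_def)
  have "case_prod F = (\<lambda>p. (if s < fst p \<and> fst p < snd p \<and> snd p < t then v (fst p) \<bullet> v (snd p) else 0))"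
    by (auto simp: F_def fun_eq_iff indicator_def)
  also have "\<dots> \<in> borel_measurable (leb01 \<Otimes>\<^sub>M leb01)" by measurable
  finally have "integrable (leb01 \<Otimes>\<^sub>M leb01) (case_prod F)"
    by (rule unit_pair_integrable[where g = "\<lambda>x. norm (v x)" and h = "\<lambda>x. norm (v x)"])
      (use v in \<open>auto simp: F_def indicator_def Cauchy_Schwarz_ineq2\<close>)
  then have "(LINT y|leb01. LINT x|leb01. F x y) = (LINT x|leb01. LINT y|leb01. F x y)"
    by (rule unit_pair.Fubini_integral)
  moreover have "(LINT x|leb01. F x y) = indicator {s<..<t} y * ((\<beta> y - \<beta> s) \<bullet> v y)"
    if "y \<in> {0<..<1}" for y
  proof (cases "s < y \<and> y < t")
    case True
    have "(LINT x|leb01. F x y) = (LINT x|leb01. indicator {s<..<y} x *\<^sub>R v x) \<bullet> v y"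
      unfolding Feq using True set_integrable_unit[OF v, of s y]
      by (subst integral_inner_left[symmetric]) auto
    then show ?thesis
      using True has_L2_derivD(4)[OF \<beta>, of s y] st that by (simp add: set_lebesgue_integral_def)
  qed (auto simp: Feq)
  then have "(LINT y|leb01. LINT x|leb01. F x y) = (LINT y|leb01. indicator {s<..<t} y * ((\<beta> y - \<beta> s) \<bullet> v y))"
    by (intro Bochner_Integration.integral_cong) auto
  moreover have "(LINT y|leb01. F x y) = indicator {s<..<t} x * ((\<beta> t - \<beta> x) \<bullet> v x)"
    if "x \<in> {0<..<1}" for x
  proof (cases "s < x \<and> x < t")
    case True
    have "(LINT y|leb01. F x y) = v x \<bullet> (LINT y|leb01. indicator {x<..<t} y *\<^sub>R v y)"
      unfolding F_def using True set_integrable_unit[OF v, of x t]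
      by (subst integral_inner_right[symmetric]) auto
    then show ?thesis
      using True has_L2_derivD(4)[OF \<beta>, of x t] st that by (simp add: set_lebesgue_integral_def inner_commute)
  qed (auto simp: F_def)
  then have "(LINT x|leb01. LINT y|leb01. F x y) = (LINT y|leb01. indicator {s<..<t} y * ((\<beta> t - \<beta> y) \<bullet> v y))"
    by (intro Bochner_Integration.integral_cong) auto
  ultimately have eq: "(LINT y|leb01. indicator {s<..<t} y * ((\<beta> y - \<beta> s) \<bullet> v y)) =
      (LINT y|leb01. indicator {s<..<t} y * ((\<beta> t - \<beta> y) \<bullet> v y))" by simp
  have Iv: "integrable leb01 (\<lambda>y. indicator {s<..<t} y *\<^sub>R v y)" by (rule set_integrable_unit[OF v])
  have Ib: "integrable leb01 (\<lambda>y. indicator {s<..<t} y * (\<beta> y \<bullet> v y))"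
    using set_integrable_unit[OF I, of s t] by simp
  have Iw: "integrable leb01 (\<lambda>y. indicator {s<..<t} y * (w \<bullet> v y))" for w
    using integrable_inner_right[OF Iv, of w] by simp
  have w: "(LINT y|leb01. indicator {s<..<t} y * (w \<bullet> v y)) = w \<bullet> (\<beta> t - \<beta> s)" for w
    using integral_inner_right[OF Iv, of w] has_L2_derivD(4)[OF \<beta> st] by (simp add: set_lebesgue_integral_def)
  have "(LINT y|leb01. indicator {s<..<t} y * (\<beta> y \<bullet> v y)) - \<beta> s \<bullet> (\<beta> t - \<beta> s)
      = \<beta> t \<bullet> (\<beta> t - \<beta> s) - (LINT y|leb01. indicator {s<..<t} y * (\<beta> y \<bullet> v y))"
    using eq Ib Iw by (simp add: inner_diff_left right_diff_distrib w)
  then have "2 * (LINT y|leb01. indicator {s<..<t} y * (\<beta> y \<bullet> v y)) = \<beta> t \<bullet> \<beta> t - \<beta> s \<bullet> \<beta> s"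
    by (simp add: inner_diff_right inner_commute)
  also have "\<dots> = 0" using nrm[of s] nrm[of t] st by (simp flip: power2_norm_eq_inner)
  finally show "(LINT x:{s<..<t}|leb01. \<beta> x \<bullet> v x) = 0"
    by (simp add: set_lebesgue_integral_def)
qed

lemma set_integral_unit_lborel:
  fixes f :: "real \<Rightarrow> 'b::{banach, second_countable_topology}"
  assumes "0 \<le> s" "t \<le> 1" "continuous_on {s..t} f"
  shows "(LINT x:{s<..<t}|leb01. f x) = (LINT x|lborel. indicator {s..t} x *\<^sub>R f x)"
proof -
  have m: "(\<lambda>x. indicator {s..t} x *\<^sub>R f x) \<in> borel_measurable lborel"
    using borel_measurable_continuous_on_indicator[OF _ assms(3)] by simp
  have "(LINT x:{s<..<t}|leb01. f x) = (LINT x|lebesgue. indicator {s<..<t} x *\<^sub>R f x)"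
    unfolding set_lebesgue_integral_def using assms(1,2)
    by (subst integral_restrict_space) (auto intro!: Bochner_Integration.integral_cong simp: indicator_def)
  also have "\<dots> = (LINT x|lebesgue. indicator {s..t} x *\<^sub>R f x)"
  proof (rule integral_cong_AE)
    show "(\<lambda>x. indicator {s..t} x *\<^sub>R f x) \<in> borel_measurable lebesgue"
      using m by (rule measurable_completion)
    have "(\<lambda>x. indicator {s<..<t} x *\<^sub>R (indicator {s..t} x *\<^sub>R f x)) \<in> borel_measurable lborel"
      using m by measurable
    also have "(\<lambda>x. indicator {s<..<t} x *\<^sub>R (indicator {s..t} x *\<^sub>R f x)) = (\<lambda>x. indicator {s<..<t} x *\<^sub>R f x)"
      by (auto simp: indicator_def fun_eq_iff)
    finally show "(\<lambda>x. indicator {s<..<t} x *\<^sub>R f x) \<in> borel_measurable lebesgue"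
      by (rule measurable_completion)
    have "AE x in lebesgue. x \<noteq> s" "AE x in lebesgue. x \<noteq> t"
      by (rule AE_completion[OF AE_lborel_singleton])+
    then show "AE x in lebesgue. indicator {s<..<t} x *\<^sub>R f x = indicator {s..t} x *\<^sub>R f x"
      by eventually_elim (auto simp: indicator_def)
  qed
  also have "\<dots> = (LINT x|lborel. indicator {s..t} x *\<^sub>R f x)" by (rule integral_completion[OF m])
  finally show ?thesis .
qed

lemma set_integral_unit_FTC:
  fixes F f :: "real \<Rightarrow> real"
  assumes "0 \<le> s" "s \<le> t" "t \<le> 1"
    and "\<And>x. x \<in> {s..t} \<Longrightarrow> (F has_real_derivative f x) (at x within {s..t})" "continuous_on {s..t} f"
  shows "(LINT x:{s<..<t}|leb01. f x) = F t - F s"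
  using assms integral_FTC_Icc[of s t F f]
  by (simp add: set_integral_unit_lborel has_real_derivative_iff_has_vector_derivative)

text \<open>Pairing with a fixed vector h reduces the Bochner integral to the real fundamental
  theorem of calculus.\<close>

lemma has_L2_derivI_C1:
  fixes \<gamma> v :: "real \<Rightarrow> 'h::{real_inner, banach, second_countable_topology}"
  assumes d: "\<And>t. t \<in> {0..1} \<Longrightarrow> (\<gamma> has_vector_derivative v t) (at t within {0..1})"
    and v: "continuous_on {0..1} v"
  shows "has_L2_deriv \<gamma> v"
  unfolding has_L2_deriv_def
proof (intro conjI allI impI)
  show vL: "v \<in> L2_funs leb01" by (rule continuous_on_L2_unit[OF v])
  fix s t :: real assume st: "0 \<le> s" "s \<le> t" "t \<le> 1"
  have vI: "integrable leb01 (\<lambda>x. indicator {s<..<t} x *\<^sub>R v x)"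
    by (rule set_integrable_unit[OF L2_funs_integrable[OF leb01.finite_measure_axioms vL]])
  have "(LINT x:{s<..<t}|leb01. v x) \<bullet> h = (\<gamma> t - \<gamma> s) \<bullet> h" for h
  proof -
    have "(LINT x:{s<..<t}|leb01. v x) \<bullet> h = (LINT x:{s<..<t}|leb01. v x \<bullet> h)"
      using integral_inner_left[OF vI, of h] by (simp add: set_lebesgue_integral_def)
    also have "\<dots> = \<gamma> t \<bullet> h - \<gamma> s \<bullet> h"
    proof (rule set_integral_unit_FTC[OF st])
      show "((\<lambda>t. \<gamma> t \<bullet> h) has_real_derivative v x \<bullet> h) (at x within {s..t})" if "x \<in> {s..t}" for x
      proof -
        have "(\<gamma> has_vector_derivative v x) (at x within {s..t})"
          by (rule has_vector_derivative_within_subset[OF d]) (use that st in auto)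
        from bounded_linear.has_vector_derivative[OF bounded_linear_inner_left this]
        show ?thesis by (simp add: has_real_derivative_iff_has_vector_derivative)
      qed
      show "continuous_on {s..t} (\<lambda>x. v x \<bullet> h)"
        by (intro continuous_intros continuous_on_subset[OF v]) (use st in auto)
    qed
    finally show ?thesis by (simp add: inner_diff_left)
  qed
  then show "\<gamma> t - \<gamma> s = (LINT x:{s<..<t}|leb01. v x)"
    by (metis vector_eq_rdot)
qed

section \<open>Weak derivatives from the integral representation\<close>

lemma test_function_deriv_continuous:
  assumes "test_function \<phi>"
  shows "continuous_on S (deriv \<phi>)" "(\<phi> has_real_derivative deriv \<phi> t) (at t within T)"
proof -
  have *: "(deriv ^^ n) \<phi> differentiable (at t)" for n t using assms by (simp add: test_function_def)
  have "deriv \<phi> differentiable (at t)" for t using *[of 1] by simp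
  then show "continuous_on S (deriv \<phi>)"
    by (intro continuous_at_imp_continuous_on ballI differentiable_imp_continuous_within)
  have "(\<phi> has_real_derivative deriv \<phi> t) (at t)"
    using *[of 0] by (simp add: DERIV_deriv_iff_real_differentiable)
  then show "(\<phi> has_real_derivative deriv \<phi> t) (at t within T)" by (rule DERIV_subset) simp
qed

lemma test_function_zero:
  assumes "test_function \<phi>" "t \<notin> {0<..<1}"
  shows "\<phi> t = 0"
  using assms closure_subset[of "{t. \<phi> t \<noteq> 0}"] by (auto simp: test_function_def)

text \<open>Fubini for \<phi>'(y) v(x) over the triangle 0 < x < y < 1: integrating in x first gives
  \<phi>'(y) (\<beta>(y) - \<beta>(0)), integrating in y first gives -\<phi>(x) v(x). The constant
  \<beta>(0) drops out because \<phi>' has integral zero.\<close>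

lemma has_L2_deriv_imp_weak:
  fixes \<beta> :: "real \<Rightarrow> 'h::{real_inner, banach, second_countable_topology}"
  assumes \<beta>: "has_L2_deriv \<beta> v" and cont: "continuous_on {0..1} \<beta>" and \<phi>: "test_function \<phi>"
  shows "(LINT t|leb01. deriv \<phi> t *\<^sub>R \<beta> t) = - (LINT t|leb01. \<phi> t *\<^sub>R v t)"
proof -
  have v: "integrable leb01 v" and vm [measurable]: "v \<in> borel_measurable leb01"
    by (rule has_L2_derivD[OF \<beta>])+
  have [measurable]: "deriv \<phi> \<in> borel_measurable leb01"
    by (intro continuous_on_measurable_unit test_function_deriv_continuous[OF \<phi>])
  have dI: "integrable leb01 (deriv \<phi>)"
    by (intro L2_funs_integrable continuous_on_L2_unit test_function_deriv_continuous[OF \<phi>] leb01.finite_measure_axioms)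
  define F where "F x y = (if 0 < y \<and> y < 1 \<and> 0 < x \<and> x < y then deriv \<phi> y *\<^sub>R v x else 0)" for x y
  have "case_prod F = (\<lambda>p. if 0 < snd p \<and> snd p < 1 \<and> 0 < fst p \<and> fst p < snd p then deriv \<phi> (snd p) *\<^sub>R v (fst p) else 0)"
    by (auto simp: F_def fun_eq_iff)
  also have "\<dots> \<in> borel_measurable (leb01 \<Otimes>\<^sub>M leb01)" by measurable
  finally have "integrable (leb01 \<Otimes>\<^sub>M leb01) (case_prod F)"
    by (rule unit_pair_integrable[where g = "\<lambda>x. norm (v x)" and h = "\<lambda>x. norm (deriv \<phi> x)"])
      (use v dI in \<open>auto simp: F_def\<close>)
  then have "(LINT y|leb01. LINT x|leb01. F x y) = (LINT x|leb01. LINT y|leb01. F x y)"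
    by (rule unit_pair.Fubini_integral)
  moreover have "(LINT x|leb01. F x y) = deriv \<phi> y *\<^sub>R \<beta> y - deriv \<phi> y *\<^sub>R \<beta> 0" if "y \<in> {0<..<1}" for y
  proof -
    have "(LINT x|leb01. F x y) = (LINT x|leb01. deriv \<phi> y *\<^sub>R (indicator {0<..<y} x *\<^sub>R v x))"
      by (rule Bochner_Integration.integral_cong) (use that in \<open>auto simp: F_def indicator_def\<close>)
    also have "\<dots> = deriv \<phi> y *\<^sub>R (LINT x:{0<..<y}|leb01. v x)"
      unfolding set_lebesgue_integral_def by (rule integral_scaleR_right)
    finally show ?thesis using has_L2_derivD(4)[OF \<beta>, of 0 y] that by (simp add: scaleR_diff_right)
  qed
  then have "(LINT y|leb01. LINT x|leb01. F x y) = (LINT y|leb01. deriv \<phi> y *\<^sub>R \<beta> y - deriv \<phi> y *\<^sub>R \<beta> 0)"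
    by (intro Bochner_Integration.integral_cong) auto
  moreover have "(LINT y|leb01. F x y) = - (\<phi> x *\<^sub>R v x)" if "x \<in> {0<..<1}" for x
  proof -
    have "(LINT y|leb01. F x y) = (LINT y|leb01. (indicator {x<..<1} y *\<^sub>R deriv \<phi> y) *\<^sub>R v x)"
      by (rule Bochner_Integration.integral_cong) (use that in \<open>auto simp: F_def indicator_def\<close>)
    also have "\<dots> = (LINT y:{x<..<1}|leb01. deriv \<phi> y) *\<^sub>R v x"
      unfolding set_lebesgue_integral_def using set_integrable_unit[OF dI, of x 1]
      by (intro integral_scaleR_left) auto
    also have "(LINT y:{x<..<1}|leb01. deriv \<phi> y) = \<phi> 1 - \<phi> x"
      by (rule set_integral_unit_FTC) (use that test_function_deriv_continuous[OF \<phi>] in auto)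
    finally show ?thesis using test_function_zero[OF \<phi>, of 1] by simp
  qed
  then have "(LINT x|leb01. LINT y|leb01. F x y) = (LINT y|leb01. - (\<phi> y *\<^sub>R v y))"
    by (intro Bochner_Integration.integral_cong) auto
  moreover have "(LINT y|leb01. deriv \<phi> y *\<^sub>R \<beta> 0) = 0"
  proof -
    have "(LINT y|leb01. deriv \<phi> y) = (LINT y:{0<..<1}|leb01. deriv \<phi> y)"
      unfolding set_lebesgue_integral_def by (rule Bochner_Integration.integral_cong) auto
    also have "\<dots> = \<phi> 1 - \<phi> 0"
      by (rule set_integral_unit_FTC) (use test_function_deriv_continuous[OF \<phi>] in auto)
    also have "\<dots> = 0" using test_function_zero[OF \<phi>] by simp
    finally show ?thesis using dI by simp
  qed
  moreover have "integrable leb01 (\<lambda>y. deriv \<phi> y *\<^sub>R \<beta> y)"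
  proof -
    have "continuous_on {0..1} (\<lambda>y. deriv \<phi> y *\<^sub>R \<beta> y)"
      by (intro continuous_intros cont test_function_deriv_continuous[OF \<phi>])
    then show ?thesis
      by (intro L2_funs_integrable continuous_on_L2_unit leb01.finite_measure_axioms)
  qed
  ultimately show ?thesis using dI by simp
qed

text \<open>
  The functions \<open>p(t) w\<^sup>m exp (-w)\<close> with \<open>w = 1/((t-a)(b-t))\<close>, extended by \<open>0\<close> outside \<open>(a,b)\<close>, are
  closed under differentiation.
\<close>

definition bump :: "real \<Rightarrow> real \<Rightarrow> real poly \<Rightarrow> nat \<Rightarrow> real \<Rightarrow> real" where
  "bump a b p m t = (if a < t \<and> t < b
     then poly p t * (1 / ((t - a) * (b - t))) ^ m * exp (- (1 / ((t - a) * (b - t)))) else 0)"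

text \<open>With v = 1/w one has v' = -w' \<open>v\<^sup>2\<close>, so the derivative of p
  \<open>v ^ m\<close> exp(-v) has terms with the powers m, m + 1 and m + 2 of v. Taking out
  \<open>v ^ (m + 2)\<close> multiplies them by \<open>w\<^sup>2\<close>, w and 1, which is this
  polynomial.\<close>

definition bump_deriv_poly :: "real \<Rightarrow> real \<Rightarrow> real poly \<Rightarrow> nat \<Rightarrow> real poly" where
  "bump_deriv_poly a b p m = (let w = [:-a, 1:] * [:b, -1:] in
     pderiv p * w\<^sup>2 - of_nat m * p * pderiv w * w + p * pderiv w)"

text \<open>A single term of the exponential series, the one of index m + 2, already dominates. The
  two surplus powers of v are what gives quadratic decay at the ends of a bump.\<close>

lemma power_exp_minus_le:
  fixes v :: real
  assumes "v > 0"
  shows "v ^ m * exp (- v) \<le> fact (m + 2) / v\<^sup>2"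
proof -
  have "(\<Sum>n\<in>{m + 2}. v ^ n /\<^sub>R fact n) \<le> (\<Sum>n. v ^ n /\<^sub>R fact n)"
    using assms sums_summable[OF exp_converges[of v]] by (intro sum_le_suminf) auto
  then have "v ^ (m + 2) / fact (m + 2) \<le> exp v"
    using exp_converges[of v] by (simp add: sums_iff divide_real_def mult.commute)
  then have "v ^ (m + 2) \<le> fact (m + 2) * exp v"
    using pos_divide_le_eq[of "fact (m + 2) :: real" "v ^ (m + 2)" "exp v"] by (simp add: mult.commute del: fact_Suc)
  then show ?thesis
    using assms by (simp add: field_simps exp_minus power_add power2_eq_square del: fact_Suc)
qed

lemma has_real_derivative_zero_quadratic:
  fixes f :: "real \<Rightarrow> real"
  assumes "\<And>t. \<bar>f t\<bar> \<le> C * (t - a)\<^sup>2"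
  shows "(f has_real_derivative 0) (at a)"
proof -
  have "f a = 0" using assms[of a] by simp
  have "((\<lambda>h. (f (a + h) - f a) / h) \<longlongrightarrow> 0) (at 0)"
  proof (rule Lim_null_comparison)
    have "\<bar>(f (a + h) - f a) / h\<bar> \<le> C * \<bar>h\<bar>" for h
      using assms[of "a + h"] \<open>f a = 0\<close>
      by (cases "h = 0") (auto simp: abs_divide divide_le_eq power2_eq_square mult.assoc)
    then show "\<forall>\<^sub>F h in at 0. norm ((f (a + h) - f a) / h) \<le> C * \<bar>h\<bar>" by simp
    show "((\<lambda>h. C * \<bar>h\<bar>) \<longlongrightarrow> 0) (at 0)"
      by (rule tendsto_eq_intros refl | simp)+
  qed
  then show ?thesis by (simp add: DERIV_def)
qed

text \<open>The bump is of the order of the square of w = (t - a)(b - t), and inside the interval w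
  is at most b - a times the distance to either endpoint. This makes the extension by zero
  differentiable at both endpoints.\<close>

lemma bump_quadratic_bound:
  assumes "a < b"
  obtains C where "\<And>t. \<bar>bump a b p m t\<bar> \<le> C * (t - a)\<^sup>2" "\<And>t. \<bar>bump a b p m t\<bar> \<le> C * (t - b)\<^sup>2"
proof -
  have "continuous_on {a..b} (poly p)" by (intro continuous_intros)
  then have "bounded (poly p ` {a..b})" by (intro compact_imp_bounded compact_continuous_image) auto
  then obtain D where D: "\<And>y. y \<in> poly p ` {a..b} \<Longrightarrow> \<bar>y\<bar> \<le> D" unfolding bounded_iff by auto
  have "D \<ge> 0" using D[of "poly p a"] assms by force
  define C where "C = D * fact (m + 2) * (b - a)\<^sup>2"
  have C0: "C \<ge> 0" unfolding C_def using \<open>D \<ge> 0\<close> by simp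
  have "\<bar>bump a b p m t\<bar> \<le> C * (t - a)\<^sup>2 \<and> \<bar>bump a b p m t\<bar> \<le> C * (t - b)\<^sup>2" for t
  proof (cases "a < t \<and> t < b")
    case True
    define w where "w = (t - a) * (b - t)"
    have w: "w > 0" unfolding w_def using True by simp
    have "(1 / w) ^ m * exp (- (1 / w)) \<le> fact (m + 2) / (1 / w)\<^sup>2"
      by (rule power_exp_minus_le) (use w in simp)
    also have "\<dots> = fact (m + 2) * w\<^sup>2" by (simp add: power_divide)
    finally have 1: "(1 / w) ^ m * exp (- (1 / w)) \<le> fact (m + 2) * w\<^sup>2" .
    have "\<bar>bump a b p m t\<bar> = \<bar>poly p t\<bar> * ((1 / w) ^ m * exp (- (1 / w)))"
      using True w by (simp add: bump_def abs_mult flip: w_def)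
    also have "\<dots> \<le> D * (fact (m + 2) * w\<^sup>2)"
      using D[of "poly p t"] True w \<open>D \<ge> 0\<close> by (intro mult_mono[OF _ 1]) auto
    finally have 2: "\<bar>bump a b p m t\<bar> \<le> D * fact (m + 2) * w\<^sup>2" by simp
    have "w\<^sup>2 \<le> (b - a)\<^sup>2 * (t - a)\<^sup>2" "w\<^sup>2 \<le> (b - a)\<^sup>2 * (t - b)\<^sup>2"
      unfolding w_def power_mult_distrib using True
      by (auto simp: power2_commute[of t b] mult.commute[of "(t - a)\<^sup>2"] intro!: mult_right_mono power_mono)
    moreover have "D * fact (m + 2) \<ge> 0" using \<open>D \<ge> 0\<close> by simp
    ultimately have "D * fact (m + 2) * w\<^sup>2 \<le> D * fact (m + 2) * ((b - a)\<^sup>2 * (t - a)\<^sup>2)"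
      "D * fact (m + 2) * w\<^sup>2 \<le> D * fact (m + 2) * ((b - a)\<^sup>2 * (t - b)\<^sup>2)"
      by (auto intro!: mult_left_mono simp del: fact_Suc)
    then show ?thesis using 2 unfolding C_def by (simp only: mult.assoc) linarith
  next
    case False
    then have "bump a b p m t = 0" unfolding bump_def by (rule if_not_P)
    then show ?thesis using C0 by simp
  qed
  then show ?thesis using that by blast
qed

lemma bump_deriv:
  assumes "a < b"
  shows "(bump a b p m has_real_derivative bump a b (bump_deriv_poly a b p m) (m + 2) t) (at t)"
proof -
  consider "a < t" "t < b" | "t < a" | "t > b" | "t = a" | "t = b" by linarith
  then show ?thesis
  proof cases
    case 1
    define w where "w = (\<lambda>t. (t - a) * (b - t))"
    define v where "v = (\<lambda>t. 1 / w t)"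
    have w: "w t > 0" using 1 by (simp add: w_def)
    have wv: "w t * v t = 1" using w by (simp add: v_def)
    define w' where "w' = (b - t) - (t - a)"
    have dw: "(w has_real_derivative w') (at t)"
      unfolding w_def w'_def by (auto intro!: derivative_eq_intros)
    have dv: "(v has_real_derivative - w' * (v t)\<^sup>2) (at t)"
      unfolding v_def using w
      by (auto intro!: derivative_eq_intros dw simp: power2_eq_square field_simps)
    have dm: "((\<lambda>t. v t ^ m) has_real_derivative - (of_nat m * w' * v t ^ (m + 1))) (at t)"
      using DERIV_power[OF dv, of m] by (cases m) (simp_all add: power2_eq_square algebra_simps)
    have de: "((\<lambda>t. exp (- v t)) has_real_derivative exp (- v t) * (w' * (v t)\<^sup>2)) (at t)"
      by (rule derivative_eq_intros dv refl | simp)+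
    define e where "e = exp (- v t)"
    have wp: "poly ([:- a, 1:] * [:b, - 1:]) t = w t" by (simp add: w_def algebra_simps)
    have wp': "poly (pderiv ([:- a, 1:] * [:b, - 1:])) t = w'" by (simp add: w'_def pderiv_mult pderiv_pCons algebra_simps)
    have "((\<lambda>t. poly p t * v t ^ m * exp (- v t)) has_real_derivative
       (poly (pderiv p) t * v t ^ m + - (of_nat m * w' * v t ^ (m + 1)) * poly p t) * exp (- v t)
         + exp (- v t) * (w' * (v t)\<^sup>2) * (poly p t * v t ^ m)) (at t)"
      by (intro DERIV_mult dm de poly_DERIV)
    moreover have "(poly (pderiv p) t * v t ^ m + - (of_nat m * w' * v t ^ (m + 1)) * poly p t) * exp (- v t)
         + exp (- v t) * (w' * (v t)\<^sup>2) * (poly p t * v t ^ m)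
      = bump a b (bump_deriv_poly a b p m) (m + 2) t"
    proof -
      have gen: "poly (pderiv p * u\<^sup>2 - of_nat m * p * pderiv u * u + p * pderiv u) t =
          poly (pderiv p) t * (poly u t)\<^sup>2 - of_nat m * poly p t * poly (pderiv u) t * poly u t + poly p t * poly (pderiv u) t"
        for u by (simp add: algebra_simps)
      have q: "poly (bump_deriv_poly a b p m) t =
          poly (pderiv p) t * (w t)\<^sup>2 - of_nat m * poly p t * w' * w t + poly p t * w'"
        unfolding bump_deriv_poly_def Let_def gen wp wp' by simp
      have "bump a b (bump_deriv_poly a b p m) (m + 2) t = poly (bump_deriv_poly a b p m) t * v t ^ (m + 2) * e"
        using 1 by (simp add: bump_def e_def v_def w_def)
      also have "\<dots> = (poly (pderiv p) t * (w t * v t)\<^sup>2 * v t ^ m - of_nat m * poly p t * w' * (w t * v t) * v t ^ (m + 1)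
          + poly p t * w' * v t ^ (m + 2)) * e"
        unfolding q by (simp add: algebra_simps power2_eq_square)
      finally show ?thesis unfolding wv e_def by (simp add: algebra_simps power2_eq_square)
    qed
    moreover have "((\<lambda>t. poly p t * v t ^ m * exp (- v t)) has_real_derivative D) (at t) \<longleftrightarrow> 
       (bump a b p m has_real_derivative D) (at t)" for D
    proof (rule DERIV_cong_ev[OF refl _ refl])
      have "\<forall>\<^sub>F x in nhds t. x \<in> {a<..<b}" using 1 by (intro eventually_nhds_in_open) auto
      then show "\<forall>\<^sub>F x in nhds t. poly p x * v x ^ m * exp (- v x) = bump a b p m x"
        by eventually_elim (simp add: bump_def v_def w_def)
    qed
    ultimately show ?thesis by simp
  next
    case 2
    have "\<forall>\<^sub>F x in nhds t. x \<in> {..<a}" using 2 by (intro eventually_nhds_in_open) auto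
    then have "\<forall>\<^sub>F x in nhds t. bump a b p m x = 0" by eventually_elim (simp add: bump_def)
    then have "(bump a b p m has_real_derivative 0) (at t)" by (subst DERIV_cong_ev[OF refl _ refl]) auto
    then show ?thesis using 2 by (simp add: bump_def)
  next
    case 3
    have "\<forall>\<^sub>F x in nhds t. x \<in> {b<..}" using 3 by (intro eventually_nhds_in_open) auto
    then have "\<forall>\<^sub>F x in nhds t. bump a b p m x = 0" by eventually_elim (simp add: bump_def)
    then have "(bump a b p m has_real_derivative 0) (at t)" by (subst DERIV_cong_ev[OF refl _ refl]) auto
    then show ?thesis using 3 by (simp add: bump_def)
  next
    case 4
    obtain C where "\<And>t. \<bar>bump a b p m t\<bar> \<le> C * (t - a)\<^sup>2" using bump_quadratic_bound[OF assms] by blast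
    then have "(bump a b p m has_real_derivative 0) (at a)" by (rule has_real_derivative_zero_quadratic)
    then show ?thesis using 4 by (simp add: bump_def[of a b _ _ a])
  next
    case 5
    obtain C where "\<And>t. \<bar>bump a b p m t\<bar> \<le> C * (t - b)\<^sup>2" using bump_quadratic_bound[OF assms] by blast
    then have "(bump a b p m has_real_derivative 0) (at b)" by (rule has_real_derivative_zero_quadratic)
    then show ?thesis using 5 by (simp add: bump_def[of a b _ _ b])
  qed
qed

text \<open>Two bumps are carried along because the derivative of a test function has integral zero:
  a positive bump has to be balanced by a negative one elsewhere.\<close>

lemma bump_add_iterated_deriv:
  assumes "a < b" "a' < b'"
  shows "(deriv ^^ n) (\<lambda>t. bump a b p m t + bump a' b' p' m' t) differentiable (at t)"
proof -
  define F where "F q k q' k' = (\<lambda>t. bump a b q k t + bump a' b' q' k' t)" for q k q' k'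
  have d: "(F q k q' k' has_real_derivative F (bump_deriv_poly a b q k) (k + 2) (bump_deriv_poly a' b' q' k') (k' + 2) t) (at t)"
    for q k q' k' t
    unfolding F_def by (intro DERIV_add bump_deriv assms)
  have "\<exists>q k q' k'. (deriv ^^ n) (F p m p' m') = F q k q' k'"
  proof (induction n)
    case 0
    show ?case unfolding funpow_0 by blast
  next
    case (Suc n)
    then obtain q k q' k' where *: "(deriv ^^ n) (F p m p' m') = F q k q' k'" by blast
    have "deriv (F q k q' k') = F (bump_deriv_poly a b q k) (k + 2) (bump_deriv_poly a' b' q' k') (k' + 2)"
      by (rule ext, rule DERIV_imp_deriv, rule d)
    then have "(deriv ^^ Suc n) (F p m p' m') = F (bump_deriv_poly a b q k) (k + 2) (bump_deriv_poly a' b' q' k') (k' + 2)"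
      by (simp only: funpow.simps o_apply *)
    then show ?case by blast
  qed
  then obtain q k q' k' where eq: "(deriv ^^ n) (F p m p' m') = F q k q' k'" by blast
  have "(deriv ^^ n) (F p m p' m') differentiable (at t)"
    unfolding eq real_differentiable_def by (rule exI, rule d)
  then show ?thesis unfolding F_def .
qed

lemma bump_nonneg: "bump a b [:1:] 0 t \<ge> 0"
  by (simp add: bump_def)

lemma bump_const: "bump a b [:c:] 0 t = c * bump a b [:1:] 0 t"
  by (simp add: bump_def)

lemma bump_continuous: "a < b \<Longrightarrow> continuous_on S (bump a b p m)"
  by (intro continuous_at_imp_continuous_on ballI DERIV_isCont[OF bump_deriv])

lemma bump_integrable: "a < b \<Longrightarrow> integrable leb01 (bump a b p m)"
  by (intro L2_funs_integrable continuous_on_L2_unit bump_continuous leb01.finite_measure_axioms)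

lemma bump_integral_pos:
  assumes "0 < a" "a < b" "b < 1"
  shows "0 < (LINT t|leb01. bump a b [:1:] 0 t)"
proof (rule ccontr)
  assume "\<not> ?thesis"
  moreover have "(LINT t|leb01. bump a b [:1:] 0 t) \<ge> 0" by (simp add: bump_nonneg)
  ultimately have "(LINT t|leb01. bump a b [:1:] 0 t) = 0" by simp
  then have "AE t in leb01. bump a b [:1:] 0 t = 0"
    using integral_nonneg_eq_0_iff_AE[OF bump_integrable[OF assms(2)]] by (simp add: bump_nonneg)
  then have "AE t in leb01. t \<notin> {a<..<b}"
    by eventually_elim (auto simp: bump_def)
  moreover have S: "{a<..<b} \<in> sets leb01"
    using assms by (subst sets_restrict_space_iff) auto
  ultimately have "emeasure leb01 {a<..<b} = 0"
    by (simp add: AE_iff_null_sets[symmetric] null_setsD1 del: greaterThanLessThan_iff)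
  moreover have "emeasure leb01 {a<..<b} = ennreal (b - a)"
    using assms by (subst emeasure_restrict_space) auto
  ultimately show False using assms by simp
qed

text \<open>The antiderivative vanishes to the left of both bumps and is constant to the right of
  them; the zero integral makes that constant 0, so the support stays inside the open unit
  interval.\<close>

lemma test_function_antiderivative_bump_add:
  assumes ab: "0 < a" "a < b" "b < 1" and ab': "0 < a'" "a' < b'" "b' < 1"
    and G: "G = (\<lambda>t. bump a b p m t + bump a' b' p' m' t)"
    and z: "(LINT t|leb01. G t) = 0"
  shows "\<exists>\<phi>. test_function \<phi> \<and> deriv \<phi> = G"
proof -
  \<comment> \<open>Any starting point left of both bumps gives the same values on the unit
    interval; with -1 every t \<ge> \<open>A\<close> is an interior point of
    \<open>{-1..t + 1}\<close>.\<close>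
  define \<phi> where "\<phi> t = integral {-1..t} G" for t
  define A where "A = min a a'"
  define B where "B = max b b'"
  have AB: "0 < A" "A < B" "B < 1" using ab ab' by (auto simp: A_def B_def)
  have Gc: "continuous_on S G" for S
    unfolding G using ab ab' by (intro continuous_intros bump_continuous)
  have G0: "G t = 0" if "t \<le> A \<or> B \<le> t" for t
    using that by (auto simp: G bump_def A_def B_def)
  have left: "\<phi> t = 0" if "t \<le> A" for t
  proof -
    have "integral {-1..t} G = integral {-1..t} (\<lambda>_. 0)"
      by (rule Henstock_Kurzweil_Integration.integral_cong) (use that G0 in auto)
    then show ?thesis by (simp add: \<phi>_def)
  qed
  have d: "(\<phi> has_real_derivative G t) (at t)" for t
  proof (cases "t < A")
    case True
    have "\<forall>\<^sub>F x in nhds t. x \<in> {..<A}" using True by (intro eventually_nhds_in_open) auto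
    then have "\<forall>\<^sub>F x in nhds t. \<phi> x = 0" by eventually_elim (simp add: left)
    then have "(\<phi> has_real_derivative 0) (at t)" by (subst DERIV_cong_ev[OF refl _ refl]) auto
    then show ?thesis using True G0 by simp
  next
    case False
    have "((\<lambda>u. integral {-1..u} G) has_real_derivative G t) (at t within {-1..t + 1})"
      by (rule integral_has_real_derivative[OF Gc]) (use False AB in auto)
    then show ?thesis
      unfolding \<phi>_def using False AB
      by (subst (asm) at_within_interior) auto
  qed
  have "\<phi> 1 - \<phi> 0 = (LINT t:{0<..<1}|leb01. G t)"
    by (rule set_integral_unit_FTC[symmetric]) (auto intro: DERIV_subset[OF d] Gc)
  also have "\<dots> = (LINT t|leb01. G t)"
    unfolding set_lebesgue_integral_def by (rule Bochner_Integration.integral_cong) auto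
  finally have \<phi>1: "\<phi> 1 = 0" using z left[of 0] AB by simp
  have "\<exists>c. \<forall>x\<in>{B..}. \<phi> x = c"
  proof (rule has_field_derivative_zero_constant)
    show "(\<phi> has_field_derivative 0) (at x within {B..})" if "x \<in> {B..}" for x
      using DERIV_subset[OF d[of x], of "{B..}"] G0[of x] that by auto
  qed simp
  then have right: "\<phi> t = 0" if "t \<ge> B" for t
    using that \<phi>1 AB by (metis atLeast_iff less_imp_le)
  have "{t. \<phi> t \<noteq> 0} \<subseteq> {A..B}" using left right by (auto simp: not_less[symmetric] intro: ccontr less_imp_le)
  then have "closure {t. \<phi> t \<noteq> 0} \<subseteq> {A..B}" by (intro closure_minimal) auto
  also have "\<dots> \<subseteq> {0<..<1}" using AB by auto
  finally have supp: "closure {t. \<phi> t \<noteq> 0} \<subseteq> {0<..<1}" .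
  have dG: "deriv \<phi> = G" using DERIV_imp_deriv[OF d] by auto
  have "(deriv ^^ n) \<phi> differentiable (at t)" for n t
  proof (cases n)
    case 0
    then show ?thesis using d by (auto simp: real_differentiable_def)
  next
    case (Suc k)
    then have "(deriv ^^ n) \<phi> = (deriv ^^ k) G" by (simp add: funpow_Suc_right dG del: funpow.simps)
    then show ?thesis unfolding G using bump_add_iterated_deriv[OF ab(2) ab'(2)] by simp
  qed
  then show ?thesis using supp dG by (auto simp: test_function_def)
qed

section \<open>From the weak derivative back to the integral representation\<close>

lemma continuous_on_primitive_unit:
  fixes v :: "real \<Rightarrow> 'h::{banach, second_countable_topology}"
  assumes v: "integrable leb01 v"
  shows "continuous_on {0..1} (\<lambda>t. LINT x:{0<..<t}|leb01. v x)"
  unfolding continuous_on_sequentially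
proof (intro allI ballI impI, elim conjE)
  fix X :: "nat \<Rightarrow> real" and a assume X: "X \<longlonglongrightarrow> a"
  have [measurable]: "v \<in> borel_measurable leb01" using v by auto
  show "((\<lambda>t. LINT x:{0<..<t}|leb01. v x) \<circ> X) \<longlonglongrightarrow> (LINT x:{0<..<a}|leb01. v x)"
    unfolding set_lebesgue_integral_def o_def
  proof (rule integral_dominated_convergence[where w = "\<lambda>x. norm (v x)"])
    show "(\<lambda>x. indicat_real {0<..<a} x *\<^sub>R v x) \<in> borel_measurable leb01"
      "\<And>i. (\<lambda>x. indicat_real {0<..<X i} x *\<^sub>R v x) \<in> borel_measurable leb01"
      using set_integrable_unit[OF v] by auto
    show "integrable leb01 (\<lambda>x. norm (v x))" using v by simp
    show "AE x in leb01. norm (indicat_real {0<..<X i} x *\<^sub>R v x) \<le> norm (v x)" for i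
      by (auto simp: indicator_def)
    \<comment> \<open>The indicators of the intervals ending at \<open>X i\<close> can fail to
      converge only at x = a.\<close>
    have "AE x in lebesgue. x \<noteq> a" by (rule AE_completion[OF AE_lborel_singleton])
    then have "AE x in leb01. x \<noteq> a"
      by (subst AE_restrict_space_iff) (auto elim: eventually_mono)
    then show "AE x in leb01. (\<lambda>i. indicat_real {0<..<X i} x *\<^sub>R v x) \<longlonglongrightarrow> indicat_real {0<..<a} x *\<^sub>R v x"
    proof eventually_elim
      case (elim x)
      have "\<forall>\<^sub>F i in sequentially. indicat_real {0<..<X i} x = indicat_real {0<..<a} x"
      proof (cases "x < a")
        case True
        then have "\<forall>\<^sub>F i in sequentially. x < X i" by (rule order_tendstoD(1)[OF X])
        then show ?thesis by eventually_elim (use True in \<open>auto simp: indicator_def\<close>)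
      next
        case False
        then have "\<forall>\<^sub>F i in sequentially. X i < x" using elim by (intro order_tendstoD(2)[OF X]) auto
        then show ?thesis by eventually_elim (use False in \<open>auto simp: indicator_def\<close>)
      qed
      then show ?case by (intro tendsto_eventually) (auto elim: eventually_mono)
    qed
  qed
qed

lemma primitive_has_L2_deriv:
  fixes v :: "real \<Rightarrow> 'h::{banach, second_countable_topology}"
  assumes "v \<in> L2_funs leb01"
  shows "has_L2_deriv (\<lambda>t. LINT x:{0<..<t}|leb01. v x) v"
  unfolding has_L2_deriv_def
proof (intro conjI allI impI)
  have v: "integrable leb01 v" by (rule L2_funs_integrable[OF leb01.finite_measure_axioms assms])
  fix s t :: real assume st: "0 \<le> s" "s \<le> t" "t \<le> 1"
  have I: "integrable leb01 (\<lambda>x. indicat_real {l<..<u} x *\<^sub>R v x)" for l u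
    by (rule set_integrable_unit[OF v])
  have "AE x in lebesgue. x \<noteq> s" by (rule AE_completion[OF AE_lborel_singleton])
  then have "AE x in leb01. x \<noteq> s"
    by (subst AE_restrict_space_iff) (auto elim: eventually_mono)
  then have "AE x in leb01. indicat_real {0<..<t} x *\<^sub>R v x - indicat_real {0<..<s} x *\<^sub>R v x
      = indicat_real {s<..<t} x *\<^sub>R v x"
    using AE_space
  proof eventually_elim
    case (elim x)
    then show ?case using st by (cases "x < s") (auto simp: indicator_def)
  qed
  then have "(LINT x|leb01. indicat_real {0<..<t} x *\<^sub>R v x - indicat_real {0<..<s} x *\<^sub>R v x)
        = (LINT x|leb01. indicat_real {s<..<t} x *\<^sub>R v x)"
    by (intro integral_cong_AE borel_measurable_integrable Bochner_Integration.integrable_diff I)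
  then show "(LINT x:{0<..<t}|leb01. v x) - (LINT x:{0<..<s}|leb01. v x) = (LINT x:{s<..<t}|leb01. v x)"
    unfolding set_lebesgue_integral_def by (simp only: Bochner_Integration.integral_diff[OF I I])
qed (rule assms)

lemma continuous_on_unit_nbhd:
  fixes p :: "real \<Rightarrow> real"
  assumes p: "continuous_on {0..1} p" and r: "r \<in> {0<..<1}" and e: "e > 0"
  obtains a b where "0 < a" "a < b" "b < 1" "\<And>x. x \<in> {a<..<b} \<Longrightarrow> \<bar>p x - p r\<bar> < e"
proof -
  have "r \<in> {0..1}" using r by simp
  then obtain d where d: "d > 0" "\<And>x. x \<in> {0..1} \<Longrightarrow> dist x r < d \<Longrightarrow> dist (p x) (p r) < e"
    using p e unfolding continuous_on_iff by blast
  define k where "k = min d (min (r / 2) ((1 - r) / 2))"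
  have k: "0 < k" "k \<le> d" "k \<le> r / 2" "k \<le> (1 - r) / 2" using d(1) r unfolding k_def by (simp, simp, linarith, linarith)
  show thesis
  proof (rule that[of "r - k" "r + k"])
    fix x assume x: "x \<in> {r - k<..<r + k}"
    then have "x \<in> {0..1}" "dist x r < d" using k r by (auto simp: dist_real_def)
    then show "\<bar>p x - p r\<bar> < e" using d(2) by (simp add: dist_real_def)
  qed (use k r in auto)
qed

text \<open>The du Bois-Reymond argument: the difference \<open>W\<close> of \<beta> and the
  primitive of v has weak derivative zero. Testing it against a unit-mass bump near s minus a
  unit-mass bump near t compares its values at s and t, so it is constant.\<close>

lemma continuous_weak_deriv_imp_L2_deriv:
  fixes \<beta> v :: "real \<Rightarrow> 'h::{real_inner, banach, second_countable_topology}"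
  assumes vL: "v \<in> L2_funs leb01" and cont: "continuous_on {0..1} \<beta>"
    and weak: "\<And>\<phi>. test_function \<phi> \<Longrightarrow>
      (LINT t|leb01. deriv \<phi> t *\<^sub>R \<beta> t) = - (LINT t|leb01. \<phi> t *\<^sub>R v t)"
  shows "has_L2_deriv \<beta> v"
proof -
  define V where "V t = (LINT x:{0<..<t}|leb01. v x)" for t
  define W where "W t = \<beta> t - V t" for t
  have v: "integrable leb01 v" by (rule L2_funs_integrable[OF leb01.finite_measure_axioms vL])
  have V: "has_L2_deriv V v" unfolding V_def by (rule primitive_has_L2_deriv[OF vL])
  have Vc: "continuous_on {0..1} V" unfolding V_def by (rule continuous_on_primitive_unit[OF v])
  have Wc: "continuous_on {0..1} W" unfolding W_def by (intro continuous_intros cont Vc)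
  have cI: "integrable leb01 f" if "continuous_on {0..1} f" for f :: "real \<Rightarrow> 'z::{banach, second_countable_topology}"
    using that by (intro L2_funs_integrable continuous_on_L2_unit leb01.finite_measure_axioms)
  have W0: "(LINT t|leb01. deriv \<phi> t * (W t \<bullet> h)) = 0" if "test_function \<phi>" for \<phi> h
  proof -
    note tc = test_function_deriv_continuous(1)[OF that]
    have "(LINT t|leb01. deriv \<phi> t *\<^sub>R W t) = 0"
      using weak[OF that] has_L2_deriv_imp_weak[OF V Vc that]
        cI[of "\<lambda>t. deriv \<phi> t *\<^sub>R \<beta> t"] cI[of "\<lambda>t. deriv \<phi> t *\<^sub>R V t"]
      by (simp add: W_def scaleR_diff_right continuous_on_scaleR tc cont Vc)
    moreover have "integrable leb01 (\<lambda>t. deriv \<phi> t *\<^sub>R W t)"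
      by (intro cI continuous_on_scaleR tc Wc)
    from integral_inner_left[OF this, of h]
    have "(LINT t|leb01. deriv \<phi> t * (W t \<bullet> h)) = (LINT t|leb01. deriv \<phi> t *\<^sub>R W t) \<bullet> h" by simp
    ultimately show ?thesis by simp
  qed
  have le: "W s \<bullet> h \<le> W t \<bullet> h" if st: "s \<in> {0<..<1}" "t \<in> {0<..<1}" for s t h
  proof (rule ccontr)
    assume neg: "\<not> ?thesis"
    define p where "p r = W r \<bullet> h" for r
    have pc: "continuous_on {0..1} p" unfolding p_def by (intro continuous_intros Wc)
    \<comment> \<open>A third of the gap: near s the values stay above p(s) - e, near t below p(t) +
      e, and these two levels are still e apart.\<close>
    define e where "e = (p s - p t) / 3"
    have e: "e > 0" using neg by (simp add: e_def p_def)
    obtain a b where ab: "0 < a" "a < b" "b < 1" "\<And>x. x \<in> {a<..<b} \<Longrightarrow> p s - e \<le> p x"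
      using continuous_on_unit_nbhd[OF pc st(1) e] by (smt (verit, best))
    obtain a' b' where ab': "0 < a'" "a' < b'" "b' < 1" "\<And>x. x \<in> {a'<..<b'} \<Longrightarrow> p x < p t + e"
      using continuous_on_unit_nbhd[OF pc st(2) e] by (smt (verit, best))
    define I where "I = (LINT t|leb01. bump a b [:1:] 0 t)"
    define I' where "I' = (LINT t|leb01. bump a' b' [:1:] 0 t)"
    have I: "I > 0" "I' > 0" unfolding I_def I'_def using bump_integral_pos ab ab' by blast+
    note bI = bump_integrable[OF ab(2), of "[:1:]" 0] bump_integrable[OF ab'(2), of "[:1:]" 0]
    \<comment> \<open>Both bumps are normalized to mass one, so \<open>G\<close> has integral zero
      and is the derivative of a test function.\<close>
    define G where "G = (\<lambda>t. bump a b [:1 / I:] 0 t + bump a' b' [:- 1 / I':] 0 t)"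
    have Geq: "G t = bump a b [:1:] 0 t / I - bump a' b' [:1:] 0 t / I'" for t
      unfolding G_def by (subst bump_const, subst (2) bump_const) simp
    have "(LINT t|leb01. G t) = 0"
      unfolding Geq using bI I by (simp flip: I_def I'_def)
    from test_function_antiderivative_bump_add[OF ab(1-3) ab'(1-3) G_def this]
    obtain \<phi> where \<phi>: "test_function \<phi>" "deriv \<phi> = G" by blast
    have z: "(LINT t|leb01. G t * p t) = 0" using W0[OF \<phi>(1), of h] \<phi>(2) by (simp add: p_def)
    have pI: "integrable leb01 (\<lambda>x. bump c d [:1:] 0 x * p x)" if "c < d" for c d
      by (intro cI continuous_intros bump_continuous that pc)
    have dec: "(LINT t|leb01. G t * p t) =
        (LINT t|leb01. bump a b [:1:] 0 t * p t) / I - (LINT t|leb01. bump a' b' [:1:] 0 t * p t) / I'"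
    proof -
      have "(LINT t|leb01. G t * p t) = (LINT t|leb01. bump a b [:1:] 0 t * p t / I - bump a' b' [:1:] 0 t * p t / I')"
        by (simp add: Geq left_diff_distrib)
      then show ?thesis using pI[OF ab(2)] pI[OF ab'(2)] by simp
    qed
    have "I * (p s - e) \<le> (LINT t|leb01. bump a b [:1:] 0 t * p t)"
    proof -
      have "I * (p s - e) = (LINT t|leb01. bump a b [:1:] 0 t * (p s - e))" by (simp add: I_def)
      also have "\<dots> \<le> (LINT t|leb01. bump a b [:1:] 0 t * p t)"
      proof (rule integral_mono)
        fix x show "bump a b [:1:] 0 x * (p s - e) \<le> bump a b [:1:] 0 x * p x"
          using ab(4)[of x] bump_nonneg[of a b x] by (cases "x \<in> {a<..<b}") (auto simp: mult_left_mono bump_def)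
      qed (use bI pI[OF ab(2)] in auto)
      finally show ?thesis .
    qed
    then have l1: "p s - e \<le> (LINT t|leb01. bump a b [:1:] 0 t * p t) / I"
      using I by (simp add: le_divide_eq mult.commute)
    have "(LINT t|leb01. bump a' b' [:1:] 0 t * p t) \<le> I' * (p t + e)"
    proof -
      have "(LINT x|leb01. bump a' b' [:1:] 0 x * p x) \<le> (LINT x|leb01. bump a' b' [:1:] 0 x * (p t + e))"
      proof (rule integral_mono)
        fix x show "bump a' b' [:1:] 0 x * p x \<le> bump a' b' [:1:] 0 x * (p t + e)"
          using ab'(4)[of x] bump_nonneg[of a' b' x] by (cases "x \<in> {a'<..<b'}") (auto simp: mult_left_mono bump_def)
      qed (use bI pI[OF ab'(2)] in auto)
      then show ?thesis by (simp add: I'_def)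
    qed
    then have l2: "(LINT t|leb01. bump a' b' [:1:] 0 t * p t) / I' \<le> p t + e"
      using I by (simp add: divide_le_eq mult.commute)
    have "p s - e \<le> p t + e"
      using order_trans[OF l1, OF order_trans[OF eq_refl l2]] dec z by simp
    moreover have "3 * e = p s - p t" by (simp add: e_def)
    ultimately show False using e by linarith
  qed
  have const: "W s = W t" if "s \<in> {0<..<1}" "t \<in> {0<..<1}" for s t
    using le[OF that] le[OF that(2) that(1)] by (metis order_antisym vector_eq_rdot)
  have "W t = W (1/2)" if t: "t \<in> {0..1}" for t
  proof -
    \<comment> \<open>Test functions see only the open interval; the endpoints are reached by
      continuity of \<open>W\<close>.\<close>
    have "closure {0<..<1::real} = {0..1}" by simp
    then have c: "continuous_on (closure {0<..<1}) W" "t \<in> closure {0<..<1::real}" using Wc t by simp_all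
    show ?thesis
    proof (rule continuous_constant_on_closure[OF c(1) _ c(2)])
      show "W x = W (1/2)" if "x \<in> {0<..<1}" for x by (rule const[OF that]) simp
    qed
  qed
  then have W: "W t = W s" if "t \<in> {0..1}" "s \<in> {0..1}" for s t using that by metis
  have "\<beta> t - \<beta> s = (LINT x:{s<..<t}|leb01. v x)" if "0 \<le> s" "s \<le> t" "t \<le> 1" for s t
  proof -
    have "W t = W s" by (rule W) (use that in auto)
    then have "\<beta> t - \<beta> s = V t - V s" by (simp add: W_def algebra_simps)
    then show ?thesis using has_L2_derivD(4)[OF V that] by simp
  qed
  then show ?thesis using vL by (simp add: has_L2_deriv_def)
qed

theorem has_sobolev_deriv_iff:
  fixes \<beta> v :: "real \<Rightarrow> 'h::{real_inner, banach, second_countable_topology}"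
  assumes "continuous_on {0..1} \<beta>"
  shows "has_sobolev_deriv \<beta> v \<longleftrightarrow> has_L2_deriv \<beta> v"
proof
  show "has_L2_deriv \<beta> v" if "has_sobolev_deriv \<beta> v"
    using that assms by (intro continuous_weak_deriv_imp_L2_deriv) (auto simp: has_sobolev_deriv_def)
  show "has_sobolev_deriv \<beta> v" if "has_L2_deriv \<beta> v"
    using has_L2_derivD(1)[OF that] has_L2_deriv_imp_weak[OF that assms] continuous_on_L2_unit[OF assms]
    by (auto simp: has_sobolev_deriv_def)
qed

section \<open>Concatenation and reversal\<close>

lemma measurable_affine_lebesgue:
  fixes f :: "real \<Rightarrow> 'b::topological_space"
  assumes "f \<in> borel_measurable lebesgue" "m \<noteq> 0"
  shows "(\<lambda>x. f (l + m * x)) \<in> borel_measurable lebesgue"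
proof -
  have "(\<lambda>x. l + m * x) \<in> lebesgue \<rightarrow>\<^sub>M lebesgue"
    using lebesgue_affine_measurable[where c = "\<lambda>x::real. m" and t = l] assms(2) by simp
  then show ?thesis by (rule measurable_compose[OF _ assms(1)])
qed

lemma integrable_affine_lebesgue:
  fixes f :: "real \<Rightarrow> 'b::{banach, second_countable_topology}"
  assumes f: "integrable lebesgue f" and m: "m \<noteq> 0"
  shows "integrable lebesgue (\<lambda>x. f (l + m * x))"
proof (rule integrableI_bounded)
  have fm: "f \<in> borel_measurable lebesgue" using f by simp
  then show "(\<lambda>x. f (l + m * x)) \<in> borel_measurable lebesgue" by (rule measurable_affine_lebesgue[OF _ m])
  have nm: "(\<lambda>x. ennreal (norm (f x))) \<in> borel_measurable lebesgue" using fm by measurable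
  have "ennreal \<bar>m\<bar> * (\<integral>\<^sup>+x. norm (f (l + m * x)) \<partial>lebesgue) < \<infinity>"
    using nn_integral_real_affine_lebesgue[OF nm m, of l] f by (simp add: integrable_iff_bounded)
  then show "(\<integral>\<^sup>+x. norm (f (l + m * x)) \<partial>lebesgue) < \<infinity>"
    using m by (auto simp: ennreal_mult_less_top)
qed

lemma integral_affine_lebesgue:
  fixes f :: "real \<Rightarrow> 'b::{banach, second_countable_topology}"
  assumes f: "f \<in> borel_measurable lebesgue" and m: "m \<noteq> 0"
  shows "(LINT x|lebesgue. f x) = \<bar>m\<bar> *\<^sub>R (LINT x|lebesgue. f (l + m * x))"
proof -
  have T: "(\<lambda>x. l + m * x) \<in> lebesgue \<rightarrow>\<^sub>M lebesgue"
    using lebesgue_affine_measurable[where c = "\<lambda>x::real. m" and t = l] m by simp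
  have "(LINT x|lebesgue. f x) = (LINT x|density (distr lebesgue lebesgue (\<lambda>x. l + m * x)) (\<lambda>_. ennreal \<bar>m\<bar>). f x)"
    using lebesgue_real_affine[OF m, of l] by simp
  also have "\<dots> = (LINT x|distr lebesgue lebesgue (\<lambda>x. l + m * x). \<bar>m\<bar> *\<^sub>R f x)"
    using f by (subst integral_density) auto
  also have "\<dots> = (LINT x|lebesgue. \<bar>m\<bar> *\<^sub>R f (l + m * x))"
    using f by (subst integral_distr[OF T]) auto
  finally show ?thesis by simp
qed

lemma L2_funs_add:
  fixes f g :: "'x \<Rightarrow> 'b::{banach, second_countable_topology}"
  assumes "f \<in> L2_funs M" "g \<in> L2_funs M"
  shows "(\<lambda>x. f x + g x) \<in> L2_funs M"
proof -
  have m: "f \<in> borel_measurable M" "g \<in> borel_measurable M" using assms by (auto simp: L2_funs_def)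
  have le: "(norm (f x + g x))\<^sup>2 \<le> 2 * (norm (f x))\<^sup>2 + 2 * (norm (g x))\<^sup>2" for x
  proof -
    have "(norm (f x + g x))\<^sup>2 \<le> (norm (f x) + norm (g x))\<^sup>2" by (intro power_mono norm_triangle_ineq) simp
    also have "\<dots> \<le> 2 * (norm (f x))\<^sup>2 + 2 * (norm (g x))\<^sup>2"
      using sum_squares_bound[of "norm (f x)" "norm (g x)"] by (simp add: power2_sum)
    finally show ?thesis .
  qed
  have "integrable M (\<lambda>x. (norm (f x + g x))\<^sup>2)"
  proof (rule Bochner_Integration.integrable_bound)
    show "integrable M (\<lambda>x. 2 * (norm (f x))\<^sup>2 + 2 * (norm (g x))\<^sup>2)" using assms by (auto simp: L2_funs_def)
    show "(\<lambda>x. (norm (f x + g x))\<^sup>2) \<in> borel_measurable M" using m by measurable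
    show "AE x in M. norm ((norm (f x + g x))\<^sup>2) \<le> norm (2 * (norm (f x))\<^sup>2 + 2 * (norm (g x))\<^sup>2)"
      using le by simp
  qed
  then show ?thesis using m by (simp add: L2_funs_def)
qed

text \<open>The chain rule derivative of x \<mapsto> \<beta>((x - l)/m). The indicator sets it to
  zero outside the rescaled unit interval, so that the derivative of a concatenated path is the sum
  of two such terms.\<close>

definition rescale :: "real \<Rightarrow> real \<Rightarrow> (real \<Rightarrow> 'h::real_vector) \<Rightarrow> real \<Rightarrow> 'h" where
  "rescale l m v x = (1 / m) *\<^sub>R (indicator {0<..<1} ((x - l) / m) *\<^sub>R v ((x - l) / m))"

lemma rescale_L2:
  fixes v :: "real \<Rightarrow> 'h::{banach, second_countable_topology}"
  assumes v: "v \<in> L2_funs leb01" and m: "m \<noteq> 0"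
  shows "rescale l m v \<in> L2_funs leb01"
proof -
  define u where "u = (\<lambda>x. indicat_real {0<..<1} x *\<^sub>R v x)"
  have u: "u \<in> borel_measurable lebesgue"
    using v unfolding u_def L2_funs_def by (subst (asm) borel_measurable_restrict_space_iff) auto
  have u2: "integrable lebesgue (\<lambda>x. (norm (u x))\<^sup>2)"
  proof -
    have "(\<lambda>x. (norm (u x))\<^sup>2) = (\<lambda>x. indicat_real {0<..<1} x *\<^sub>R (norm (v x))\<^sup>2)"
      by (auto simp: u_def indicator_def)
    moreover have "integrable leb01 (\<lambda>x. (norm (v x))\<^sup>2)" using v by (simp add: L2_funs_def)
    ultimately show ?thesis by (simp add: integrable_restrict_space)
  qed
  have eq: "(x - l) / m = - l / m + (1 / m) * x" for x by (simp add: diff_divide_distrib)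
  have r: "rescale l m v = (\<lambda>x. (1 / m) *\<^sub>R u (- l / m + (1 / m) * x))"
    by (auto simp: rescale_def u_def eq)
  have 1: "rescale l m v \<in> borel_measurable lebesgue"
    unfolding r using measurable_affine_lebesgue[OF u, of "1 / m" "- l / m"] m by simp
  have "integrable lebesgue (\<lambda>x. (1 / m)\<^sup>2 * (norm (u (- l / m + (1 / m) * x)))\<^sup>2)"
    using integrable_affine_lebesgue[OF u2, of "1 / m" "- l / m"] m by simp
  then have "integrable lebesgue (\<lambda>x. (norm (rescale l m v x))\<^sup>2)"
    by (simp add: r power_mult_distrib power_divide)
  then have "integrable leb01 (\<lambda>x. (norm (rescale l m v x))\<^sup>2)"
    using integrable_mult_indicator[of "{0<..<1::real}" lebesgue "\<lambda>x. (norm (rescale l m v x))\<^sup>2"]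
    by (subst integrable_restrict_space) auto
  moreover have "rescale l m v \<in> borel_measurable leb01"
    using 1 by (rule measurable_restrict_space1)
  ultimately show ?thesis by (simp add: L2_funs_def)
qed

text \<open>The substitution contributes the absolute value of m and the chain rule the factor 1/m.
  What remains is the sign of m, which is -1 exactly when the path is reversed.\<close>

lemma rescale_integral:
  fixes v :: "real \<Rightarrow> 'h::{banach, second_countable_topology}"
  assumes v: "v \<in> L2_funs leb01" and m: "m \<noteq> 0" and st: "0 \<le> s" "t \<le> 1"
  shows "(LINT x:{s<..<t}|leb01. rescale l m v x) =
    sgn m *\<^sub>R (LINT y:{y. s < l + m * y \<and> l + m * y < t}|leb01. v y)"
proof -
  define f where "f x = indicat_real {s<..<t} x *\<^sub>R rescale l m v x" for x
  have "(LINT x:{s<..<t}|leb01. rescale l m v x) = (LINT x|lebesgue. f x)"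
    unfolding set_lebesgue_integral_def f_def
    by (subst integral_restrict_space)
      (use st in \<open>auto intro!: Bochner_Integration.integral_cong simp: indicator_def\<close>)
  also have "\<dots> = \<bar>m\<bar> *\<^sub>R (LINT y|lebesgue. f (l + m * y))"
  proof (rule integral_affine_lebesgue[OF _ m])
    have "(\<lambda>x. indicat_real {s<..<t} x *\<^sub>R rescale l m v x) \<in> borel_measurable leb01"
      using set_integrable_unit[OF L2_funs_integrable[OF leb01.finite_measure_axioms rescale_L2[OF v m]]] by auto
    then have "(\<lambda>x. indicat_real {0<..<1} x *\<^sub>R f x) \<in> borel_measurable lebesgue"
      unfolding f_def by (subst (asm) borel_measurable_restrict_space_iff) auto
    also have "(\<lambda>x. indicat_real {0<..<1} x *\<^sub>R f x) = f"
      using st by (auto simp: f_def indicator_def)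
    finally show "f \<in> borel_measurable lebesgue" .
  qed
  also have "(LINT y|lebesgue. f (l + m * y)) =
      (LINT y|lebesgue. (1 / m) *\<^sub>R (indicat_real {0<..<1} y *\<^sub>R (indicat_real {y. s < l + m * y \<and> l + m * y < t} y *\<^sub>R v y)))"
    by (rule Bochner_Integration.integral_cong) (use m in \<open>auto simp: f_def rescale_def indicator_def\<close>)
  also have "\<bar>m\<bar> *\<^sub>R \<dots> = sgn m *\<^sub>R (LINT y|lebesgue. indicat_real {0<..<1} y *\<^sub>R (indicat_real {y. s < l + m * y \<and> l + m * y < t} y *\<^sub>R v y))"
    using m by (simp only: integral_scaleR_right) (simp add: sgn_if abs_if)
  also have "\<dots> = sgn m *\<^sub>R (LINT y:{y. s < l + m * y \<and> l + m * y < t}|leb01. v y)"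
    unfolding set_lebesgue_integral_def by (subst integral_restrict_space) auto
  finally show ?thesis .
qed

text \<open>Freezes a path at its end values outside the unit interval. A concatenation then is, at
  every time, the first path plus the second path minus their common point, with no distinction of
  cases.\<close>

definition clamp01 :: "real \<Rightarrow> real" where "clamp01 x = max 0 (min 1 x)"

lemma has_L2_deriv_clamp:
  assumes "has_L2_deriv \<beta> v" "s \<le> t"
  shows "(LINT x:{s<..<t}|leb01. v x) = \<beta> (clamp01 t) - \<beta> (clamp01 s)"
proof -
  have "{s<..<t} \<inter> {0<..<1} = {clamp01 s<..<clamp01 t} \<inter> {0<..<1}"
    using assms(2) by (auto simp: clamp01_def)
  then have "(LINT x:{s<..<t}|leb01. v x) = (LINT x:{clamp01 s<..<clamp01 t}|leb01. v x)"
    by (metis set_integral_unit_Int)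
  also have "\<dots> = \<beta> (clamp01 t) - \<beta> (clamp01 s)"
    by (rule has_L2_derivD(4)[OF assms(1)]) (use assms(2) in \<open>auto simp: clamp01_def\<close>)
  finally show ?thesis .
qed

lemma has_L2_deriv_concat:
  fixes \<beta>1 \<beta>2 :: "real \<Rightarrow> 'h::{banach, second_countable_topology}"
  assumes th: "0 < \<theta>" "\<theta> < 1" and d: "has_L2_deriv \<beta>1 v1" "has_L2_deriv \<beta>2 v2" and j: "\<beta>1 1 = \<beta>2 0"
  shows "has_L2_deriv (\<lambda>t. if t \<le> \<theta> then \<beta>1 (t / \<theta>) else \<beta>2 ((t - \<theta>) / (1 - \<theta>)))
    (\<lambda>t. rescale 0 \<theta> v1 t + rescale \<theta> (1 - \<theta>) v2 t)"
    (is "has_L2_deriv ?\<beta> _")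
  unfolding has_L2_deriv_def
proof (intro conjI allI impI)
  have L: "rescale 0 \<theta> v1 \<in> L2_funs leb01" "rescale \<theta> (1 - \<theta>) v2 \<in> L2_funs leb01"
    using th rescale_L2[OF has_L2_derivD(1)[OF d(1)]] rescale_L2[OF has_L2_derivD(1)[OF d(2)]] by auto
  then show "(\<lambda>t. rescale 0 \<theta> v1 t + rescale \<theta> (1 - \<theta>) v2 t) \<in> L2_funs leb01"
    by (rule L2_funs_add)
  fix s t :: real assume st: "0 \<le> s" "s \<le> t" "t \<le> 1"
  have rep: "?\<beta> r = \<beta>1 (clamp01 (r / \<theta>)) + \<beta>2 (clamp01 ((r - \<theta>) / (1 - \<theta>))) - \<beta>2 0" if "0 \<le> r" "r \<le> 1" for r
  proof (cases "r \<le> \<theta>")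
    case True
    then have "clamp01 (r / \<theta>) = r / \<theta>" "clamp01 ((r - \<theta>) / (1 - \<theta>)) = 0"
      using th that by (auto simp: clamp01_def divide_le_eq le_divide_eq)
    then show ?thesis using True by simp
  next
    case False
    then have "clamp01 (r / \<theta>) = 1" "clamp01 ((r - \<theta>) / (1 - \<theta>)) = (r - \<theta>) / (1 - \<theta>)"
      using th that by (auto simp: clamp01_def divide_le_eq le_divide_eq)
    then show ?thesis using False j by simp
  qed
  have 1: "(LINT x:{s<..<t}|leb01. rescale 0 \<theta> v1 x) = \<beta>1 (clamp01 (t / \<theta>)) - \<beta>1 (clamp01 (s / \<theta>))"
  proof -
    have "{y. s < 0 + \<theta> * y \<and> 0 + \<theta> * y < t} = {s / \<theta><..<t / \<theta>}" using th by (auto simp: field_simps)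
    then show ?thesis
      using rescale_integral[OF has_L2_derivD(1)[OF d(1)], of \<theta> s t 0] has_L2_deriv_clamp[OF d(1), of "s / \<theta>" "t / \<theta>"] th st
      by (simp add: divide_right_mono)
  qed
  have 2: "(LINT x:{s<..<t}|leb01. rescale \<theta> (1 - \<theta>) v2 x) =
     \<beta>2 (clamp01 ((t - \<theta>) / (1 - \<theta>))) - \<beta>2 (clamp01 ((s - \<theta>) / (1 - \<theta>)))"
  proof -
    have "{y. s < \<theta> + (1 - \<theta>) * y \<and> \<theta> + (1 - \<theta>) * y < t} = {(s - \<theta>) / (1 - \<theta>)<..<(t - \<theta>) / (1 - \<theta>)}"
      using th by (auto simp: field_simps)
    then show ?thesis
      using rescale_integral[OF has_L2_derivD(1)[OF d(2)], of "1 - \<theta>" s t \<theta>]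
        has_L2_deriv_clamp[OF d(2), of "(s - \<theta>) / (1 - \<theta>)" "(t - \<theta>) / (1 - \<theta>)"] th st
      by (simp add: divide_right_mono)
  qed
  have "(LINT x:{s<..<t}|leb01. rescale 0 \<theta> v1 x + rescale \<theta> (1 - \<theta>) v2 x) =
     (LINT x:{s<..<t}|leb01. rescale 0 \<theta> v1 x) + (LINT x:{s<..<t}|leb01. rescale \<theta> (1 - \<theta>) v2 x)"
    using L by (intro set_integral_add)
      (simp_all add: set_integrable_def set_integrable_unit L2_funs_integrable leb01.finite_measure_axioms)
  then show "?\<beta> t - ?\<beta> s = (LINT x:{s<..<t}|leb01. rescale 0 \<theta> v1 x + rescale \<theta> (1 - \<theta>) v2 x)"
    unfolding 1 2 using rep[of t] rep[of s] st by simp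
qed

lemma has_L2_deriv_reverse:
  fixes \<beta> :: "real \<Rightarrow> 'h::{banach, second_countable_topology}"
  assumes d: "has_L2_deriv \<beta> v"
  shows "has_L2_deriv (\<lambda>t. \<beta> (1 - t)) (rescale 1 (-1) v)"
  unfolding has_L2_deriv_def
proof (intro conjI allI impI)
  show "rescale 1 (-1) v \<in> L2_funs leb01" by (rule rescale_L2[OF has_L2_derivD(1)[OF d]]) simp
  fix s t :: real assume st: "0 \<le> s" "s \<le> t" "t \<le> 1"
  have "{y. s < 1 + (-1) * y \<and> 1 + (-1) * y < t} = {1 - t<..<1 - s}" by auto
  then show "\<beta> (1 - t) - \<beta> (1 - s) = (LINT x:{s<..<t}|leb01. rescale 1 (-1) v x)"
    using rescale_integral[OF has_L2_derivD(1)[OF d], of "-1" s t 1] has_L2_derivD(4)[OF d, of "1 - t" "1 - s"] st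
    by (simp add: sgn_if)
qed

text \<open>Jensen's inequality as nonnegativity of a variance: the increment w is the mean of v,
  and the integral of the squared norm of v - w is expanded.\<close>

lemma has_L2_deriv_norm_le:
  fixes \<beta> :: "real \<Rightarrow> 'h::{real_inner, banach, second_countable_topology}"
  assumes d: "has_L2_deriv \<beta> v"
  shows "ennreal ((norm (\<beta> 1 - \<beta> 0))\<^sup>2) \<le> (\<integral>\<^sup>+t. ennreal ((norm (v t))\<^sup>2) \<partial>leb01)"
proof -
  have v: "integrable leb01 v" and v2: "integrable leb01 (\<lambda>t. (norm (v t))\<^sup>2)"
    using has_L2_derivD(1,2)[OF d] by (auto simp: L2_funs_def)
  define w where "w = \<beta> 1 - \<beta> 0"
  have "w = (LINT x:{0<..<1}|leb01. v x)" using has_L2_derivD(4)[OF d, of 0 1] by (simp add: w_def)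
  also have "\<dots> = (LINT x|leb01. v x)"
    unfolding set_lebesgue_integral_def by (rule Bochner_Integration.integral_cong) auto
  finally have w: "w = (LINT x|leb01. v x)" .
  have "0 \<le> (LINT x|leb01. (norm (v x - w))\<^sup>2)" by simp
  also have "\<dots> = (LINT x|leb01. (norm (v x))\<^sup>2 - 2 * (v x \<bullet> w) + (norm w)\<^sup>2)"
    by (simp add: power2_norm_eq_inner inner_diff_left inner_diff_right inner_commute algebra_simps)
  also have "\<dots> = (LINT x|leb01. (norm (v x))\<^sup>2) - 2 * ((LINT x|leb01. v x) \<bullet> w) + (norm w)\<^sup>2"
    using v v2 leb01.prob_space by simp
  also have "\<dots> = (LINT x|leb01. (norm (v x))\<^sup>2) - (norm w)\<^sup>2"
    unfolding w[symmetric] by (simp add: power2_norm_eq_inner)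
  finally have "(norm w)\<^sup>2 \<le> (LINT x|leb01. (norm (v x))\<^sup>2)" by simp
  then show ?thesis
    using v2 by (simp add: nn_integral_eq_integral w_def ennreal_leI)
qed

section \<open>The fixed point equation for B\<close>

lemma radon_probD:
  assumes "\<mu> \<in> radon_prob"
  shows "prob_space \<mu>" "sets \<mu> = sets borel" "space \<mu> = UNIV" "finite_measure \<mu>" "sigma_finite_measure \<mu>"
    "emeasure \<mu> UNIV = 1" "measure \<mu> UNIV = 1"
proof -
  show *: "prob_space \<mu>" "sets \<mu> = sets borel" using assms by (auto simp: radon_prob_def)
  then show sp: "space \<mu> = UNIV" using sets_eq_imp_space_eq[OF *(2)] by simp
  interpret prob_space \<mu> by fact
  show "finite_measure \<mu>" "sigma_finite_measure \<mu>" by unfold_locales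
  show "emeasure \<mu> UNIV = 1" "measure \<mu> UNIV = 1" using emeasure_space_1 prob_space sp by auto
qed

lemma radon_prob_const_integrable:
  fixes r :: "'b::{banach, second_countable_topology}"
  shows "\<mu> \<in> radon_prob \<Longrightarrow> integrable \<mu> (\<lambda>x. r)"
  by (rule finite_measure.integrable_const) (rule radon_probD)

lemma radon_prob_measurable:
  assumes "\<mu> \<in> radon_prob" "f \<in> borel_measurable borel"
  shows "f \<in> borel_measurable \<mu>"
  using assms(2) measurable_cong_sets[OF radon_probD(2)[OF assms(1)] refl] by blast

lemma radon_prob_continuous_measurable:
  fixes f :: "'a::metric_space \<Rightarrow> 'b::topological_space"
  assumes "\<mu> \<in> radon_prob" "continuous_on UNIV f"
  shows "f \<in> borel_measurable \<mu>"
  using assms borel_measurable_continuous_onI radon_prob_measurable by blast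

lemma continuous_bounded_compact:
  fixes f :: "'a::compact_metric_space \<Rightarrow> 'b::real_normed_vector"
  assumes "continuous_on UNIV f"
  obtains C where "\<And>x. norm (f x) \<le> C"
proof -
  have "bounded (range f)" by (rule compact_imp_bounded[OF compact_continuous_image[OF assms compact_space_UNIV]])
  then show ?thesis using that unfolding bounded_iff by blast
qed

lemma radon_prob_integrable:
  fixes f :: "'a::metric_space \<Rightarrow> 'b::{banach, second_countable_topology}"
  assumes "\<mu> \<in> radon_prob" "f \<in> borel_measurable \<mu>" "\<And>x. norm (f x) \<le> C"
  shows "integrable \<mu> f"
  by (rule finite_measure.integrable_const_bound[OF radon_probD(4)[OF assms(1)] _ assms(2), where B = C])
    (use assms(3) in simp)

lemma radon_prob_continuous_integrable:
  fixes f :: "'a::compact_metric_space \<Rightarrow> 'b::{banach, second_countable_topology}"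
  assumes "\<mu> \<in> radon_prob" "continuous_on UNIV f"
  shows "integrable \<mu> f"
proof -
  obtain C where "\<And>x. norm (f x) \<le> C" using continuous_bounded_compact[OF assms(2)] by blast
  then show ?thesis
    by (rule radon_prob_integrable[OF assms(1) radon_prob_continuous_measurable[OF assms]])
qed

lemma radon_prob_norm_integral_le:
  fixes f :: "'a::metric_space \<Rightarrow> 'b::{banach, second_countable_topology}"
  assumes "\<mu> \<in> radon_prob" "f \<in> borel_measurable \<mu>" "\<And>x. norm (f x) \<le> C"
  shows "norm (LINT x|\<mu>. f x) \<le> C"
proof -
  have I: "integrable \<mu> f" by (rule radon_prob_integrable[OF assms])
  have "norm (LINT x|\<mu>. f x) \<le> (LINT x|\<mu>. norm (f x))" by simp
  also have "\<dots> \<le> (LINT x|\<mu>. C)"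
    using I assms(3) finite_measure.integrable_const[OF radon_probD(4)[OF assms(1)]] by (intro integral_mono) auto
  also have "\<dots> = C" using radon_probD[OF assms(1)] by simp
  finally show ?thesis .
qed

lemma norm_scaleR_add_power2:
  fixes x y :: "'b::real_inner"
  shows "(norm (a *\<^sub>R x + b *\<^sub>R y))\<^sup>2 = a\<^sup>2 * (norm x)\<^sup>2 + b\<^sup>2 * (norm y)\<^sup>2 + 2 * (b * a * (y \<bullet> x))"
  unfolding power2_norm_eq_inner
  by (simp add: inner_add_left inner_add_right inner_commute[of x y] power2_eq_square algebra_simps)

section \<open>The Gibbs kernel and its feature map\<close>

locale gibbs_rkhs =
  fixes c :: "'a::compact_metric_space \<Rightarrow> 'a \<Rightarrow> real"
    and \<epsilon> :: real
    and \<iota> :: "'h::{real_inner, banach, second_countable_topology} \<Rightarrow> 'a \<Rightarrow> real"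
  assumes eps: "\<epsilon> > 0"
    and c_cont: "continuous_on UNIV (\<lambda>(x, y). c x y)"
    and c_nonneg: "\<And>x y. c x y \<ge> 0"
    and c_sym: "\<And>x y. c x y = c y x"
    and rkhs: "is_rkhs (gibbs_kernel \<epsilon> c) \<iota>"
    and univ: "universal_rkhs \<iota>"
begin

abbreviation k :: "'a \<Rightarrow> 'a \<Rightarrow> real" where "k \<equiv> gibbs_kernel \<epsilon> c"

definition kx :: "'a \<Rightarrow> 'h" where "kx x = inv \<iota> (k x)"

definition q :: real where "q = exp (- sup_norm c / \<epsilon>)"

lemma kx: "\<iota> (kx x) = k x" "\<iota> h x = h \<bullet> kx x"
proof -
  obtain \<kappa> where \<kappa>: "\<iota> \<kappa> = k x" "\<And>h. \<iota> h x = h \<bullet> \<kappa>"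
    using rkhs unfolding is_rkhs_def by blast
  have "inj \<iota>" using rkhs by (auto simp: is_rkhs_def)
  then have "kx x = \<kappa>" unfolding kx_def \<kappa>(1)[symmetric] by (rule inv_f_f)
  then show "\<iota> (kx x) = k x" "\<iota> h x = h \<bullet> kx x" using \<kappa> by auto
qed

lemma kx_inner: "kx x \<bullet> kx y = k x y"
  using kx(1)[of x] kx(2)[of "kx x" y] by simp

lemma k_sym: "k x y = k y x" by (simp add: gibbs_kernel_def c_sym[of x y])

lemma k_cont: "continuous_on UNIV (\<lambda>(x, y). k x y)"
  unfolding gibbs_kernel_def using c_cont eps
  by (auto simp: case_prod_beta intro!: continuous_intros)

lemma q_pos: "0 < q" by (simp add: q_def)

lemma k_bounds: "q \<le> k x y" "k x y \<le> 1"
proof -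
  have "compact (UNIV \<times> UNIV :: ('a \<times> 'a) set)" by (intro compact_Times compact_space_UNIV)
  then have "compact ((\<lambda>p. \<bar>c (fst p) (snd p)\<bar>) ` UNIV)"
    using c_cont by (intro compact_continuous_image) (auto simp: case_prod_beta intro!: continuous_intros)
  then have "bdd_above (range (\<lambda>p. \<bar>c (fst p) (snd p)\<bar>))" by (intro bounded_imp_bdd_above compact_imp_bounded)
  then have "\<bar>c (fst (x, y)) (snd (x, y))\<bar> \<le> sup_norm c" unfolding sup_norm_def by (intro cSUP_upper) auto
  then have "c x y \<le> sup_norm c" by simp
  then show "q \<le> k x y" using eps by (simp add: q_def gibbs_kernel_def divide_right_mono)
  show "k x y \<le> 1" using eps c_nonneg by (simp add: gibbs_kernel_def)
qed

lemma q_le_1: "q \<le> 1" using k_bounds[of undefined undefined] by linarith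

lemma norm_kx: "norm (kx x) \<le> 1"
  using k_bounds(2)[of x x] kx_inner[of x x] by (simp add: norm_eq_sqrt_inner)

text \<open>The squared distance of two features is k(y,y) - 2 k(y,x) + k(x,x), so continuity of the
  kernel gives norm continuity of the feature map.\<close>

lemma kx_cont: "continuous_on UNIV kx"
  unfolding continuous_on_def
proof
  fix x
  have kc: "((\<lambda>y. k (f y) (g y)) \<longlongrightarrow> k a b) F"
    if "(f \<longlongrightarrow> a) F" "(g \<longlongrightarrow> b) F" for f g :: "'a \<Rightarrow> 'a" and a b F
    using continuous_on_tendsto_compose[OF k_cont, of "\<lambda>y. (f y, g y)" "(a, b)"] tendsto_Pair[OF that] by simp
  have "((\<lambda>y. k y y - 2 * k y x + k x x) \<longlongrightarrow> k x x - 2 * k x x + k x x) (at x within UNIV)"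
    by (intro tendsto_intros kc)
  moreover have "k y y - 2 * k y x + k x x = (norm (kx y - kx x))\<^sup>2" for y
    by (simp add: power2_norm_eq_inner inner_diff_left inner_diff_right kx_inner k_sym[of x y])
  ultimately have "((\<lambda>y. (norm (kx y - kx x))\<^sup>2) \<longlongrightarrow> 0) (at x within UNIV)" by simp
  then have "((\<lambda>y. sqrt ((norm (kx y - kx x))\<^sup>2)) \<longlongrightarrow> sqrt 0) (at x within UNIV)"
    by (rule tendsto_real_sqrt)
  then show "(kx \<longlongrightarrow> kx x) (at x within UNIV)"
    by (simp add: tendsto_norm_zero_iff LIM_zero_iff)
qed

lemma cont_inner_kx: "continuous_on S (\<lambda>x. h \<bullet> kx x)"
  by (intro continuous_intros continuous_on_subset[OF kx_cont]) simp

lemma inner_kx_le: "\<bar>h \<bullet> kx x\<bar> \<le> norm h"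
  using Cauchy_Schwarz_ineq2[of h "kx x"] norm_kx[of x] mult_left_mono[of "norm (kx x)" 1 "norm h"] by simp

section \<open>The fixed point equation: bounds, stability and solvability\<close>

definition sol :: "'a measure \<Rightarrow> 'h \<Rightarrow> bool" where
  "sol \<mu> \<beta> \<longleftrightarrow> (\<forall>x. 0 < \<beta> \<bullet> kx x) \<and> \<beta> = (LINT x|\<mu>. (1 / (\<beta> \<bullet> kx x)) *\<^sub>R kx x)"

lemma scaled_kx_integrable:
  fixes f :: "'a \<Rightarrow> real"
  assumes "\<mu> \<in> radon_prob" "continuous_on UNIV f"
  shows "integrable \<mu> (\<lambda>x. f x *\<^sub>R kx x)"
  by (rule radon_prob_continuous_integrable[OF assms(1)]) (intro continuous_intros assms kx_cont)

lemma inner_integral_kx: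
  fixes f :: "'a \<Rightarrow> real"
  assumes "\<mu> \<in> radon_prob" "continuous_on UNIV f"
  shows "(LINT x|\<mu>. f x *\<^sub>R kx x) \<bullet> h = (LINT x|\<mu>. f x * (h \<bullet> kx x))"
  using integral_inner_left[OF scaled_kx_integrable[OF assms], of h] by (simp add: inner_commute)

lemma sol_inv_cont: "sol \<mu> \<beta> \<Longrightarrow> continuous_on S (\<lambda>x. 1 / (\<beta> \<bullet> kx x))"
  unfolding sol_def by (intro continuous_on_divide continuous_on_const cont_inner_kx) (auto simp: less_imp_neq[symmetric])

lemma sol_eq: "sol \<mu> \<beta> \<Longrightarrow> (LINT x|\<mu>. (1 / (\<beta> \<bullet> kx x)) *\<^sub>R kx x) = \<beta>"
  unfolding sol_def by (rule sym) (rule conjunct2)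

lemma sol_inner:
  assumes "\<mu> \<in> radon_prob" "sol \<mu> \<beta>"
  shows "\<beta> \<bullet> h = (LINT x|\<mu>. 1 / (\<beta> \<bullet> kx x) * (h \<bullet> kx x))"
  using inner_integral_kx[OF assms(1) sol_inv_cont[OF assms(2)], of h] unfolding sol_eq[OF assms(2)] .

lemma q_le_weighted_integral:
  assumes \<mu>: "\<mu> \<in> radon_prob" and f: "continuous_on UNIV f" "\<And>x. 1 \<le> f x" and h: "\<And>x. q \<le> h \<bullet> kx x"
  shows "q \<le> (LINT x|\<mu>. f x * (h \<bullet> kx x))"
proof -
  have "q = (LINT x|\<mu>. q)" using radon_probD[OF \<mu>] by simp
  also have "\<dots> \<le> (LINT x|\<mu>. f x * (h \<bullet> kx x))"
  proof (rule integral_mono[OF radon_prob_const_integrable[OF \<mu>]])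
    show "integrable \<mu> (\<lambda>x. f x * (h \<bullet> kx x))"
      by (rule radon_prob_continuous_integrable[OF \<mu>]) (intro continuous_on_mult f cont_inner_kx)
    have "1 * q \<le> f x * (h \<bullet> kx x)" for x
      using f(2)[of x] h[of x] q_pos by (intro mult_mono) auto
    then show "q \<le> f x * (h \<bullet> kx x)" for x by simp
  qed
  finally show ?thesis .
qed

text \<open>Testing the equation with \<beta> itself makes the integrand 1, hence the norm 1 and
  \<beta> \<bullet> \<open>kx x\<close> \<le> 1. The weights 1/(\<beta> \<bullet>
  \<open>kx y\<close>) are therefore at least 1, and testing with \<open>kx x\<close> turns the
  kernel bound q into the lower bound.\<close>

lemma sol_bounds:
  assumes \<mu>: "\<mu> \<in> radon_prob" and s: "sol \<mu> \<beta>"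
  shows "norm \<beta> = 1" "\<beta> \<bullet> kx x \<le> 1" "q \<le> \<beta> \<bullet> kx x"
proof -
  have pos: "0 < \<beta> \<bullet> kx x" for x using s by (simp add: sol_def)
  have "\<beta> \<bullet> \<beta> = (LINT x|\<mu>. 1 / (\<beta> \<bullet> kx x) * (\<beta> \<bullet> kx x))" by (rule sol_inner[OF assms])
  also have "\<dots> = (LINT x|\<mu>. 1)" by (rule Bochner_Integration.integral_cong) (use pos in \<open>auto simp: less_imp_neq[symmetric]\<close>)
  also have "\<dots> = 1" using radon_probD[OF \<mu>] by simp
  finally show n: "norm \<beta> = 1" by (simp add: norm_eq_sqrt_inner)
  show le: "\<beta> \<bullet> kx x \<le> 1" for x using inner_kx_le[of \<beta> x] n by simp
  have "1 \<le> 1 / (\<beta> \<bullet> kx y)" for y using pos[of y] le[of y] by simp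
  then have "q \<le> (LINT y|\<mu>. 1 / (\<beta> \<bullet> kx y) * (kx x \<bullet> kx y))"
    by (intro q_le_weighted_integral[OF \<mu> sol_inv_cont[OF s]]) (simp_all add: kx_inner k_bounds)
  also have "\<dots> = \<beta> \<bullet> kx x" by (rule sol_inner[OF assms, symmetric])
  finally show "q \<le> \<beta> \<bullet> kx x" .
qed

text \<open>The map \<open>\<beta> \<mapsto> \<integral> kx / (\<beta> \<bullet> kx) d\<mu>\<close> is antitone, so the fixed point equation is strongly monotone.\<close>

lemma sol_stability:
  assumes \<mu>: "\<mu> \<in> radon_prob" "\<mu>0 \<in> radon_prob" and s: "sol \<mu> \<beta>" "sol \<mu>0 \<beta>0"
  shows "norm (\<beta> - \<beta>0) \<le>
    norm ((LINT x|\<mu>. (1 / (\<beta>0 \<bullet> kx x)) *\<^sub>R kx x) - (LINT x|\<mu>0. (1 / (\<beta>0 \<bullet> kx x)) *\<^sub>R kx x))"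
proof -
  define D where "D = (LINT x|\<mu>. (1 / (\<beta>0 \<bullet> kx x)) *\<^sub>R kx x) - \<beta>0"
  define d where "d = \<beta> - \<beta>0"
  have I: "integrable \<mu> (\<lambda>x. 1 / (\<beta> \<bullet> kx x) * (d \<bullet> kx x))" "integrable \<mu> (\<lambda>x. 1 / (\<beta>0 \<bullet> kx x) * (d \<bullet> kx x))"
    by (rule radon_prob_continuous_integrable[OF \<mu>(1)], intro continuous_on_mult sol_inv_cont[OF s(1)] sol_inv_cont[OF s(2)] cont_inner_kx)+
  have "(norm d)\<^sup>2 = \<beta> \<bullet> d - \<beta>0 \<bullet> d" by (simp add: d_def power2_norm_eq_inner inner_diff_left)
  \<comment> \<open>The \<mu>-integral with weight 1/(\<beta>0 \<bullet> \<open>kx x\<close>) is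
    inserted: the difference of the two \<mu>-integrals is nonpositive by antitonicity, and
    \<open>D\<close> carries the whole change of measure.\<close>
  also have "\<dots> = (LINT x|\<mu>. 1 / (\<beta> \<bullet> kx x) * (d \<bullet> kx x)) - (LINT x|\<mu>. 1 / (\<beta>0 \<bullet> kx x) * (d \<bullet> kx x)) + D \<bullet> d"
    using sol_inner[OF \<mu>(1) s(1), of d] inner_integral_kx[OF \<mu>(1) sol_inv_cont[OF s(2)], of d]
    by (simp add: D_def inner_diff_left)
  also have "\<dots> \<le> D \<bullet> d"
  proof -
    have "1 / (\<beta> \<bullet> kx x) * (d \<bullet> kx x) \<le> 1 / (\<beta>0 \<bullet> kx x) * (d \<bullet> kx x)" for x
    proof -
      define u where "u = \<beta> \<bullet> kx x"
      define w where "w = \<beta>0 \<bullet> kx x"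
      have p: "u > 0" "w > 0" using s by (auto simp: sol_def u_def w_def)
      have "(u - w) / u \<le> (u - w) / w"
        using p zero_le_power2[of "u - w"] by (simp add: field_simps power2_eq_square)
      moreover have "d \<bullet> kx x = u - w" by (simp add: d_def u_def w_def inner_diff_left)
      ultimately show ?thesis by (simp add: u_def w_def)
    qed
    then show ?thesis using integral_mono[OF I] by simp
  qed
  also have "\<dots> \<le> norm D * norm d" by (rule norm_cauchy_schwarz)
  finally have "norm d * norm d \<le> norm D * norm d" by (simp add: power2_eq_square)
  then have "norm d \<le> norm D" by (cases "d = 0") auto
  then show ?thesis unfolding D_def d_def sol_eq[OF s(2)] .
qed

lemma sol_unique:
  assumes "\<mu> \<in> radon_prob" "sol \<mu> \<beta>" "sol \<mu> \<beta>'"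
  shows "\<beta> = \<beta>'"
  using sol_stability[OF assms(1,1,2,3)] by simp

text \<open>Truncating the denominator at q makes the right-hand side \<open>N\<close> Lipschitz on
  the whole space while keeping it antitone. For such a map the damped iteration \<open>T\<close> is
  a contraction, although \<open>N\<close> itself need not be. The bounds of an exact solution then
  show that the truncation is inactive at the fixed point.\<close>

lemma sol_exists:
  assumes \<mu>: "\<mu> \<in> radon_prob"
  shows "\<exists>\<beta>. sol \<mu> \<beta>"
proof -
  define m where "m b x = 1 / max (b \<bullet> kx x) q" for b x
  define N where "N b = (LINT x|\<mu>. m b x *\<^sub>R kx x)" for b
  have m_cont: "continuous_on S (m b)" for S b
    unfolding m_def
    by (intro continuous_on_divide continuous_on_const continuous_on_max cont_inner_kx)
      (use q_pos in \<open>auto simp: max_def\<close>)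
  define Q where "Q = (1 / q\<^sup>2)\<^sup>2"
  have Q: "Q > 0" using q_pos by (simp add: Q_def)
  have m_diff: "m b x - m b' x = (max (b' \<bullet> kx x) q - max (b \<bullet> kx x) q) / (max (b \<bullet> kx x) q * max (b' \<bullet> kx x) q)" for b b' x
  proof -
    have "max (b' \<bullet> kx x) q > 0" "max (b \<bullet> kx x) q > 0" using q_pos by (auto simp: max_def)
    then show ?thesis unfolding m_def by (simp add: field_simps)
  qed
  have mq: "max (b \<bullet> kx x) q * max (b' \<bullet> kx x) q \<ge> q\<^sup>2" for b b' x
    unfolding power2_eq_square using q_pos by (intro mult_mono) auto
  have mlip: "\<bar>m b x - m b' x\<bar> \<le> 1 / q\<^sup>2 * norm (b - b')" for b b' x
  proof -
    have "\<bar>max (b' \<bullet> kx x) q - max (b \<bullet> kx x) q\<bar> \<le> \<bar>(b - b') \<bullet> kx x\<bar>"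
      unfolding inner_diff_left by (auto simp: max_def abs_if)
    also have "\<dots> \<le> norm (b - b')" by (rule inner_kx_le)
    finally have "\<bar>m b x - m b' x\<bar> \<le> norm (b - b') / q\<^sup>2"
      unfolding m_diff abs_divide using mq[of b x b'] q_pos
      by (intro frac_le) auto
    then show ?thesis by simp
  qed
  have mmono: "(m b x - m b' x) * ((b - b') \<bullet> kx x) \<le> 0" for b b' x
  proof -
    define P where "P = max (b \<bullet> kx x) q * max (b' \<bullet> kx x) q"
    have "P > 0" using mq[of b x b'] q_pos unfolding P_def by (smt (verit) zero_less_power)
    moreover have "(max (b' \<bullet> kx x) q - max (b \<bullet> kx x) q) * (b \<bullet> kx x - b' \<bullet> kx x) \<le> 0"
      by (auto simp: mult_le_0_iff max_def)
    ultimately show ?thesis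
      unfolding m_diff P_def[symmetric] by (simp add: inner_diff_left divide_le_0_iff mult_le_0_iff zero_le_divide_iff)
  qed
  have N_diff: "N b - N b' = (LINT x|\<mu>. (m b x - m b' x) *\<^sub>R kx x)" for b b'
    unfolding N_def scaleR_diff_left
    by (rule Bochner_Integration.integral_diff[symmetric]) (rule scaled_kx_integrable[OF \<mu> m_cont])+
  have c_diff: "continuous_on UNIV (\<lambda>x. m b x - m b' x)" for b b' by (intro continuous_intros m_cont)
  have N_lip: "norm (N b - N b') \<le> 1 / q\<^sup>2 * norm (b - b')" for b b'
    unfolding N_diff
  proof (rule radon_prob_norm_integral_le[OF \<mu>])
    show "(\<lambda>x. (m b x - m b' x) *\<^sub>R kx x) \<in> borel_measurable \<mu>"
      using scaled_kx_integrable[OF \<mu> c_diff] by auto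
    show "norm ((m b x - m b' x) *\<^sub>R kx x) \<le> 1 / q\<^sup>2 * norm (b - b')" for x
      using mult_mono[OF mlip[of b x b'] norm_kx[of x]] by simp
  qed
  have N_mono: "(N b - N b') \<bullet> (b - b') \<le> 0" for b b'
  proof -
    have "0 \<le> (LINT x|\<mu>. - ((m b x - m b' x) * ((b - b') \<bullet> kx x)))"
      by (rule Bochner_Integration.integral_nonneg) (simp only: neg_0_le_iff_le mmono)
    then show ?thesis unfolding N_diff inner_integral_kx[OF \<mu> c_diff] by simp
  qed
  \<comment> \<open>This value minimizes \<open>(1 - \<eta>)\<^sup>2 + \<eta>\<^sup>2 * Q\<close>,
    where \<open>Q\<close> is the square of the Lipschitz constant of \<open>N\<close>; the minimum
    Q/(1 + Q) is the squared contraction factor.\<close>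
  define \<eta> where "\<eta> = 1 / (1 + Q)"
  define T where "T b = (1 - \<eta>) *\<^sub>R b + \<eta> *\<^sub>R N b" for b
  have \<eta>: "0 < \<eta>" "\<eta> < 1" using Q by (auto simp: \<eta>_def)
  define L where "L = sqrt (Q / (1 + Q))"
  have L: "0 \<le> L" "L < 1" using Q by (auto simp: L_def)
  have "norm (T b - T b') \<le> L * norm (b - b')" for b b'
  proof (rule power2_le_imp_le)
    have T: "T b - T b' = (1 - \<eta>) *\<^sub>R (b - b') + \<eta> *\<^sub>R (N b - N b')"
      by (simp add: T_def algebra_simps)
    have "(norm (T b - T b'))\<^sup>2 = (1 - \<eta>)\<^sup>2 * (norm (b - b'))\<^sup>2 + \<eta>\<^sup>2 * (norm (N b - N b'))\<^sup>2
       + 2 * (\<eta> * (1 - \<eta>) * ((N b - N b') \<bullet> (b - b')))"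
      unfolding T by (rule norm_scaleR_add_power2)
    also have "\<dots> \<le> (1 - \<eta>)\<^sup>2 * (norm (b - b'))\<^sup>2 + \<eta>\<^sup>2 * (Q * (norm (b - b'))\<^sup>2) + 2 * 0"
    proof (intro add_mono mult_left_mono)
      show "(norm (N b - N b'))\<^sup>2 \<le> Q * (norm (b - b'))\<^sup>2"
        using power_mono[OF N_lip[of b b'], of 2] by (simp add: Q_def power_mult_distrib power_divide)
      show "\<eta> * (1 - \<eta>) * ((N b - N b') \<bullet> (b - b')) \<le> 0"
        using N_mono[of b b'] \<eta> by (intro mult_nonneg_nonpos) auto
    qed auto
    also have "\<dots> = ((1 - \<eta>)\<^sup>2 + \<eta>\<^sup>2 * Q) * (norm (b - b'))\<^sup>2" by (simp add: algebra_simps)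
    also have "(1 - \<eta>)\<^sup>2 + \<eta>\<^sup>2 * Q = Q / (1 + Q)"
    proof -
      have "1 - \<eta> = Q / (1 + Q)" using Q by (simp add: \<eta>_def field_simps)
      then have "(1 - \<eta>)\<^sup>2 + \<eta>\<^sup>2 * Q = (Q * (1 + Q)) / (1 + Q)\<^sup>2"
        by (simp add: \<eta>_def power_divide add_divide_distrib[symmetric]) (simp add: power2_eq_square algebra_simps)
      also have "\<dots> = Q / (1 + Q)" using Q by (simp add: power2_eq_square)
      finally show ?thesis .
    qed
    also have "Q / (1 + Q) * (norm (b - b'))\<^sup>2 = (L * norm (b - b'))\<^sup>2"
      using Q by (simp add: L_def power_mult_distrib)
    finally show "(norm (T b - T b'))\<^sup>2 \<le> (L * norm (b - b'))\<^sup>2" .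
    show "0 \<le> L * norm (b - b')" using L by simp
  qed
  then have "\<exists>!b. T b = b"
    using L by (intro banach_fix_type[where c = L]) (auto simp: dist_norm)
  then obtain b where "T b = b" by blast
  then have "\<eta> *\<^sub>R (N b - b) = 0" by (simp add: T_def algebra_simps)
  then have b: "b = N b" using \<eta> by simp
  \<comment> \<open>The truncated weight times b \<bullet> \<open>kx x\<close> is at most 1, so b
    has norm at most 1. All weights are then at least 1, which gives b \<bullet> \<open>kx x\<close>
    \<ge> q and removes the truncation.\<close>
  have "b \<bullet> b = (LINT x|\<mu>. m b x * (b \<bullet> kx x))"
    using inner_integral_kx[OF \<mu> m_cont, of b b] b by (simp add: N_def)
  also have "\<dots> \<le> (LINT x|\<mu>. 1)"
  proof (rule integral_mono)
    show "integrable \<mu> (\<lambda>x. m b x * (b \<bullet> kx x))"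
      by (rule radon_prob_continuous_integrable[OF \<mu>]) (intro continuous_on_mult m_cont cont_inner_kx)
    show "m b x * (b \<bullet> kx x) \<le> 1" for x
      unfolding m_def using q_pos by (auto simp: max_def)
  qed (use radon_prob_const_integrable[OF \<mu>] in auto)
  also have "\<dots> = 1" using radon_probD[OF \<mu>] by simp
  finally have nb: "norm b \<le> 1" by (simp add: norm_eq_sqrt_inner)
  have "q \<le> b \<bullet> kx x" for x
  proof -
    have "1 \<le> m b y" for y
    proof -
      have "max (b \<bullet> kx y) q \<le> 1" "max (b \<bullet> kx y) q > 0" using inner_kx_le[of b y] nb q_le_1 q_pos by (auto simp: max_def)
      then show ?thesis by (simp add: m_def)
    qed
    then have "q \<le> (LINT y|\<mu>. m b y * (kx x \<bullet> kx y))"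
      by (intro q_le_weighted_integral[OF \<mu> m_cont]) (simp_all add: kx_inner k_bounds)
    also have "\<dots> = b \<bullet> kx x" using inner_integral_kx[OF \<mu> m_cont, of b "kx x"] b by (simp add: N_def)
    finally show ?thesis .
  qed
  then have "0 < b \<bullet> kx x" "m b x = 1 / (b \<bullet> kx x)" for x
    using q_pos by (auto simp: m_def max_def intro: less_le_trans order_antisym)
  then have "sol \<mu> b" using b by (simp add: sol_def N_def)
  then show ?thesis by blast
qed

text \<open>For b the integral of exp(f/\<epsilon>) \<open>kx\<close>, the Schroedinger equation
  reads exp(f(y)/\<epsilon>) (b \<bullet> \<open>kx y\<close>) = 1, which says that b solves the
  fixed point equation. Thus f = -\<epsilon> ln(\<beta> \<bullet> \<open>kx\<close>) is a potential,
  and uniqueness of \<beta> makes it the only one.\<close>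

lemma B_map_props:
  assumes \<mu>: "\<mu> \<in> radon_prob"
  shows "sol \<mu> (B_map \<iota> \<epsilon> c \<mu>)" "a_fun \<epsilon> c \<mu> x = 1 / (B_map \<iota> \<epsilon> c \<mu> \<bullet> kx x)"
proof -
  obtain \<beta> where \<beta>: "sol \<mu> \<beta>" using sol_exists[OF \<mu>] by blast
  have pos: "0 < \<beta> \<bullet> kx x" for x using \<beta> by (simp add: sol_def)
  have expf: "(LINT x|\<mu>. exp (1 / \<epsilon> * (f x + f y - c x y))) = exp (f y / \<epsilon>) * ((LINT x|\<mu>. exp (f x / \<epsilon>) *\<^sub>R kx x) \<bullet> kx y)"
    if "continuous_on UNIV f" for f :: "'a \<Rightarrow> real" and y
  proof -
    have fc: "continuous_on UNIV (\<lambda>x. exp (f x / \<epsilon>))" using that eps by (intro continuous_intros) auto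
    have "(LINT x|\<mu>. exp (1 / \<epsilon> * (f x + f y - c x y))) = (LINT x|\<mu>. exp (f y / \<epsilon>) * (exp (f x / \<epsilon>) * (kx y \<bullet> kx x)))"
    proof (rule Bochner_Integration.integral_cong[OF refl])
      fix x
      have "1 / \<epsilon> * (f x + f y - c x y) = f y / \<epsilon> + (f x / \<epsilon> + (- c y x / \<epsilon>))"
        by (simp add: diff_divide_distrib add_divide_distrib c_sym[of x y])
      then show "exp (1 / \<epsilon> * (f x + f y - c x y)) = exp (f y / \<epsilon>) * (exp (f x / \<epsilon>) * (kx y \<bullet> kx x))"
        by (simp only: exp_add kx_inner gibbs_kernel_def)
    qed
    then show ?thesis using inner_integral_kx[OF \<mu> fc, of "kx y"] by simp
  qed
  define f0 where "f0 x = - \<epsilon> * ln (\<beta> \<bullet> kx x)" for x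
  have ef0: "exp (f0 x / \<epsilon>) = 1 / (\<beta> \<bullet> kx x)" for x
  proof -
    have "f0 x / \<epsilon> = - ln (\<beta> \<bullet> kx x)" using eps by (simp add: f0_def)
    then show ?thesis using pos[of x] by (simp add: exp_minus divide_inverse)
  qed
  have f0c: "continuous_on UNIV f0"
    unfolding f0_def using pos by (intro continuous_intros cont_inner_kx) (metis less_irrefl)
  have "schroedinger_potential \<epsilon> c \<mu> = f0"
    unfolding schroedinger_potential_def
  proof (rule the_equality)
    have "(LINT x|\<mu>. exp (1 / \<epsilon> * (f0 x + f0 y - c x y))) = 1" for y
      unfolding expf[OF f0c] ef0 sol_eq[OF \<beta>] using pos[of y] by simp
    then show "continuous_on UNIV f0 \<and> (\<forall>y. (LINT x|\<mu>. exp (1 / \<epsilon> * (f0 x + f0 y - c x y))) = 1)"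
      using f0c by blast
  next
    fix f assume f: "continuous_on UNIV f \<and> (\<forall>y. (LINT x|\<mu>. exp (1 / \<epsilon> * (f x + f y - c x y))) = 1)"
    define b where "b = (LINT x|\<mu>. exp (f x / \<epsilon>) *\<^sub>R kx x)"
    have e: "exp (f y / \<epsilon>) * (b \<bullet> kx y) = 1" for y using expf[of f y] f by (simp add: b_def)
    have bp: "0 < b \<bullet> kx y" for y using e[of y] by (metis exp_gt_zero zero_less_mult_pos zero_less_one)
    have ee: "exp (f y / \<epsilon>) = 1 / (b \<bullet> kx y)" for y using e[of y] bp[of y] by (simp add: field_simps)
    have "sol \<mu> b" using bp b_def[unfolded ee] unfolding sol_def by blast
    then have "b = \<beta>" by (rule sol_unique[OF \<mu> _ \<beta>])
    then have "exp (f y / \<epsilon>) = exp (f0 y / \<epsilon>)" for y using ee ef0 by simp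
    then show "f = f0" using eps by (auto simp: fun_eq_iff)
  qed
  then have a: "a_fun \<epsilon> c \<mu> x = 1 / (\<beta> \<bullet> kx x)" for x by (simp add: a_fun_def ef0)
  have "B_map \<iota> \<epsilon> c \<mu> = \<beta>"
    unfolding B_map_def a kx_def[symmetric] by (rule sol_eq[OF \<beta>])
  then show "sol \<mu> (B_map \<iota> \<epsilon> c \<mu>)" "a_fun \<epsilon> c \<mu> x = 1 / (B_map \<iota> \<epsilon> c \<mu> \<bullet> kx x)"
    using \<beta> a by auto
qed

lemma B_map_eqI: "\<mu> \<in> radon_prob \<Longrightarrow> sol \<mu> \<beta> \<Longrightarrow> B_map \<iota> \<epsilon> c \<mu> = \<beta>"
  using sol_unique B_map_props(1) by blast

end

section \<open>The metric tensor\<close>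

lemma L2_funs_integrable_mult:
  fixes f g :: "'x \<Rightarrow> real"
  assumes "f \<in> L2_funs M" "g \<in> L2_funs M"
  shows "integrable M (\<lambda>x. f x * g x)"
  using L2_funs_integrable_inner[OF assms] by simp

lemma radon_prob_L2_integrable:
  fixes f :: "'a::metric_space \<Rightarrow> 'b::{banach, second_countable_topology}"
  assumes "\<mu> \<in> radon_prob" "f \<in> L2_funs \<mu>"
  shows "integrable \<mu> f"
  by (rule L2_funs_integrable[OF radon_probD(4)[OF assms(1)] assms(2)])

lemma radon_prob_continuous_L2:
  fixes f :: "'a::compact_metric_space \<Rightarrow> 'b::{banach, second_countable_topology}"
  assumes "\<mu> \<in> radon_prob" "continuous_on UNIV f"
  shows "f \<in> L2_funs \<mu>"
proof -
  obtain C where "\<And>x. norm (f x) \<le> C" using continuous_bounded_compact[OF assms(2)] by blast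
  then show ?thesis
    by (intro L2_funs_bounded[OF radon_probD(4)[OF assms(1)] radon_prob_continuous_measurable[OF assms]])
qed

context gibbs_rkhs
begin

context
  fixes \<mu> :: "'a measure"
  assumes \<mu>: "\<mu> \<in> radon_prob"
begin

abbreviation "\<beta> \<equiv> B_map \<iota> \<epsilon> c \<mu>"
abbreviation "a \<equiv> a_fun \<epsilon> c \<mu>"
abbreviation "K \<equiv> K_op \<epsilon> c \<mu>"

lemma const_integrable: "integrable \<mu> (\<lambda>x. r :: real)"
  by (rule radon_prob_const_integrable[OF \<mu>])

lemma integral_const: "(LINT x|\<mu>. r) = (r :: real)"
  using radon_probD[OF \<mu>] by simp

lemma \<beta>_bounds: "0 < \<beta> \<bullet> kx x" "\<beta> \<bullet> kx x \<le> 1" "q \<le> \<beta> \<bullet> kx x"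
  using B_map_props(1)[OF \<mu>] sol_bounds[OF \<mu> B_map_props(1)[OF \<mu>]] by (auto simp: sol_def)

lemma a_cont: "continuous_on S a"
  using sol_inv_cont[OF B_map_props(1)[OF \<mu>], of S] by (simp add: B_map_props(2)[OF \<mu>, abs_def])

lemma a_bounds: "1 \<le> a x" "a x \<le> 1 / q" "a x * (\<beta> \<bullet> kx x) = 1"
  using \<beta>_bounds[of x] q_pos by (auto simp: B_map_props(2)[OF \<mu>] frac_le)

lemma k_mu_bounds: "q \<le> k_mu \<epsilon> c \<mu> x y" "\<bar>k_mu \<epsilon> c \<mu> x y\<bar> \<le> 1 / q * (1 / q) * 1"
proof -
  have "1 * 1 * q \<le> k_mu \<epsilon> c \<mu> x y"
    unfolding k_mu_def using a_bounds(1)[of x] a_bounds(1)[of y] k_bounds(1)[of x y] q_pos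
    by (intro mult_mono) auto
  then show 1: "q \<le> k_mu \<epsilon> c \<mu> x y" by simp
  have "k_mu \<epsilon> c \<mu> x y \<le> 1 / q * (1 / q) * 1"
    unfolding k_mu_def using a_bounds[of x] a_bounds[of y] k_bounds[of x y] q_pos
    by (intro mult_mono mult_nonneg_nonneg) auto
  then show "\<bar>k_mu \<epsilon> c \<mu> x y\<bar> \<le> 1 / q * (1 / q) * 1" using 1 q_pos by simp
qed

lemma k_mu_cont: "continuous_on UNIV (\<lambda>x. k_mu \<epsilon> c \<mu> x y)"
proof -
  have "k_mu \<epsilon> c \<mu> x y = a x * a y * (kx y \<bullet> kx x)" for x by (simp add: k_mu_def kx_inner k_sym[of x y])
  then show ?thesis by (auto intro!: continuous_intros a_cont cont_inner_kx)
qed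

section \<open>The operator K as a Gram operator on the RKHS\<close>

lemma bounded_times_integrable:
  fixes f :: "'a \<Rightarrow> real" and g :: "'a \<Rightarrow> 'z::{banach, second_countable_topology}"
  assumes f: "integrable \<mu> f" and g: "continuous_on UNIV g"
  shows "integrable \<mu> (\<lambda>x. f x *\<^sub>R g x)"
proof -
  obtain C where C: "\<And>x. norm (g x) \<le> C" using continuous_bounded_compact[OF g] by blast
  have C0: "C \<ge> 0" using C[of undefined] norm_ge_zero order_trans by blast
  show ?thesis
  proof (rule Bochner_Integration.integrable_bound)
    show "integrable \<mu> (\<lambda>x. C * f x)" using f by simp
    show "(\<lambda>x. f x *\<^sub>R g x) \<in> borel_measurable \<mu>"
      using f radon_prob_continuous_measurable[OF \<mu> g] by (intro borel_measurable_scaleR) auto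
    have "norm (f x *\<^sub>R g x) \<le> norm (C * f x)" for x
      using mult_left_mono[OF C, of "\<bar>f x\<bar>" x] C0 by (simp add: abs_mult mult.commute)
    then show "AE x in \<mu>. norm (f x *\<^sub>R g x) \<le> norm (C * f x)" by simp
  qed
qed

text \<open>The kernel mean embedding of the signed measure g a \<mu>. The operator K factors
  through it: the pairing of f with \<open>K g\<close> in \<open>L\<^sup>2\<close> is
  \<open>Mv f\<close> \<bullet> \<open>Mv g\<close>, which gives symmetry and positivity of K, and
  constants are sent to multiples of \<beta>.\<close>

definition Mv :: "('a \<Rightarrow> real) \<Rightarrow> 'h" where "Mv g = (LINT x|\<mu>. g x *\<^sub>R (a x *\<^sub>R kx x))"

lemma a_kx_cont: "continuous_on UNIV (\<lambda>x. a x *\<^sub>R kx x)"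
  by (intro continuous_intros a_cont kx_cont)

lemma Mv_inner:
  assumes "integrable \<mu> g"
  shows "Mv g \<bullet> h = (LINT x|\<mu>. g x * (a x * (h \<bullet> kx x)))"
proof -
  have "integrable \<mu> (\<lambda>x. g x *\<^sub>R (a x *\<^sub>R kx x))" by (rule bounded_times_integrable[OF assms a_kx_cont])
  from integral_inner_left[OF this, of h] show ?thesis by (simp add: Mv_def inner_commute mult.assoc)
qed

lemma K_op_eq: "integrable \<mu> g \<Longrightarrow> K g y = a y * (Mv g \<bullet> kx y)"
proof -
  assume g: "integrable \<mu> g"
  have "K g y = (LINT x|\<mu>. a y * (g x * (a x * (kx y \<bullet> kx x))))"
    unfolding K_op_def k_mu_def
    by (rule Bochner_Integration.integral_cong) (auto simp: kx_inner k_sym[of _ y])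
  then show ?thesis by (simp add: Mv_inner[OF g])
qed

lemma K_op_cont:
  assumes "integrable \<mu> g"
  shows "continuous_on UNIV (K g)"
proof -
  have "K g = (\<lambda>y. a y * (Mv g \<bullet> kx y))" by (rule ext) (rule K_op_eq[OF assms])
  then show ?thesis by (simp add: continuous_on_mult a_cont cont_inner_kx)
qed

lemma K_op_integral_mult:
  assumes f: "integrable \<mu> f" and g: "integrable \<mu> g"
  shows "(LINT y|\<mu>. f y * K g y) = Mv f \<bullet> Mv g" "integrable \<mu> (\<lambda>y. f y * K g y)"
  using Mv_inner[OF f, of "Mv g"] bounded_times_integrable[OF f K_op_cont[OF g]] by (simp_all add: K_op_eq[OF g])

lemma Mv_1: "Mv (\<lambda>x. 1) = \<beta>"
  using sol_eq[OF B_map_props(1)[OF \<mu>]] by (simp add: Mv_def B_map_props(2)[OF \<mu>])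

lemma K_op_1: "K (\<lambda>x. 1) y = 1"
  using K_op_eq[OF const_integrable] a_bounds(3) by (simp add: Mv_1)

lemma K_op_integral: "integrable \<mu> g \<Longrightarrow> (LINT y|\<mu>. K g y) = (LINT y|\<mu>. g y)"
  using K_op_integral_mult(1)[OF const_integrable[of 1], of g] Mv_inner[of g \<beta>] a_bounds(3)
  by (simp add: Mv_1 inner_commute)

text \<open>Young's inequality \<open>2 \<psi>(x) \<psi>(y) \<le> \<psi>(x)\<^sup>2 + \<psi>(y)\<^sup>2\<close> against the nonnegative kernel \<open>k\<^sub>\<mu> - q\<close>.\<close>

lemma spectral_gap:
  assumes \<psi>: "\<psi> \<in> L2_funs \<mu>"
  shows "q * ((LINT x|\<mu>. (\<psi> x)\<^sup>2) - (LINT x|\<mu>. \<psi> x)\<^sup>2) \<le> (LINT x|\<mu>. (\<psi> x)\<^sup>2) - Mv \<psi> \<bullet> Mv \<psi>"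
proof -
  have I1: "integrable \<mu> \<psi>" by (rule radon_prob_L2_integrable[OF \<mu> \<psi>])
  have I2: "integrable \<mu> (\<lambda>x. (\<psi> x)\<^sup>2)" using \<psi> by (simp add: L2_funs_def)
  define S where "S = (LINT x|\<mu>. (\<psi> x)\<^sup>2)"
  define m where "m = (LINT x|\<mu>. \<psi> x)"
  have K: "integrable \<mu> (\<lambda>x. g x * k_mu \<epsilon> c \<mu> x y)" if "integrable \<mu> g" for g :: "'a \<Rightarrow> real" and y
    using bounded_times_integrable[OF that k_mu_cont] by simp
  have Kd: "(LINT x|\<mu>. g x * (k_mu \<epsilon> c \<mu> x y - q)) = K g y - q * (LINT x|\<mu>. g x)" if "integrable \<mu> g" for g :: "'a \<Rightarrow> real" and y
    unfolding K_op_def right_diff_distrib using K[OF that] that by (simp add: mult.commute)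
  have Kdi: "integrable \<mu> (\<lambda>x. g x * (k_mu \<epsilon> c \<mu> x y - q))" if "integrable \<mu> g" for g :: "'a \<Rightarrow> real" and y
    unfolding right_diff_distrib using K[OF that] that by simp
  have pt: "\<psi> y * K \<psi> y - q * m * \<psi> y \<le> (K (\<lambda>x. (\<psi> x)\<^sup>2) y - q * S) / 2 + (1 - q) / 2 * (\<psi> y)\<^sup>2" for y
  proof -
    have "\<psi> y * (K \<psi> y - q * m) = (LINT x|\<mu>. \<psi> y * (\<psi> x * (k_mu \<epsilon> c \<mu> x y - q)))"
      using Kd[OF I1, of y] by (simp add: m_def)
    also have "\<dots> \<le> (LINT x|\<mu>. ((\<psi> x)\<^sup>2 * (k_mu \<epsilon> c \<mu> x y - q) + (\<psi> y)\<^sup>2 * (1 * (k_mu \<epsilon> c \<mu> x y - q))) / 2)"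
    proof (rule integral_mono)
      show "integrable \<mu> (\<lambda>x. \<psi> y * (\<psi> x * (k_mu \<epsilon> c \<mu> x y - q)))" using Kdi[OF I1, of y] by simp
      show "integrable \<mu> (\<lambda>x. ((\<psi> x)\<^sup>2 * (k_mu \<epsilon> c \<mu> x y - q) + (\<psi> y)\<^sup>2 * (1 * (k_mu \<epsilon> c \<mu> x y - q))) / 2)"
        using Kdi[OF I2, of y] Kdi[OF const_integrable[of 1], of y] by simp
      show "\<psi> y * (\<psi> x * (k_mu \<epsilon> c \<mu> x y - q)) \<le> ((\<psi> x)\<^sup>2 * (k_mu \<epsilon> c \<mu> x y - q) + (\<psi> y)\<^sup>2 * (1 * (k_mu \<epsilon> c \<mu> x y - q))) / 2" for x
        using mult_right_mono[OF sum_squares_bound[of "\<psi> x" "\<psi> y"], of "k_mu \<epsilon> c \<mu> x y - q"] k_mu_bounds(1)[of x y]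
        by (simp add: algebra_simps)
    qed
    \<comment> \<open>By \<open>K_op_1\<close> the kernel \<open>k_mu\<close> has mass 1 in x, so
      \<open>k_mu\<close> minus q has mass 1 - q.\<close>
    also have "\<dots> = (K (\<lambda>x. (\<psi> x)\<^sup>2) y - q * S + (\<psi> y)\<^sup>2 * (1 - q)) / 2"
      using Kd[OF I2, of y] Kd[OF const_integrable[of 1], of y] Kdi[OF I2, of y] Kdi[OF const_integrable[of 1], of y]
      by (simp add: S_def K_op_1 radon_probD[OF \<mu>] del: Bochner_Integration.integral_diff)
    finally show ?thesis by (simp add: algebra_simps add_divide_distrib diff_divide_distrib)
  qed
  have KI: "integrable \<mu> (K (\<lambda>x. (\<psi> x)\<^sup>2))"
    by (rule radon_prob_continuous_integrable[OF \<mu> K_op_cont[OF I2]])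
  have "(LINT y|\<mu>. \<psi> y * K \<psi> y - q * m * \<psi> y) \<le> (LINT y|\<mu>. (K (\<lambda>x. (\<psi> x)\<^sup>2) y - q * S) / 2 + (1 - q) / 2 * (\<psi> y)\<^sup>2)"
    using K_op_integral_mult(2)[OF I1 I1] I1 I2 KI const_integrable
    by (intro integral_mono pt) auto
  also have "\<dots> = (S - q * S) / 2 + (1 - q) / 2 * S"
    using KI I2 const_integrable by (simp add: K_op_integral[OF I2] integral_const S_def radon_probD[OF \<mu>])
  finally have "Mv \<psi> \<bullet> Mv \<psi> - q * m * m \<le> (S - q * S) / 2 + (1 - q) / 2 * S"
    using K_op_integral_mult[OF I1 I1] I1 by (simp add: m_def)
  then show ?thesis unfolding S_def[symmetric] m_def[symmetric]
    by (simp add: power2_eq_square algebra_simps add_divide_distrib diff_divide_distrib)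
qed

text \<open>Subtracting q times the integral changes the equation only by a constant, which the
  quotient absorbs. It replaces \<open>k_mu\<close> by the nonnegative kernel \<open>k_mu\<close> -
  q of mass 1 - q, so the iteration contracts in the supremum norm.\<close>

lemma id_minus_K_solvable:
  fixes \<phi> :: "'a \<Rightarrow> real"
  assumes \<phi>: "continuous_on UNIV \<phi>"
  shows "\<exists>\<psi>. \<psi> \<in> L2_funs \<mu> \<and> (\<exists>r. AE y in \<mu>. \<psi> y - K \<psi> y = \<phi> y + r)"
proof -
  define T where "T f y = \<phi> y + K (apply_bcontfun f) y - q * (LINT x|\<mu>. apply_bcontfun f x)" for f :: "'a \<Rightarrow>\<^sub>C real" and y
  have I: "integrable \<mu> (apply_bcontfun f)" for f :: "'a \<Rightarrow>\<^sub>C real"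
    by (rule radon_prob_continuous_integrable[OF \<mu> apply_bcontfun[of f, unfolded bcontfun_def, THEN CollectD, THEN conjunct1]])
  have Tc: "continuous_on UNIV (T f)" for f
    unfolding T_def by (intro continuous_intros \<phi> K_op_cont[OF I])
  have TB: "apply_bcontfun (Bcontfun (T f)) = T f" for f
  proof (rule Bcontfun_inverse)
    have "bounded (range (T f))" by (rule compact_imp_bounded[OF compact_continuous_image[OF Tc compact_space_UNIV]])
    then show "T f \<in> bcontfun" using Tc by (simp add: bcontfun_def)
  qed
  have "dist (Bcontfun (T f)) (Bcontfun (T g)) \<le> (1 - q) * dist f g" for f g
  proof (rule dist_bound)
    fix y
    define h where "h x = apply_bcontfun f x - apply_bcontfun g x" for x
    have hI: "integrable \<mu> h" unfolding h_def using I by simp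
    have h: "\<bar>h x\<bar> \<le> dist f g" for x
      using dist_bounded[of f x g] by (simp add: h_def dist_real_def)
    have PI: "integrable \<mu> (\<lambda>x. g x * k_mu \<epsilon> c \<mu> x y)" if "integrable \<mu> g" for g :: "'a \<Rightarrow> real"
      using bounded_times_integrable[OF that k_mu_cont] by simp
    have "T f y - T g y = (LINT x|\<mu>. h x * (k_mu \<epsilon> c \<mu> x y - q))"
      unfolding T_def K_op_def h_def right_diff_distrib left_diff_distrib
      using I[of f] I[of g] PI[OF I[of f]] PI[OF I[of g]] by (simp add: mult.commute)
    also have "\<bar>\<dots>\<bar> \<le> (LINT x|\<mu>. \<bar>h x * (k_mu \<epsilon> c \<mu> x y - q)\<bar>)" by simp
    also have "\<dots> \<le> (LINT x|\<mu>. dist f g * (1 * k_mu \<epsilon> c \<mu> x y - q))"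
    proof (rule integral_mono)
      show "integrable \<mu> (\<lambda>x. \<bar>h x * (k_mu \<epsilon> c \<mu> x y - q)\<bar>)"
        unfolding right_diff_distrib using PI[OF hI] hI by simp
      show "integrable \<mu> (\<lambda>x. dist f g * (1 * k_mu \<epsilon> c \<mu> x y - q))"
        using PI[OF const_integrable[of 1]] const_integrable by simp
      show "\<bar>h x * (k_mu \<epsilon> c \<mu> x y - q)\<bar> \<le> dist f g * (1 * k_mu \<epsilon> c \<mu> x y - q)" for x
        using mult_right_mono[OF h[of x], of "k_mu \<epsilon> c \<mu> x y - q"] k_mu_bounds(1)[of x y] by (simp add: abs_mult)
    qed
    also have "\<dots> = dist f g * (K (\<lambda>x. 1) y - q)"
      unfolding K_op_def using PI[OF const_integrable[of 1]] const_integrable by (simp add: radon_probD[OF \<mu>])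
    finally show "dist (apply_bcontfun (Bcontfun (T f)) y) (apply_bcontfun (Bcontfun (T g)) y) \<le> (1 - q) * dist f g"
      by (simp add: TB dist_real_def K_op_1 mult.commute)
  qed
  then have "\<exists>!f. Bcontfun (T f) = f"
    using q_pos q_le_1 by (intro banach_fix_type[where c = "1 - q"]) auto
  then obtain f where f: "Bcontfun (T f) = f" by blast
  define \<psi> where "\<psi> = apply_bcontfun f"
  have eq: "\<psi> = T f" using TB[of f] f by (simp add: \<psi>_def)
  have "\<psi> \<in> L2_funs \<mu>" unfolding eq by (rule radon_prob_continuous_L2[OF \<mu> Tc])
  moreover have "\<psi> y - K \<psi> y = \<phi> y + (- q * (LINT x|\<mu>. \<psi> x))" for y
    by (subst (1) eq) (simp add: T_def \<psi>_def)
  ultimately show ?thesis by (intro exI[of _ \<psi>] conjI exI[of _ "- q * (LINT x|\<mu>. \<psi> x)"]) auto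
qed

section \<open>The quadratic form of the inverse for tangent vectors\<close>

context
  fixes b :: 'h
  assumes b: "b \<bullet> \<beta> = 0"
begin

abbreviation "\<phi> \<equiv> (\<lambda>x. a x * \<iota> b x)"
abbreviation "\<psi> \<equiv> id_minus_K_inv \<epsilon> c \<mu> \<phi>"

lemma \<phi>_cont: "continuous_on UNIV \<phi>"
  using continuous_on_mult[OF a_cont cont_inner_kx, of UNIV b] by (simp only: kx(2))

lemma \<phi>_integral: "(LINT x|\<mu>. \<phi> x) = 0"
proof -
  have "(LINT x|\<mu>. \<phi> x) = \<beta> \<bullet> b"
    using Mv_inner[OF const_integrable[of 1], of b] by (simp only: kx(2) Mv_1 mult_1)
  also have "\<dots> = 0" using b by (simp only: inner_commute)
  finally show ?thesis .
qed

text \<open>K preserves integrals and \<phi> has mean zero, so integrating the equation forces the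
  additive constant r to vanish.\<close>

lemma id_minus_K_inv_props:
  "\<psi> \<in> L2_funs \<mu>" "AE y in \<mu>. \<psi> y - K \<psi> y = \<phi> y"
proof -
  have "\<psi> \<in> L2_funs \<mu> \<and> (\<exists>r. AE y in \<mu>. \<psi> y - K \<psi> y = \<phi> y + r)"
    unfolding id_minus_K_inv_def by (rule someI_ex[OF id_minus_K_solvable[OF \<phi>_cont]])
  then obtain r where L: "\<psi> \<in> L2_funs \<mu>" and r: "AE y in \<mu>. \<psi> y - K \<psi> y = \<phi> y + r" by blast
  have I: "integrable \<mu> \<psi>" by (rule radon_prob_L2_integrable[OF \<mu> L])
  have KI: "integrable \<mu> (K \<psi>)" by (rule radon_prob_continuous_integrable[OF \<mu> K_op_cont[OF I]])
  have PI: "integrable \<mu> \<phi>" by (rule radon_prob_continuous_integrable[OF \<mu> \<phi>_cont])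
  have "(LINT y|\<mu>. \<psi> y - K \<psi> y) = (LINT y|\<mu>. \<phi> y + r)"
    by (rule integral_cong_AE[OF _ _ r]) (use I KI PI in auto)
  then have "r = 0" using I KI PI \<phi>_integral by (simp add: K_op_integral[OF I] integral_const const_integrable radon_probD[OF \<mu>])
  then show "\<psi> \<in> L2_funs \<mu>" "AE y in \<mu>. \<psi> y - K \<psi> y = \<phi> y" using L r by auto
qed

text \<open>The weak form of (id - K) \<psi> = \<phi>. Its right-hand side is symmetric in \<psi>
  and g: with g = \<psi> it feeds the spectral gap, with another representative it compares two
  choices of the inverse.\<close>

lemma inner_id_minus_K_inv:
  assumes g: "g \<in> L2_funs \<mu>"
  shows "(LINT x|\<mu>. \<phi> x * g x) = (LINT x|\<mu>. \<psi> x * g x) - Mv \<psi> \<bullet> Mv g"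
proof -
  note L = id_minus_K_inv_props
  have I: "integrable \<mu> \<psi>" "integrable \<mu> g" by (rule radon_prob_L2_integrable[OF \<mu> L(1)]) (rule radon_prob_L2_integrable[OF \<mu> g])
  have I2: "integrable \<mu> (\<lambda>x. \<psi> x * g x)" by (rule L2_funs_integrable_mult[OF L(1) g])
  have "(LINT x|\<mu>. \<phi> x * g x) = (LINT x|\<mu>. \<psi> x * g x - g x * K \<psi> x)"
  proof (rule integral_cong_AE)
    show "(\<lambda>x. \<phi> x * g x) \<in> borel_measurable \<mu>"
      by (rule borel_measurable_times[OF radon_prob_continuous_measurable[OF \<mu> \<phi>_cont] borel_measurable_integrable[OF I(2)]])
    show "(\<lambda>x. \<psi> x * g x - g x * K \<psi> x) \<in> borel_measurable \<mu>"
      using I2 K_op_integral_mult(2)[OF I(2,1)] by auto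
    show "AE x in \<mu>. \<phi> x * g x = \<psi> x * g x - g x * K \<psi> x"
      using L(2)
    proof eventually_elim
      case (elim x)
      show ?case unfolding elim[symmetric] by (simp add: algebra_simps)
    qed
  qed
  also have "\<dots> = (LINT x|\<mu>. \<psi> x * g x) - Mv g \<bullet> Mv \<psi>"
    using I2 K_op_integral_mult[OF I(2,1)] by simp
  finally show ?thesis by (simp add: inner_commute)
qed

text \<open>The spectral gap bounds the form \<open>Q\<close> below by q times the variance of
  \<psi>. For the upper bound, Young's inequality with weight q leaves q times the variance, at most
  \<open>Q\<close>, and the supremum of \<open>\<phi>\<^sup>2 / q\<close>, at most
  \<open>(norm b)\<^sup>2 / q ^ 3\<close> because a \<le> 1/q.\<close>

lemma quadratic_form_bounds:
  "0 \<le> (LINT x|\<mu>. \<phi> x * \<psi> x)" "(LINT x|\<mu>. \<phi> x * \<psi> x) \<le> (norm b)\<^sup>2 / q ^ 3"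
proof -
  note L = id_minus_K_inv_props(1)
  define Q where "Q = (LINT x|\<mu>. \<phi> x * \<psi> x)"
  define m where "m = (LINT x|\<mu>. \<psi> x)"
  define S where "S = (LINT x|\<mu>. (\<psi> x)\<^sup>2)"
  have I: "integrable \<mu> \<psi>" by (rule radon_prob_L2_integrable[OF \<mu> L])
  have I2: "integrable \<mu> (\<lambda>x. (\<psi> x)\<^sup>2)" using L by (simp add: L2_funs_def)
  have QV: "q * (S - m\<^sup>2) \<le> Q"
    using spectral_gap[OF L] inner_id_minus_K_inv[OF L] by (simp add: Q_def S_def m_def power2_eq_square)
  have mI: "(LINT x|\<mu>. \<psi> x) = m" and SI: "(LINT x|\<mu>. (\<psi> x)\<^sup>2) = S" by (simp_all only: m_def S_def)
  have V2: "(\<psi> x - m)\<^sup>2 = (\<psi> x)\<^sup>2 - 2 * m * \<psi> x + m\<^sup>2" for x by (simp add: power2_diff)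
  have I3: "integrable \<mu> (\<lambda>x. (\<psi> x - m)\<^sup>2)" unfolding V2 using I I2 const_integrable by simp
  have "(LINT x|\<mu>. (\<psi> x - m)\<^sup>2) = (LINT x|\<mu>. (\<psi> x)\<^sup>2) - 2 * m * (LINT x|\<mu>. \<psi> x) + m\<^sup>2"
    unfolding V2 using I I2 const_integrable by (simp add: radon_probD[OF \<mu>])
  then have V: "(LINT x|\<mu>. (\<psi> x - m)\<^sup>2) = S - m\<^sup>2" unfolding mI SI by (simp add: power2_eq_square)
  have "0 \<le> (LINT x|\<mu>. (\<psi> x - m)\<^sup>2)" by (rule Bochner_Integration.integral_nonneg) (rule zero_le_power2)
  then have "0 \<le> S - m\<^sup>2" unfolding V .
  then have "0 \<le> q * (S - m\<^sup>2)" using q_pos by simp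
  then show "0 \<le> (LINT x|\<mu>. \<phi> x * \<psi> x)" using QV by (simp add: Q_def)
  have PL: "\<phi> \<in> L2_funs \<mu>" by (rule radon_prob_continuous_L2[OF \<mu> \<phi>_cont])
  have PI1: "integrable \<mu> (\<lambda>x. \<phi> x * \<psi> x)" by (rule L2_funs_integrable_mult[OF PL L])
  have PI2: "integrable \<mu> \<phi>" by (rule radon_prob_L2_integrable[OF \<mu> PL])
  define F where "F = \<phi>"
  define G where "G = \<psi>"
  have \<phi>b: "(\<phi> x)\<^sup>2 \<le> (norm b)\<^sup>2 / q\<^sup>2" for x
  proof -
    have "\<bar>a x\<bar> * \<bar>\<iota> b x\<bar> \<le> 1 / q * norm b"
      using a_bounds[of x] q_pos inner_kx_le[of b x] by (intro mult_mono) (simp_all add: kx(2))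
    then have "\<bar>\<phi> x\<bar> \<le> 1 / q * norm b" unfolding abs_mult .
    from power_mono[OF this, of 2] show ?thesis by (simp add: power_mult_distrib power_divide)
  qed
  \<comment> \<open>As \<phi> has mean zero, \<psi> may be replaced by \<psi> - m, so that only the
    variance enters.\<close>
  have "2 * Q = (LINT x|\<mu>. 2 * (F x * G x) - 2 * m * F x)"
    using PI1 PI2 \<phi>_integral unfolding Q_def F_def G_def by simp
  also have "\<dots> \<le> (LINT x|\<mu>. (norm b)\<^sup>2 / q ^ 3 + q * (G x - m)\<^sup>2)"
  proof (rule integral_mono)
    show "integrable \<mu> (\<lambda>x. 2 * (F x * G x) - 2 * m * F x)"
      using PI1 PI2 unfolding F_def G_def by simp
    show "integrable \<mu> (\<lambda>x. (norm b)\<^sup>2 / q ^ 3 + q * (G x - m)\<^sup>2)"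
      using const_integrable I3 unfolding G_def by simp
    fix x
    have "2 * (F x * G x) - 2 * m * F x = 2 * (F x / sqrt q) * (sqrt q * (G x - m))"
      using q_pos by (simp add: algebra_simps)
    also have "\<dots> \<le> (F x / sqrt q)\<^sup>2 + (sqrt q * (G x - m))\<^sup>2" by (rule sum_squares_bound)
    also have "\<dots> = (F x)\<^sup>2 / q + q * (G x - m)\<^sup>2" using q_pos by (simp add: power_divide power_mult_distrib)
    also have "(F x)\<^sup>2 / q \<le> (norm b)\<^sup>2 / q\<^sup>2 / q"
      using \<phi>b[of x] q_pos unfolding F_def by (intro divide_right_mono) auto
    also have "(norm b)\<^sup>2 / q\<^sup>2 / q = (norm b)\<^sup>2 / q ^ 3" by (simp add: power2_eq_square power3_eq_cube)
    finally show "2 * (F x * G x) - 2 * m * F x \<le> (norm b)\<^sup>2 / q ^ 3 + q * (G x - m)\<^sup>2" by simp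
  qed
  also have "\<dots> = (norm b)\<^sup>2 / q ^ 3 + q * (LINT x|\<mu>. (G x - m)\<^sup>2)"
    using const_integrable I3 unfolding G_def by (simp add: radon_probD[OF \<mu>])
  also have "\<dots> = (norm b)\<^sup>2 / q ^ 3 + q * (S - m\<^sup>2)" using V unfolding G_def by simp
  finally show "(LINT x|\<mu>. \<phi> x * \<psi> x) \<le> (norm b)\<^sup>2 / q ^ 3" using QV by (simp add: Q_def)
qed

end

lemma metric_tensor_bounds:
  assumes "b \<bullet> \<beta> = 0"
  shows "\<epsilon> / 2 * (norm b)\<^sup>2 \<le> metric_tensor \<iota> \<epsilon> c \<mu> b"
    "metric_tensor \<iota> \<epsilon> c \<mu> b \<le> \<epsilon> / 2 * (1 + 2 * exp (11 / (2 * \<epsilon>) * sup_norm c)) * (norm b)\<^sup>2"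
proof -
  note Q = quadratic_form_bounds[OF assms]
  show "\<epsilon> / 2 * (norm b)\<^sup>2 \<le> metric_tensor \<iota> \<epsilon> c \<mu> b"
    unfolding metric_tensor_def Let_def using Q(1) eps by (intro mult_left_mono) auto
  have "sup_norm c \<ge> 0"
    using q_le_1 eps by (simp add: q_def zero_le_divide_iff)
  \<comment> \<open>The factor 1/\<open>q ^ 3\<close> has exponent 3; nonnegativity of the supremum
    norm allows it to be raised to 11/2.\<close>
  then have "3 * sup_norm c / \<epsilon> \<le> 11 / (2 * \<epsilon>) * sup_norm c"
    using eps by (simp add: field_simps)
  moreover have "q ^ 3 = exp (real 3 * (- sup_norm c / \<epsilon>))" by (simp only: q_def exp_of_nat_mult)
  then have "1 / q ^ 3 = exp (3 * sup_norm c / \<epsilon>)" by (simp add: exp_minus inverse_eq_divide)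
  ultimately have E: "1 / q ^ 3 \<le> exp (11 / (2 * \<epsilon>) * sup_norm c)" by simp
  have "(norm b)\<^sup>2 + 2 * (LINT x|\<mu>. a x * \<iota> b x * id_minus_K_inv \<epsilon> c \<mu> (\<lambda>x. a x * \<iota> b x) x)
      \<le> (norm b)\<^sup>2 + 2 * (exp (11 / (2 * \<epsilon>) * sup_norm c) * (norm b)\<^sup>2)"
    using Q(2) mult_right_mono[OF E, of "(norm b)\<^sup>2"] by simp
  also have "\<dots> = (1 + 2 * exp (11 / (2 * \<epsilon>) * sup_norm c)) * (norm b)\<^sup>2" by (simp add: algebra_simps)
  finally show "metric_tensor \<iota> \<epsilon> c \<mu> b \<le> \<epsilon> / 2 * (1 + 2 * exp (11 / (2 * \<epsilon>) * sup_norm c)) * (norm b)\<^sup>2"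
    unfolding metric_tensor_def Let_def mult.assoc[of "\<epsilon> / 2"] using eps by (intro mult_left_mono) auto
qed

text \<open>The symmetry of \<open>K\<close> makes the value independent of the choice of representatives.\<close>

lemma metric_tensor_scale:
  assumes b: "b \<bullet> \<beta> = 0"
  shows "metric_tensor \<iota> \<epsilon> c \<mu> (l *\<^sub>R b) = l\<^sup>2 * metric_tensor \<iota> \<epsilon> c \<mu> b"
proof -
  have lb: "(l *\<^sub>R b) \<bullet> \<beta> = 0" using b by simp
  define f where "f = (\<lambda>x. a x * \<iota> b x)"
  define f' where "f' = (\<lambda>x. a x * \<iota> (l *\<^sub>R b) x)"
  define p where "p = id_minus_K_inv \<epsilon> c \<mu> f"
  define p' where "p' = id_minus_K_inv \<epsilon> c \<mu> f'"
  note L = id_minus_K_inv_props(1)[OF b, folded f_def, folded p_def] id_minus_K_inv_props(1)[OF lb, folded f'_def, folded p'_def]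
  have ff: "f' x = l * f x" for x by (simp add: f_def f'_def kx(2))
  \<comment> \<open>Pairing each equation with the solution of the other relates p and p' without
    identifying p' with l p.\<close>
  have "(LINT x|\<mu>. f x * p' x) = (LINT x|\<mu>. p x * p' x) - Mv p \<bullet> Mv p'"
    using inner_id_minus_K_inv[OF b L(2)] by (simp only: f_def f'_def p_def p'_def)
  also have "\<dots> = (LINT x|\<mu>. p' x * p x) - Mv p' \<bullet> Mv p"
    by (simp add: inner_commute mult.commute)
  also have "\<dots> = (LINT x|\<mu>. f' x * p x)"
    using inner_id_minus_K_inv[OF lb L(1)] by (simp only: f_def f'_def p_def p'_def)
  finally have "(LINT x|\<mu>. f' x * p' x) = l\<^sup>2 * (LINT x|\<mu>. f x * p x)"
    by (simp add: ff mult.assoc power2_eq_square)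
  then show ?thesis
    unfolding metric_tensor_def Let_def f_def[symmetric] f'_def[symmetric] p_def[symmetric] p'_def[symmetric]
    by (simp add: power_mult_distrib algebra_simps)
qed

end

end

section \<open>Energy bounds\<close>

lemma integral_real_determined_by_nonneg:
  fixes f :: "'a::compact_metric_space \<Rightarrow> real"
  assumes \<mu>: "\<mu> \<in> radon_prob" and f: "continuous_on UNIV f" and C: "\<And>x. \<bar>f x\<bar> \<le> C"
  shows "(LINT x|\<mu>. f x) = enn2real (\<integral>\<^sup>+x. ennreal (f x + C) \<partial>\<mu>) - C"
proof -
  have I: "integrable \<mu> f" by (rule radon_prob_continuous_integrable[OF \<mu> f])
  have c: "integrable \<mu> (\<lambda>x. C)" by (rule radon_prob_const_integrable[OF \<mu>])
  have "(LINT x|\<mu>. f x + C) = enn2real (\<integral>\<^sup>+x. ennreal (f x + C) \<partial>\<mu>)"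
  proof (rule integral_eq_nn_integral)
    show "(\<lambda>x. f x + C) \<in> borel_measurable \<mu>"
      using I by (intro borel_measurable_add) auto
    have "0 \<le> f x + C" for x using C[of x] by linarith
    then show "AE x in \<mu>. 0 \<le> f x + C" by simp
  qed
  then show ?thesis using I c radon_probD[OF \<mu>] by simp
qed

text \<open>A convex combination is realized as a random choice: a Bernoulli variable selects the
  second measure with probability w, and binding keeps the total mass 1.\<close>

lemma radon_prob_mixture:
  fixes \<nu>0 \<nu>1 :: "'a::compact_metric_space measure"
  assumes \<nu>: "\<nu>0 \<in> radon_prob" "\<nu>1 \<in> radon_prob" and w: "0 \<le> w" "w \<le> 1"
  obtains \<mu> where "\<mu> \<in> radon_prob"
    "\<And>f. continuous_on UNIV (f :: 'a \<Rightarrow> real) \<Longrightarrow>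
      (LINT x|\<mu>. f x) = w * (LINT x|\<nu>1. f x) + (1 - w) * (LINT x|\<nu>0. f x)"
proof -
  define N where "N b = (if b then \<nu>1 else \<nu>0)" for b
  define \<mu> where "\<mu> = measure_pmf (bernoulli_pmf w) \<bind> N"
  have Nr: "N b \<in> radon_prob" for b using \<nu> by (simp add: N_def)
  have N: "N \<in> measure_pmf (bernoulli_pmf w) \<rightarrow>\<^sub>M subprob_algebra borel"
    using radon_probD(1,2)[OF Nr]
    by (auto simp: measurable_pmf_measure1 space_subprob_algebra prob_space_imp_subprob_space)
  have "sets \<mu> = sets borel" unfolding \<mu>_def by (rule sets_bind) (use radon_probD(2)[OF Nr] in auto)
  moreover have "prob_space \<mu>"
    unfolding \<mu>_def
    by (rule prob_space.prob_space_bind[OF prob_space_measure_pmf _ N]) (use radon_probD(1)[OF Nr] in simp)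
  ultimately have \<mu>: "\<mu> \<in> radon_prob" by (simp add: radon_prob_iff_borel_prob)
  moreover have "(LINT x|\<mu>. f x) = w * (LINT x|\<nu>1. f x) + (1 - w) * (LINT x|\<nu>0. f x)"
    if f: "continuous_on UNIV f" for f :: "'a \<Rightarrow> real"
  proof -
    obtain C where C: "\<And>x. norm (f x) \<le> C" using continuous_bounded_compact[OF f] by blast
    then have C': "\<And>x. \<bar>f x\<bar> \<le> C" by simp
    have m: "(\<lambda>x. ennreal (f x + C)) \<in> borel_measurable borel"
      using borel_measurable_continuous_onI[OF f] by measurable
    have fin: "(\<integral>\<^sup>+x. ennreal (f x + C) \<partial>\<nu>) < \<top>" if "\<nu> \<in> radon_prob" for \<nu>
    proof -
      have "(\<integral>\<^sup>+x. ennreal (f x + C) \<partial>\<nu>) \<le> (\<integral>\<^sup>+x. ennreal (2 * C) \<partial>\<nu>)"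
        using C' by (intro nn_integral_mono ennreal_leI) (simp add: abs_le_iff)
      also have "\<dots> < \<top>" using radon_probD[OF that] by (simp add: ennreal_mult_less_top)
      finally show ?thesis .
    qed
    \<comment> \<open>Integration over the bound measure is available for nonnegative functions,
      hence the shift of f by its bound \<open>C\<close>.\<close>
    have "(\<integral>\<^sup>+x. ennreal (f x + C) \<partial>\<mu>) =
        (\<integral>\<^sup>+x. ennreal (f x + C) \<partial>\<nu>1) * ennreal w + (\<integral>\<^sup>+x. ennreal (f x + C) \<partial>\<nu>0) * ennreal (1 - w)"
      unfolding \<mu>_def nn_integral_bind[OF m N]
      by (subst nn_integral_bernoulli_pmf[OF w]) (rule zero_le, unfold N_def if_True if_False, rule refl)
    then have "enn2real (\<integral>\<^sup>+x. ennreal (f x + C) \<partial>\<mu>) =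
       enn2real (\<integral>\<^sup>+x. ennreal (f x + C) \<partial>\<nu>1) * w + enn2real (\<integral>\<^sup>+x. ennreal (f x + C) \<partial>\<nu>0) * (1 - w)"
      using fin[OF \<nu>(1)] fin[OF \<nu>(2)] w
      by (simp add: enn2real_plus enn2real_mult ennreal_mult_less_top)
    then show ?thesis
      unfolding integral_real_determined_by_nonneg[OF \<mu> f C'] integral_real_determined_by_nonneg[OF \<nu>(1) f C']
        integral_real_determined_by_nonneg[OF \<nu>(2) f C']
      by (simp add: algebra_simps)
  qed
  ultimately show ?thesis using that by blast
qed

lemma radon_prob_density:
  fixes \<mu> :: "'a::compact_metric_space measure"
  assumes \<mu>: "\<mu> \<in> radon_prob" and g: "continuous_on UNIV g" "\<And>x. 0 \<le> g x" "(LINT x|\<mu>. g x) = 1"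
  obtains \<nu> where "\<nu> \<in> radon_prob"
    "\<And>f. continuous_on UNIV (f :: 'a \<Rightarrow> real) \<Longrightarrow> (LINT x|\<nu>. f x) = (LINT x|\<mu>. g x * f x)"
proof -
  define \<nu> where "\<nu> = density \<mu> (\<lambda>x. ennreal (g x))"
  have gm: "g \<in> borel_measurable \<mu>" by (rule radon_prob_continuous_measurable[OF \<mu> g(1)])
  have "(\<integral>\<^sup>+x. ennreal (g x) \<partial>\<mu>) = ennreal (LINT x|\<mu>. g x)"
    by (rule nn_integral_eq_integral[OF radon_prob_continuous_integrable[OF \<mu> g(1)]]) (use g(2) in simp)
  then have "prob_space \<nu>"
    unfolding \<nu>_def using gm g(3) by (intro prob_spaceI) (simp add: emeasure_density cong: nn_integral_cong)
  then have "\<nu> \<in> radon_prob" using radon_probD(2)[OF \<mu>] by (simp add: radon_prob_iff_borel_prob \<nu>_def)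
  moreover have "(LINT x|\<nu>. f x) = (LINT x|\<mu>. g x * f x)" if "continuous_on UNIV f" for f :: "'a \<Rightarrow> real"
    unfolding \<nu>_def
    using radon_prob_continuous_measurable[OF \<mu> that] gm g(2) by (subst integral_density) auto
  ultimately show ?thesis using that by blast
qed

context gibbs_rkhs
begin

abbreviation "Bm \<equiv> B_map \<iota> \<epsilon> c"

lemmas sol_B = B_map_props(1)

lemma solI_inner:
  assumes \<mu>: "\<mu> \<in> radon_prob" and pos: "\<And>x. 0 < \<gamma> \<bullet> kx x"
    and eq: "\<And>h. \<gamma> \<bullet> h = (LINT x|\<mu>. 1 / (\<gamma> \<bullet> kx x) * (h \<bullet> kx x))"
  shows "sol \<mu> \<gamma>"
proof -
  have c: "continuous_on UNIV (\<lambda>x. 1 / (\<gamma> \<bullet> kx x))"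
    by (intro continuous_on_divide continuous_on_const cont_inner_kx) (use pos in \<open>auto simp: less_imp_neq[symmetric]\<close>)
  have "\<gamma> \<bullet> h = (LINT x|\<mu>. (1 / (\<gamma> \<bullet> kx x)) *\<^sub>R kx x) \<bullet> h" for h
    unfolding eq[of h] inner_integral_kx[OF \<mu> c] ..
  then have "\<gamma> = (LINT x|\<mu>. (1 / (\<gamma> \<bullet> kx x)) *\<^sub>R kx x)" by (metis vector_eq_rdot)
  then show ?thesis using pos by (simp add: sol_def)
qed

text \<open>The equation for \<open>Bm \<mu>0\<close>, tested with \<open>Bm \<mu>1\<close>, has
  weights at least 1 and values at least q. The acute angle keeps the segment between the two unit
  vectors away from 0.\<close>

lemma B_inner_pos:
  assumes \<mu>: "\<mu>0 \<in> radon_prob" "\<mu>1 \<in> radon_prob"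
  shows "0 < Bm \<mu>0 \<bullet> Bm \<mu>1"
proof -
  note s = sol_B[OF \<mu>(1)] sol_B[OF \<mu>(2)]
  have "1 \<le> 1 / (Bm \<mu>0 \<bullet> kx x)" for x
    using sol_bounds(2,3)[OF \<mu>(1) s(1), of x] q_pos by simp
  then have "q \<le> (LINT x|\<mu>0. 1 / (Bm \<mu>0 \<bullet> kx x) * (Bm \<mu>1 \<bullet> kx x))"
    by (intro q_le_weighted_integral[OF \<mu>(1) sol_inv_cont[OF s(1)]] sol_bounds(3)[OF \<mu>(2) s(2)])
  also have "\<dots> = Bm \<mu>0 \<bullet> Bm \<mu>1" by (rule sol_inner[OF \<mu>(1) s(1), symmetric])
  finally show ?thesis using q_pos by simp
qed

text \<open>
  \<open>\<gamma>\<close> represents the measure \<open>r ((1-t) a\<^sub>0 \<mu>\<^sub>0 + t a\<^sub>1 \<mu>\<^sub>1)\<close>; multiplying it by \<open>\<gamma>\<close> gives a probability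
  measure whose image under \<open>B\<close> is \<open>\<gamma>\<close>.
\<close>

lemma normalized_segment_in_range:
  assumes \<mu>: "\<mu>0 \<in> radon_prob" "\<mu>1 \<in> radon_prob" and t: "0 \<le> t" "t \<le> 1" and r: "0 < r"
    and \<gamma>: "\<gamma> = r *\<^sub>R ((1 - t) *\<^sub>R Bm \<mu>0 + t *\<^sub>R Bm \<mu>1)" "norm \<gamma> = 1"
  shows "\<exists>\<mu>\<in>radon_prob. sol \<mu> \<gamma>"
proof -
  note s = sol_B[OF \<mu>(1)] sol_B[OF \<mu>(2)]
  define \<beta>0 where "\<beta>0 = Bm \<mu>0"
  define \<beta>1 where "\<beta>1 = Bm \<mu>1"
  note \<gamma>' = \<gamma>(1)[folded \<beta>0_def \<beta>1_def]
  note s' = s[folded \<beta>0_def \<beta>1_def]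
  have conv: "0 < r * ((1 - t) * u + t * v)" if "u > 0" "v > 0" for u v
  proof (cases "t = 0")
    case False
    then have "0 < t * v" "0 \<le> (1 - t) * u" using that t by auto
    then show ?thesis by (intro mult_pos_pos[OF r] add_nonneg_pos)
  qed (use r that in simp)
  have inner: "\<gamma> \<bullet> h = r * ((1 - t) * (\<beta>0 \<bullet> h) + t * (\<beta>1 \<bullet> h))" for h
    by (simp add: \<gamma>' inner_add_left)
  have p0: "0 < \<beta>0 \<bullet> kx x" "0 < \<beta>1 \<bullet> kx x" for x using s' by (auto simp: sol_def)
  have e: "0 < \<gamma> \<bullet> kx x" for x unfolding inner by (intro conv p0)
  have n: "\<beta>0 \<bullet> \<beta>0 = 1" "\<beta>1 \<bullet> \<beta>1 = 1"
    using sol_bounds(1)[OF \<mu>(1) s(1)] sol_bounds(1)[OF \<mu>(2) s(2)] by (simp_all add: \<beta>0_def \<beta>1_def norm_eq_1)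
  have p01: "0 < \<beta>0 \<bullet> \<beta>1" "0 < \<beta>1 \<bullet> \<beta>0"
    using B_inner_pos[OF \<mu>] B_inner_pos[OF \<mu>(2,1)] by (simp_all add: \<beta>0_def \<beta>1_def)
  have P: "0 < \<gamma> \<bullet> \<beta>0" "0 < \<gamma> \<bullet> \<beta>1" unfolding inner n using p01 by (auto intro: conv simp del: mult_1_right)
  have dens: "\<exists>\<nu>\<in>radon_prob. \<forall>h. (LINT x|\<nu>. 1 / (\<gamma> \<bullet> kx x) * (h \<bullet> kx x)) = (\<beta> \<bullet> h) / (\<gamma> \<bullet> \<beta>)"
    if m: "m \<in> radon_prob" and sm: "sol m \<beta>" and pb: "0 < \<gamma> \<bullet> \<beta>" for m \<beta>
  proof -
    \<comment> \<open>Reweighting m by the quotient of \<gamma> \<bullet> \<open>kx x\<close> and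
      \<beta> \<bullet> \<open>kx x\<close> trades the weight of \<beta> for that of \<gamma>:
      against 1/(\<gamma> \<bullet> \<open>kx x\<close>) the factor \<gamma> \<bullet>
      \<open>kx x\<close> cancels. Division by \<gamma> \<bullet> \<beta> normalizes the
      mass.\<close>
    define g where "g x = 1 / (\<beta> \<bullet> kx x) * (\<gamma> \<bullet> kx x) / (\<gamma> \<bullet> \<beta>)" for x
    have bp: "0 < \<beta> \<bullet> kx x" for x using sm by (simp add: sol_def)
    have gc: "continuous_on UNIV g"
      unfolding g_def using pb by (intro continuous_on_divide[OF _ continuous_on_const] continuous_on_mult sol_inv_cont[OF sm] cont_inner_kx) auto
    have g0: "0 \<le> g x" for x unfolding g_def using e[of x] bp[of x] pb by simp
    have "(LINT x|m. g x) = (LINT x|m. 1 / (\<beta> \<bullet> kx x) * (\<gamma> \<bullet> kx x)) / (\<gamma> \<bullet> \<beta>)"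
      unfolding g_def by (rule integral_divide_zero)
    also have "\<dots> = 1" unfolding sol_inner[OF m sm, symmetric] using pb by (simp add: inner_commute)
    finally have "(LINT x|m. g x) = 1" .
    then obtain \<nu> where \<nu>: "\<nu> \<in> radon_prob"
      "\<And>f. continuous_on UNIV f \<Longrightarrow> (LINT x|\<nu>. f x) = (LINT x|m. g x * f x)"
      using radon_prob_density[OF m gc g0] by blast
    have "(LINT x|\<nu>. 1 / (\<gamma> \<bullet> kx x) * (h \<bullet> kx x)) = (\<beta> \<bullet> h) / (\<gamma> \<bullet> \<beta>)" for h
    proof -
      have c: "continuous_on UNIV (\<lambda>x. 1 / (\<gamma> \<bullet> kx x) * (h \<bullet> kx x))"
        by (intro continuous_on_mult continuous_on_divide continuous_on_const cont_inner_kx)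
          (use e in \<open>auto simp: less_imp_neq[symmetric]\<close>)
      have "g x * (1 / (\<gamma> \<bullet> kx x) * (h \<bullet> kx x)) = 1 / (\<beta> \<bullet> kx x) * (h \<bullet> kx x) / (\<gamma> \<bullet> \<beta>)" for x
        unfolding g_def using e[of x] by simp
      then have "(LINT x|\<nu>. 1 / (\<gamma> \<bullet> kx x) * (h \<bullet> kx x)) = (LINT x|m. 1 / (\<beta> \<bullet> kx x) * (h \<bullet> kx x) / (\<gamma> \<bullet> \<beta>))"
        using \<nu>(2)[OF c] by simp
      also have "\<dots> = (LINT x|m. 1 / (\<beta> \<bullet> kx x) * (h \<bullet> kx x)) / (\<gamma> \<bullet> \<beta>)" by (rule integral_divide_zero)
      finally show ?thesis unfolding sol_inner[OF m sm, symmetric] .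
    qed
    then show ?thesis using \<nu>(1) by blast
  qed
  obtain \<nu>0 where \<nu>0: "\<nu>0 \<in> radon_prob" "\<And>h. (LINT x|\<nu>0. 1 / (\<gamma> \<bullet> kx x) * (h \<bullet> kx x)) = (\<beta>0 \<bullet> h) / (\<gamma> \<bullet> \<beta>0)"
    using dens[OF \<mu>(1) s'(1) P(1)] by blast
  obtain \<nu>1 where \<nu>1: "\<nu>1 \<in> radon_prob" "\<And>h. (LINT x|\<nu>1. 1 / (\<gamma> \<bullet> kx x) * (h \<bullet> kx x)) = (\<beta>1 \<bullet> h) / (\<gamma> \<bullet> \<beta>1)"
    using dens[OF \<mu>(2) s'(2) P(2)] by blast
  \<comment> \<open>The mixture weight undoes the normalization by \<gamma> \<bullet> \<beta>1. That
    the two weights add up to 1 is the identity \<gamma> \<bullet> \<gamma> = 1 expanded along the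
    segment.\<close>
  define w where "w = r * t * (\<gamma> \<bullet> \<beta>1)"
  have w1: "1 - w = r * (1 - t) * (\<gamma> \<bullet> \<beta>0)"
    using inner[of \<gamma>] \<gamma>(2) by (simp add: w_def norm_eq_1 inner_commute algebra_simps)
  have "0 \<le> w" "0 \<le> 1 - w" unfolding w1 unfolding w_def using r t P by (auto intro!: mult_nonneg_nonneg)
  then obtain \<mu> where \<mu>': "\<mu> \<in> radon_prob"
    "\<And>f. continuous_on UNIV f \<Longrightarrow> (LINT x|\<mu>. f x) = w * (LINT x|\<nu>1. f x) + (1 - w) * (LINT x|\<nu>0. f x)"
    using radon_prob_mixture[OF \<nu>0(1) \<nu>1(1), of w] by auto
  have "sol \<mu> \<gamma>"
  proof (rule solI_inner[OF \<mu>'(1) e])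
    fix h
    have c: "continuous_on UNIV (\<lambda>x. 1 / (\<gamma> \<bullet> kx x) * (h \<bullet> kx x))"
      by (intro continuous_on_mult continuous_on_divide continuous_on_const cont_inner_kx)
        (use e in \<open>auto simp: less_imp_neq[symmetric]\<close>)
    have "(LINT x|\<mu>. 1 / (\<gamma> \<bullet> kx x) * (h \<bullet> kx x)) =
       w * ((\<beta>1 \<bullet> h) / (\<gamma> \<bullet> \<beta>1)) + (1 - w) * ((\<beta>0 \<bullet> h) / (\<gamma> \<bullet> \<beta>0))"
      unfolding \<mu>'(2)[OF c] \<nu>0(2) \<nu>1(2) ..
    also have "\<dots> = r * t * (\<beta>1 \<bullet> h) + r * (1 - t) * (\<beta>0 \<bullet> h)"
      unfolding w1 unfolding w_def using P by simp
    also have "\<dots> = \<gamma> \<bullet> h" unfolding inner by (simp add: algebra_simps)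
    finally show "\<gamma> \<bullet> h = (LINT x|\<mu>. 1 / (\<gamma> \<bullet> kx x) * (h \<bullet> kx x))" ..
  qed
  then show ?thesis using \<mu>'(1) by blast
qed

section \<open>Paths, their speed and two-sided energy estimates\<close>

definition paths :: "'a measure \<Rightarrow> 'a measure \<Rightarrow> (real \<Rightarrow> 'a measure) set" where
  "paths \<mu>0 \<mu>1 = {\<mu>. admissible_path \<iota> \<epsilon> c \<mu> \<and> \<mu> 0 = \<mu>0 \<and> \<mu> 1 = \<mu>1}"

abbreviation "speed p \<equiv> sobolev_deriv (\<lambda>t. Bm (p t))"

abbreviation "energy \<equiv> path_energy \<iota> \<epsilon> c"

abbreviation "dS \<equiv> sinkhorn_dist \<iota> \<epsilon> c"

abbreviation "tensor \<equiv> metric_tensor \<iota> \<epsilon> c"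

lemma norm_B: "\<mu> \<in> radon_prob \<Longrightarrow> norm (Bm \<mu>) = 1"
  using sol_bounds(1) sol_B by blast

text \<open>The last conclusion is the derivative of the constant squared norm of
  \<open>Bm (p t)\<close>; it is the orthogonality under which the tensor is bounded.\<close>

lemma admissible_pathD:
  assumes "admissible_path \<iota> \<epsilon> c p"
  shows "t \<in> {0..1} \<Longrightarrow> p t \<in> radon_prob" "continuous_on {0..1} (\<lambda>t. Bm (p t))"
    "has_L2_deriv (\<lambda>t. Bm (p t)) (speed p)" "AE t in leb01. Bm (p t) \<bullet> speed p t = 0"
proof -
  show r: "p t \<in> radon_prob" if "t \<in> {0..1}" for t using assms that by (auto simp: admissible_path_def)
  show c: "continuous_on {0..1} (\<lambda>t. Bm (p t))" using assms by (simp add: admissible_path_def)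
  have "\<exists>v. has_sobolev_deriv (\<lambda>t. Bm (p t)) v" using assms by (simp add: admissible_path_def)
  then have "has_sobolev_deriv (\<lambda>t. Bm (p t)) (speed p)" unfolding sobolev_deriv_def by (rule someI_ex)
  then show d: "has_L2_deriv (\<lambda>t. Bm (p t)) (speed p)" using has_sobolev_deriv_iff[OF c] by blast
  show "AE t in leb01. Bm (p t) \<bullet> speed p t = 0"
    by (rule has_L2_deriv_orthogonal[OF d c]) (use norm_B[OF r] in simp)
qed

lemma admissible_pathI:
  assumes r: "\<And>t. t \<in> {0..1} \<Longrightarrow> p t \<in> radon_prob" and eq: "\<And>t. t \<in> {0..1} \<Longrightarrow> Bm (p t) = \<gamma> t"
    and c: "continuous_on {0..1} \<gamma>" and d: "has_L2_deriv \<gamma> w"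
  shows "admissible_path \<iota> \<epsilon> c p" "AE t in leb01. speed p t = w t"
proof -
  have c': "continuous_on {0..1} (\<lambda>t. Bm (p t))" by (rule continuous_on_eq[OF c]) (use eq in simp)
  have d': "has_L2_deriv (\<lambda>t. Bm (p t)) w" using d eq unfolding has_L2_deriv_def by auto
  show a: "admissible_path \<iota> \<epsilon> c p"
    unfolding admissible_path_def using r c' d' has_sobolev_deriv_iff[OF c'] by blast
  show "AE t in leb01. speed p t = w t"
    by (rule has_L2_deriv_unique[OF admissible_pathD(3)[OF a] d'])
qed

lemma AE_unit_mem: "AE t in leb01. t \<in> {0..1}"
  by (rule AE_I2) simp

lemma energy_lower:
  assumes "p \<in> paths \<mu>0 \<mu>1"
  shows "ennreal (\<epsilon> / 2 * (norm (Bm \<mu>0 - Bm \<mu>1))\<^sup>2) \<le> energy p"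
proof -
  have a: "admissible_path \<iota> \<epsilon> c p" "p 0 = \<mu>0" "p 1 = \<mu>1" using assms by (auto simp: paths_def)
  have em: "ennreal (\<epsilon> / 2) * ennreal x = ennreal (\<epsilon> / 2 * x)" for x
    by (rule ennreal_mult'[symmetric]) (use eps in simp)
  have "(norm (Bm \<mu>0 - Bm \<mu>1))\<^sup>2 = (norm (Bm (p 1) - Bm (p 0)))\<^sup>2"
    by (simp add: a norm_minus_commute)
  then have "ennreal (\<epsilon> / 2 * (norm (Bm \<mu>0 - Bm \<mu>1))\<^sup>2) = ennreal (\<epsilon> / 2) * ennreal ((norm (Bm (p 1) - Bm (p 0)))\<^sup>2)"
    unfolding em by (rule arg_cong)
  also have "\<dots> \<le> ennreal (\<epsilon> / 2) * (\<integral>\<^sup>+t. ennreal ((norm (speed p t))\<^sup>2) \<partial>leb01)"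
    by (intro mult_left_mono has_L2_deriv_norm_le[OF admissible_pathD(3)[OF a(1)]]) simp
  also have "\<dots> = (\<integral>\<^sup>+t. ennreal (\<epsilon> / 2) * ennreal ((norm (speed p t))\<^sup>2) \<partial>leb01)"
    using has_L2_derivD(3)[OF admissible_pathD(3)[OF a(1)]] by (intro nn_integral_cmult[symmetric]) measurable
  also have "\<dots> \<le> energy p"
    unfolding path_energy_def
  proof (rule nn_integral_mono_AE)
    show "AE t in leb01. ennreal (\<epsilon> / 2) * ennreal ((norm (speed p t))\<^sup>2) \<le> ennreal (tensor (p t) (speed p t))"
      using admissible_pathD(4)[OF a(1)] AE_unit_mem
    proof eventually_elim
      case (elim t)
      have "\<epsilon> / 2 * (norm (speed p t))\<^sup>2 \<le> tensor (p t) (speed p t)"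
        by (rule metric_tensor_bounds(1)[OF admissible_pathD(1)[OF a(1) elim(2)]]) (use elim in \<open>simp add: inner_commute\<close>)
      then show ?case unfolding em by (rule ennreal_leI)
    qed
  qed
  finally show ?thesis .
qed

abbreviation "C \<equiv> 1 + 2 * exp (11 / (2 * \<epsilon>) * sup_norm c)"

lemma energy_upper:
  assumes \<mu>: "\<mu>0 \<in> radon_prob" "\<mu>1 \<in> radon_prob"
  shows "\<exists>p\<in>paths \<mu>0 \<mu>1. energy p \<le> ennreal (\<epsilon> / 2 * C * (2 * (norm (Bm \<mu>0 - Bm \<mu>1))\<^sup>2))"
proof -
  define \<beta>0 where "\<beta>0 = Bm \<mu>0"
  define d where "d = Bm \<mu>1 - Bm \<mu>0"
  define L where "L t = \<beta>0 + t *\<^sub>R d" for t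
  define N where "N t = L t \<bullet> L t" for t
  have L': "L t = (1 - t) *\<^sub>R Bm \<mu>0 + t *\<^sub>R Bm \<mu>1" for t by (simp add: L_def \<beta>0_def d_def algebra_simps)
  \<comment> \<open>With a nonnegative inner product the squared length is at least
    \<open>(1 - t)\<^sup>2 + t\<^sup>2\<close>, minimal at the midpoint. Its lower bound 1/2 is the
    source of the factor 2 in the energy.\<close>
  have N_half: "1 / 2 \<le> N t" if "t \<in> {0..1}" for t
  proof -
    have n: "Bm \<mu>0 \<bullet> Bm \<mu>0 = 1" "Bm \<mu>1 \<bullet> Bm \<mu>1 = 1"
      using norm_B[OF \<mu>(1)] norm_B[OF \<mu>(2)] by (simp_all add: norm_eq_1)
    have "N t = (1 - t)\<^sup>2 + t\<^sup>2 + 2 * (t * (1 - t) * (Bm \<mu>0 \<bullet> Bm \<mu>1))"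
      using n by (simp add: N_def L' inner_add_left inner_add_right inner_commute[of "Bm \<mu>1" "Bm \<mu>0"] power2_eq_square algebra_simps)
    moreover have "0 \<le> t * (1 - t) * (Bm \<mu>0 \<bullet> Bm \<mu>1)"
      using that B_inner_pos[OF \<mu>] by (intro mult_nonneg_nonneg) auto
    moreover have "1 / 2 \<le> (1 - t)\<^sup>2 + t\<^sup>2"
      using zero_le_power2[of "t - 1/2"] by (simp add: power2_eq_square algebra_simps)
    ultimately show ?thesis by linarith
  qed
  define r where "r t = 1 / sqrt (N t)" for t
  \<comment> \<open>The derivative of the inverse square root of N, as N has derivative 2 (d
    \<bullet> \<open>L t\<close>).\<close>
  define r' where "r' t = - (d \<bullet> L t) / (N t * sqrt (N t))" for t
  define \<gamma> where "\<gamma> t = r t *\<^sub>R L t" for t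
  define v where "v t = r t *\<^sub>R d + r' t *\<^sub>R L t" for t
  have Npos: "0 < N t" if "t \<in> {0..1}" for t using N_half[OF that] by simp
  have dL: "(L has_vector_derivative d) (at t within {0..1})" for t
    unfolding L_def[abs_def] by (auto intro!: derivative_eq_intros)
  have dN: "(N has_real_derivative 2 * (d \<bullet> L t)) (at t within {0..1})" for t
    unfolding N_def[abs_def] has_real_derivative_iff_has_vector_derivative
    by (rule has_vector_derivative_eq_rhs, rule bounded_bilinear.has_vector_derivative[OF bounded_bilinear_inner dL dL])
      (simp add: inner_commute)
  have dr: "(r has_real_derivative r' t) (at t within {0..1})" if "t \<in> {0..1}" for t
  proof -
    have ds: "((\<lambda>t. sqrt (N t)) has_real_derivative (inverse (sqrt (N t)) / 2) * (2 * (d \<bullet> L t))) (at t within {0..1})"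
      by (rule DERIV_chain2[OF DERIV_real_sqrt[OF Npos[OF that]] dN])
    moreover have "(inverse (sqrt (N t)) / 2) * (2 * (d \<bullet> L t)) = (d \<bullet> L t) / sqrt (N t)"
      by (simp only: divide_inverse) (simp only: mult.commute mult.left_commute, simp)
    ultimately have ds: "((\<lambda>t. sqrt (N t)) has_real_derivative (d \<bullet> L t) / sqrt (N t)) (at t within {0..1})"
      by (simp only:)
    have "sqrt (N t) \<noteq> 0" using Npos[OF that] by simp
    from DERIV_inverse'[OF ds this] have "((\<lambda>t. inverse (sqrt (N t))) has_real_derivative
        - (inverse (sqrt (N t)) * ((d \<bullet> L t) / sqrt (N t)) * inverse (sqrt (N t)))) (at t within {0..1})" .
    moreover have "- (inverse (sqrt (N t)) * ((d \<bullet> L t) / sqrt (N t)) * inverse (sqrt (N t))) = r' t"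
    proof -
      define s where "s = sqrt (N t)"
      have s: "s > 0" "N t = s * s" using Npos[OF that] by (simp_all add: s_def)
      show ?thesis unfolding r'_def s_def[symmetric] s(2) using s(1) by (simp add: field_simps)
    qed
    moreover have "r = (\<lambda>t. inverse (sqrt (N t)))" by (rule ext) (simp add: r_def inverse_eq_divide)
    ultimately show ?thesis by (simp only:)
  qed
  have dg: "(\<gamma> has_vector_derivative v t) (at t within {0..1})" if "t \<in> {0..1}" for t
    unfolding \<gamma>_def[abs_def] v_def by (rule has_vector_derivative_scaleR[OF dr[OF that] dL])
  have Lc: "continuous_on {0..1} L" unfolding L_def by (intro continuous_intros)
  have Nc: "continuous_on {0..1} N" unfolding N_def by (intro continuous_intros Lc)
  have vc: "continuous_on {0..1} v"
    unfolding v_def r_def r'_def using Npos by (intro continuous_intros Lc Nc) (auto simp: less_imp_neq[symmetric])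
  have gc: "continuous_on {0..1} \<gamma>"
    unfolding \<gamma>_def r_def using Npos by (intro continuous_intros Lc Nc) (auto simp: less_imp_neq[symmetric])
  have gd: "has_L2_deriv \<gamma> v" by (rule has_L2_derivI_C1[OF dg vc])
  have ng: "norm (\<gamma> t) = 1" if "t \<in> {0..1}" for t
    using Npos[OF that] by (simp add: \<gamma>_def r_def N_def flip: norm_eq_sqrt_inner)
  \<comment> \<open>The velocity is the component of d orthogonal to \<open>L t\<close>, divided by
    the length of \<open>L t\<close>; dropping the projection leaves the squared norm of d over N,
    with N \<ge> 1/2.\<close>
  have vle: "(norm (v t))\<^sup>2 \<le> 2 * (norm d)\<^sup>2" if "t \<in> {0..1}" for t
  proof -
    define s where "s = d \<bullet> L t"
    define n where "n = N t"
    have n: "n > 0" "1 / 2 \<le> n" using Npos N_half that by (auto simp: n_def)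
    have sq: "sqrt n * sqrt n = n" using n by simp
    have "(norm (v t))\<^sup>2 = (r t)\<^sup>2 * (norm d)\<^sup>2 + (r' t)\<^sup>2 * n + 2 * (r' t * r t * s)"
      unfolding v_def norm_scaleR_add_power2 by (simp add: n_def s_def N_def power2_norm_eq_inner inner_commute)
    also have "(r t)\<^sup>2 = 1 / n" using n by (simp add: r_def power_divide flip: n_def)
    also have "(r' t)\<^sup>2 * n = s\<^sup>2 / n\<^sup>2"
      using n by (simp add: r'_def power_divide power_mult_distrib flip: n_def s_def) 
    also have "r' t * r t * s = - s\<^sup>2 / n\<^sup>2"
      using n sq by (simp add: r'_def r_def power2_eq_square mult.assoc flip: n_def s_def)
    finally have "(norm (v t))\<^sup>2 = (norm d)\<^sup>2 / n - s\<^sup>2 / n\<^sup>2" by simp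
    also have "\<dots> \<le> (norm d)\<^sup>2 / n" by simp
    also have "\<dots> \<le> (norm d)\<^sup>2 / (1 / 2)" using n by (intro divide_left_mono) auto
    finally show ?thesis by simp
  qed
  \<comment> \<open>The endpoints are set by hand: the choice fixes a measure only through its image
    \<gamma>(t), while a path has to start and end at the given measures themselves.\<close>
  define p where "p t = (if t = 0 then \<mu>0 else if t = 1 then \<mu>1 else (SOME m. m \<in> radon_prob \<and> sol m (\<gamma> t)))" for t :: real
  have p: "p t \<in> radon_prob \<and> Bm (p t) = \<gamma> t" if t: "t \<in> {0..1}" for t
  proof -
    have "\<exists>m. m \<in> radon_prob \<and> sol m (\<gamma> t)"
      using normalized_segment_in_range[OF \<mu>, of t "r t" "\<gamma> t"] t ng[OF t] Npos[OF t] by (auto simp: \<gamma>_def L' r_def)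
    from someI_ex[OF this] have "(SOME m. m \<in> radon_prob \<and> sol m (\<gamma> t)) \<in> radon_prob"
      "Bm (SOME m. m \<in> radon_prob \<and> sol m (\<gamma> t)) = \<gamma> t" using B_map_eqI by auto
    moreover have "\<gamma> 0 = Bm \<mu>0" "\<gamma> 1 = Bm \<mu>1"
      using norm_B[OF \<mu>(1)] norm_B[OF \<mu>(2)] by (simp_all add: \<gamma>_def r_def N_def L' norm_eq_1)
    ultimately show ?thesis using \<mu> by (simp add: p_def)
  qed
  have adm: "admissible_path \<iota> \<epsilon> c p" "AE t in leb01. speed p t = v t"
    using admissible_pathI[of p \<gamma> v] p gc gd by auto
  have "energy p \<le> (\<integral>\<^sup>+t. ennreal (\<epsilon> / 2 * C * (2 * (norm d)\<^sup>2)) \<partial>leb01)"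
    unfolding path_energy_def
  proof (rule nn_integral_mono_AE)
    show "AE t in leb01. ennreal (tensor (p t) (speed p t)) \<le> ennreal (\<epsilon> / 2 * C * (2 * (norm d)\<^sup>2))"
      using adm(2) admissible_pathD(4)[OF adm(1)] AE_unit_mem
    proof eventually_elim
      case (elim t)
      have "tensor (p t) (speed p t) \<le> \<epsilon> / 2 * C * (norm (speed p t))\<^sup>2"
        by (rule metric_tensor_bounds(2)) (use p[OF elim(3)] elim(2) in \<open>simp_all add: inner_commute\<close>)
      also have "\<dots> \<le> \<epsilon> / 2 * C * (2 * (norm d)\<^sup>2)"
        unfolding elim(1) using vle[OF elim(3)] eps by (intro mult_left_mono) auto
      finally show ?case by (rule ennreal_leI)
    qed
  qed
  also have "\<dots> = ennreal (\<epsilon> / 2 * C * (2 * (norm d)\<^sup>2))"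
    using leb01.emeasure_space_1 by simp
  finally have "energy p \<le> ennreal (\<epsilon> / 2 * C * (2 * (norm (Bm \<mu>0 - Bm \<mu>1))\<^sup>2))"
    by (simp add: d_def norm_minus_commute)
  moreover have "p \<in> paths \<mu>0 \<mu>1" using adm(1) by (simp add: paths_def p_def)
  ultimately show ?thesis by blast
qed

end

section \<open>The metric and its topology\<close>

text \<open>Lipschitz cutoffs decreasing to the indicator of a closed set recover its measure from
  integrals of continuous functions; inner regularity passes from compact sets to Borel
  sets.\<close>

lemma radon_prob_eqI:
  fixes \<mu> \<nu> :: "'a::compact_metric_space measure"
  assumes \<mu>: "\<mu> \<in> radon_prob" and \<nu>: "\<nu> \<in> radon_prob"
    and eq: "\<And>f :: 'a \<Rightarrow> real. continuous_on UNIV f \<Longrightarrow> (LINT x|\<mu>. f x) = (LINT x|\<nu>. f x)"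
  shows "\<mu> = \<nu>"
proof (rule measure_eqI)
  show "sets \<mu> = sets \<nu>" using radon_probD(2)[OF \<mu>] radon_probD(2)[OF \<nu>] by simp
  have lim: "(\<lambda>n. LINT x|m. max 0 (1 - real n * infdist x S)) \<longlonglongrightarrow> measure m S"
    if m: "m \<in> radon_prob" and S: "closed S" "S \<noteq> {}" for m and S :: "'a set"
  proof -
    have Sm: "S \<in> sets m" using S(1) radon_probD(2)[OF m] by simp
    have "(\<lambda>n. LINT x|m. max 0 (1 - real n * infdist x S)) \<longlonglongrightarrow> (LINT x|m. indicator S x)"
    proof (rule integral_dominated_convergence[where w = "\<lambda>x. 1"])
      show "(\<lambda>x. indicat_real S x) \<in> borel_measurable m" using Sm by simp
      show "(\<lambda>x. max 0 (1 - real n * infdist x S)) \<in> borel_measurable m" for n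
        by (rule radon_prob_continuous_measurable[OF m]) (intro continuous_intros)
      show "integrable m (\<lambda>x. 1 :: real)" by (rule radon_prob_const_integrable[OF m])
      show "AE x in m. norm (max 0 (1 - real n * infdist x S)) \<le> 1" for n
        by (simp add: infdist_nonneg)
      have "(\<lambda>n. max 0 (1 - real n * infdist x S)) \<longlonglongrightarrow> indicator S x" for x
      proof (cases "x \<in> S")
        case True
        then show ?thesis using in_closed_iff_infdist_zero[OF S] by simp
      next
        case False
        then have pos: "infdist x S > 0" using in_closed_iff_infdist_zero[OF S] infdist_nonneg[of x S] by fastforce
        obtain N where N: "1 / infdist x S < real N" using reals_Archimedean2 by blast
        have "max 0 (1 - real n * infdist x S) = 0" if "n \<ge> N" for n
        proof -
          have "1 / infdist x S \<le> real n" using N that by linarith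
          then show ?thesis using pos by (simp add: divide_le_eq)
        qed
        then have "\<forall>\<^sub>F n in sequentially. max 0 (1 - real n * infdist x S) = indicator S x"
          using False by (auto simp: eventually_sequentially)
        then show ?thesis by (rule tendsto_eventually)
      qed
      then show "AE x in m. (\<lambda>n. max 0 (1 - real n * infdist x S)) \<longlonglongrightarrow> indicator S x" by simp
    qed
    then show ?thesis using Sm radon_probD(3)[OF m] by simp
  qed
  \<comment> \<open>The empty set is separated because \<open>infdist\<close> to it is 0, which
    would make every cutoff constantly 1.\<close>
  have cl: "emeasure \<mu> S = emeasure \<nu> S" if "closed S" for S
  proof (cases "S = {}")
    case False
    have "(\<lambda>n. LINT x|\<mu>. max 0 (1 - real n * infdist x S)) = (\<lambda>n. LINT x|\<nu>. max 0 (1 - real n * infdist x S))"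
      by (intro ext eq continuous_intros)
    then have "measure \<mu> S = measure \<nu> S"
      using lim[OF \<mu> that False] lim[OF \<nu> that False] by (simp add: LIMSEQ_unique)
    then show ?thesis
      by (simp add: finite_measure.emeasure_eq_measure[OF radon_probD(4)[OF \<mu>]]
          finite_measure.emeasure_eq_measure[OF radon_probD(4)[OF \<nu>]])
  qed simp
  fix A assume "A \<in> sets \<mu>"
  then have A: "A \<in> sets borel" using radon_probD(2)[OF \<mu>] by simp
  have "emeasure \<mu> A = (SUP K\<in>{K. compact K \<and> K \<subseteq> A}. emeasure \<mu> K)"
    "emeasure \<nu> A = (SUP K\<in>{K. compact K \<and> K \<subseteq> A}. emeasure \<nu> K)"
    using \<mu> \<nu> A by (auto simp: radon_prob_def)
  moreover have "(SUP K\<in>{K. compact K \<and> K \<subseteq> A}. emeasure \<mu> K) = (SUP K\<in>{K. compact K \<and> K \<subseteq> A}. emeasure \<nu> K)"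
    by (intro SUP_cong refl cl) (auto intro: compact_imp_closed)
  ultimately show "emeasure \<mu> A = emeasure \<nu> A" by simp
qed

section \<open>Weak-* neighbourhoods that control vector-valued integrals\<close>

lemma openin_weak_star_subbasic:
  fixes f :: "'a::metric_space \<Rightarrow> real"
  assumes "continuous_on UNIV f" "open U"
  shows "openin weak_star_topology {\<mu> \<in> radon_prob. (LINT x|\<mu>. f x) \<in> U}"
  unfolding weak_star_topology_def by (rule topology_generated_by_Basis) (use assms in blast)

text \<open>Subordinate a partition of unity to a finite cover of \<open>F(X)\<close> by \<open>\<delta>\<close>-balls.\<close>

lemma finite_rank_approximation:
  fixes F :: "'a::compact_metric_space \<Rightarrow> 'b::real_normed_vector"
  assumes F: "continuous_on UNIV F" and \<delta>: "\<delta> > 0"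
  obtains Y and p :: "'b \<Rightarrow> 'a \<Rightarrow> real" where "finite Y" "\<And>y. y \<in> Y \<Longrightarrow> continuous_on UNIV (p y)"
    "\<And>x. norm (F x - (\<Sum>y\<in>Y. p y x *\<^sub>R y)) \<le> \<delta>"
proof -
  have "compact (range F)" by (rule compact_continuous_image[OF F compact_space_UNIV])
  then obtain Y where Y: "finite Y" "range F \<subseteq> (\<Union>y\<in>Y. ball y \<delta>)"
    using \<delta> unfolding compact_eq_totally_bounded by meson
  define w where "w y x = max 0 (\<delta> - dist (F x) y)" for y x
  define s where "s x = (\<Sum>y\<in>Y. w y x)" for x
  define p where "p y x = w y x / s x" for y x
  have w0: "0 \<le> w y x" for y x by (simp add: w_def)
  have s: "0 < s x" for x
  proof -
    obtain y where y: "y \<in> Y" "F x \<in> ball y \<delta>" using Y(2) by blast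
    then have "0 < w y x" by (simp add: w_def dist_commute)
    then show ?thesis unfolding s_def using y(1) Y(1) w0 by (intro sum_pos2[where i = y]) auto
  qed
  have wc: "continuous_on UNIV (w y)" for y
    unfolding w_def by (intro continuous_intros F)
  have pc: "continuous_on UNIV (p y)" for y
    unfolding p_def s_def using s[unfolded s_def]
    by (intro continuous_on_divide continuous_on_sum wc) (auto simp: less_imp_neq[symmetric])
  have "norm (F x - (\<Sum>y\<in>Y. p y x *\<^sub>R y)) \<le> \<delta>" for x
  proof -
    have p1: "(\<Sum>y\<in>Y. p y x) = 1" using s[of x] by (simp add: p_def s_def flip: sum_divide_distrib)
    have p0: "0 \<le> p y x" for y using w0 s[of x] by (simp add: p_def)
    have "F x = (\<Sum>y\<in>Y. p y x) *\<^sub>R F x" by (simp add: p1)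
    then have "F x - (\<Sum>y\<in>Y. p y x *\<^sub>R y) = (\<Sum>y\<in>Y. p y x *\<^sub>R (F x - y))"
      by (simp add: scaleR_left.sum scaleR_diff_right sum_subtractf)
    also have "norm \<dots> \<le> (\<Sum>y\<in>Y. norm (p y x *\<^sub>R (F x - y)))" by (rule norm_sum)
    also have "\<dots> \<le> (\<Sum>y\<in>Y. p y x * \<delta>)"
    proof (rule sum_mono)
      fix y assume "y \<in> Y"
      show "norm (p y x *\<^sub>R (F x - y)) \<le> p y x * \<delta>"
      proof (cases "dist (F x) y < \<delta>")
        case True
        then show ?thesis using p0[of y] by (simp add: dist_norm mult_left_mono)
      next
        case False
        then show ?thesis by (simp add: p_def w_def)
      qed
    qed
    also have "\<dots> = \<delta>" using p1 by (simp flip: sum_distrib_right)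
    finally show ?thesis .
  qed
  then show ?thesis using that Y(1) pc by blast
qed

text \<open>The topology controls scalar integrals only. A continuous F on a compact space is
  uniformly within e/3 of a finite sum of scalar functions times fixed vectors, so finitely many
  scalar conditions suffice.\<close>

lemma weak_star_neighbourhood_vector_integral:
  fixes F :: "'a::compact_metric_space \<Rightarrow> 'b::{banach, second_countable_topology}"
  assumes F: "continuous_on UNIV F" and \<mu>0: "\<mu>0 \<in> radon_prob" and e: "e > 0"
  obtains V where "openin weak_star_topology V" "\<mu>0 \<in> V" "V \<subseteq> radon_prob"
    "\<And>\<mu>. \<mu> \<in> V \<Longrightarrow> norm ((LINT x|\<mu>. F x) - (LINT x|\<mu>0. F x)) < e"
proof -
  obtain Y and p :: "'b \<Rightarrow> 'a \<Rightarrow> real" where Y: "finite Y" and p: "\<And>y. y \<in> Y \<Longrightarrow> continuous_on UNIV (p y)"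
    and le: "\<And>x. norm (F x - (\<Sum>y\<in>Y. p y x *\<^sub>R y)) \<le> e / 3"
    using finite_rank_approximation[OF F, of "e / 3"] e by auto
  \<comment> \<open>The summand 1 keeps the denominator positive and makes the final bound by e/3
    strict.\<close>
  define \<eta> where "\<eta> = e / (3 * (1 + (\<Sum>y\<in>Y. norm y)))"
  have S0: "0 \<le> (\<Sum>y\<in>Y. norm y)" by (intro sum_nonneg) simp
  then have \<eta>: "\<eta> > 0" "\<eta> * (\<Sum>y\<in>Y. norm y) < e / 3"
    using e by (auto simp: \<eta>_def field_simps add_pos_nonneg)
  define V0 where "V0 y = {\<mu> \<in> radon_prob. (LINT x|\<mu>. p y x) \<in> ball (LINT x|\<mu>0. p y x) \<eta>}" for y
  \<comment> \<open>The first set is all of \<open>radon_prob\<close>; it keeps \<open>V\<close>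
    inside \<open>radon_prob\<close> and open even for an intersection over an empty family.\<close>
  define V where "V = {\<mu> \<in> radon_prob. (LINT x|\<mu>. 0) \<in> (UNIV :: real set)} \<inter> (\<Inter>y\<in>Y. V0 y)"
  have o0: "openin weak_star_topology {\<mu> \<in> radon_prob. (LINT x|\<mu>. 0) \<in> (UNIV :: real set)}"
    by (rule openin_weak_star_subbasic) auto
  have oV: "openin weak_star_topology (V0 y)" if "y \<in> Y" for y
    unfolding V0_def by (rule openin_weak_star_subbasic[OF p[OF that]]) simp
  show thesis
  proof (rule that[of V])
    show "openin weak_star_topology V"
      unfolding V_def using Y oV o0 by (intro openin_Int_Inter) auto
    show "\<mu>0 \<in> V" using \<mu>0 \<eta> by (simp add: V_def V0_def)
    show "V \<subseteq> radon_prob" by (auto simp: V_def)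
    fix \<mu> assume "\<mu> \<in> V"
    then have \<mu>: "\<mu> \<in> radon_prob" and d: "\<And>y. y \<in> Y \<Longrightarrow> \<bar>(LINT x|\<mu>0. p y x) - (LINT x|\<mu>. p y x)\<bar> < \<eta>"
      by (auto simp: V_def V0_def dist_real_def)
    define F' where "F' x = (\<Sum>y\<in>Y. p y x *\<^sub>R y)" for x
    have F'c: "continuous_on UNIV F'" unfolding F'_def using p by (intro continuous_intros)
    have app: "norm ((LINT x|m. F x) - (LINT x|m. F' x)) \<le> e / 3" if m: "m \<in> radon_prob" for m
    proof -
      have c: "continuous_on UNIV (\<lambda>x. F x - F' x)" by (intro continuous_intros F F'c)
      have "(LINT x|m. F x) - (LINT x|m. F' x) = (LINT x|m. F x - F' x)"
        by (rule Bochner_Integration.integral_diff[symmetric]) (rule radon_prob_continuous_integrable[OF m], rule F F'c)+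
      also have "norm \<dots> \<le> e / 3"
        by (rule radon_prob_norm_integral_le[OF m radon_prob_continuous_measurable[OF m c]]) (unfold F'_def, rule le)
      finally show ?thesis .
    qed
    have F'int: "(LINT x|m. F' x) = (\<Sum>y\<in>Y. (LINT x|m. p y x) *\<^sub>R y)" if m: "m \<in> radon_prob" for m
      unfolding F'_def using radon_prob_continuous_integrable[OF m p] by (subst Bochner_Integration.integral_sum) auto
    have "norm ((LINT x|\<mu>. F' x) - (LINT x|\<mu>0. F' x)) \<le> (\<Sum>y\<in>Y. norm (((LINT x|\<mu>. p y x) - (LINT x|\<mu>0. p y x)) *\<^sub>R y))"
      unfolding F'int[OF \<mu>] F'int[OF \<mu>0] sum_subtractf[symmetric] scaleR_diff_left[symmetric] by (rule norm_sum)
    also have "\<dots> \<le> (\<Sum>y\<in>Y. \<eta> * norm y)"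
    proof (rule sum_mono)
      fix y assume "y \<in> Y"
      then have "\<bar>(LINT x|\<mu>. p y x) - (LINT x|\<mu>0. p y x)\<bar> \<le> \<eta>" using d[of y] by linarith
      then show "norm (((LINT x|\<mu>. p y x) - (LINT x|\<mu>0. p y x)) *\<^sub>R y) \<le> \<eta> * norm y"
        by (simp add: mult_right_mono)
    qed
    also have "\<dots> < e / 3" using \<eta>(2) by (simp add: sum_distrib_left)
    finally have m: "norm ((LINT x|\<mu>. F' x) - (LINT x|\<mu>0. F' x)) < e / 3" .
    have tri: "norm (a - b) \<le> norm (a - a') + norm (a' - b') + norm (b - b')" for a a' b b' :: 'b
      using norm_triangle_ineq4[of "(a - a') + (a' - b')" "b - b'"] norm_triangle_ineq[of "a - a'" "a' - b'"] by simp
    have "norm ((LINT x|\<mu>. F x) - (LINT x|\<mu>0. F x)) \<le>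
        norm ((LINT x|\<mu>. F x) - (LINT x|\<mu>. F' x)) + norm ((LINT x|\<mu>. F' x) - (LINT x|\<mu>0. F' x)) + norm ((LINT x|\<mu>0. F x) - (LINT x|\<mu>0. F' x))"
      by (rule tri)
    then show "norm ((LINT x|\<mu>. F x) - (LINT x|\<mu>0. F x)) < e"
      using app[OF \<mu>] app[OF \<mu>0] m by linarith
  qed
qed

text \<open>Time is shared in proportion to the lengths r1 and r2. A piece of duration \<theta> runs
  faster by 1/\<theta> and so costs its energy divided by \<theta>; at this \<theta> the two costs
  add up to exactly \<open>(r1 + r2)\<^sup>2\<close>.\<close>

lemma energy_pieces:
  fixes r1 r2 :: real and E1 E2 :: ennreal
  assumes r: "r1 > 0" "r2 > 0" and E: "E1 \<le> ennreal (r1\<^sup>2)" "E2 \<le> ennreal (r2\<^sup>2)"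
    and th: "\<theta> = r1 / (r1 + r2)"
  shows "ennreal (\<theta> * (1 / \<theta>)\<^sup>2) * E1 + ennreal ((1 - \<theta>) * (1 / (1 - \<theta>))\<^sup>2) * E2 \<le> ennreal ((r1 + r2)\<^sup>2)"
proof -
  have th': "1 - \<theta> = r2 / (r1 + r2)" using r by (simp add: th field_simps)
  have a: "\<theta> * (1 / \<theta>)\<^sup>2 = (r1 + r2) / r1" "(1 - \<theta>) * (1 / (1 - \<theta>))\<^sup>2 = (r1 + r2) / r2"
    unfolding th' unfolding th using r by (simp_all add: power2_eq_square)
  have "ennreal (\<theta> * (1 / \<theta>)\<^sup>2) * E1 + ennreal ((1 - \<theta>) * (1 / (1 - \<theta>))\<^sup>2) * E2
      \<le> ennreal ((r1 + r2) / r1) * ennreal (r1\<^sup>2) + ennreal ((r1 + r2) / r2) * ennreal (r2\<^sup>2)"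
    unfolding a by (intro add_mono mult_left_mono E) auto
  also have "\<dots> = ennreal ((r1 + r2) / r1 * r1\<^sup>2 + (r1 + r2) / r2 * r2\<^sup>2)"
    using r by (simp only: ennreal_mult'[symmetric] ennreal_plus[symmetric] divide_nonneg_pos add_nonneg_nonneg
        less_imp_le mult_nonneg_nonneg zero_le_power2)
  also have "(r1 + r2) / r1 * r1\<^sup>2 + (r1 + r2) / r2 * r2\<^sup>2 = (r1 + r2)\<^sup>2"
  proof -
    have "(r1 + r2) / r1 * r1\<^sup>2 = (r1 + r2) * r1" "(r1 + r2) / r2 * r2\<^sup>2 = (r1 + r2) * r2"
      using r by (simp_all add: power2_eq_square)
    then show ?thesis by (simp only:) (simp add: power2_eq_square algebra_simps)
  qed
  finally show ?thesis .
qed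

lemma sqrt_2_le_half_pi: "sqrt 2 \<le> pi / 2"
  using sin_x_le_x[of "pi / 4"] by (simp add: sin_45)

section \<open>The infimum of the energy as a squared metric\<close>

context gibbs_rkhs
begin

definition I :: "'a measure \<Rightarrow> 'a measure \<Rightarrow> ennreal" where
  "I \<mu>0 \<mu>1 = (INF p\<in>paths \<mu>0 \<mu>1. energy p)"

lemma dS_eq: "dS \<mu>0 \<mu>1 = sqrt (enn2real (I \<mu>0 \<mu>1))"
  by (simp add: sinkhorn_dist_def I_def paths_def)

lemma dS_nonneg: "0 \<le> dS \<mu>0 \<mu>1"
  by (simp add: dS_eq)

lemma I_bounds:
  assumes \<mu>: "\<mu>0 \<in> radon_prob" "\<mu>1 \<in> radon_prob"
  shows "ennreal (\<epsilon> / 2 * (norm (Bm \<mu>0 - Bm \<mu>1))\<^sup>2) \<le> I \<mu>0 \<mu>1"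
    "I \<mu>0 \<mu>1 \<le> ennreal (\<epsilon> / 2 * C * (2 * (norm (Bm \<mu>0 - Bm \<mu>1))\<^sup>2))" "I \<mu>0 \<mu>1 = ennreal ((dS \<mu>0 \<mu>1)\<^sup>2)"
proof -
  show "ennreal (\<epsilon> / 2 * (norm (Bm \<mu>0 - Bm \<mu>1))\<^sup>2) \<le> I \<mu>0 \<mu>1"
    unfolding I_def by (rule INF_greatest) (rule energy_lower)
  show u: "I \<mu>0 \<mu>1 \<le> ennreal (\<epsilon> / 2 * C * (2 * (norm (Bm \<mu>0 - Bm \<mu>1))\<^sup>2))"
    using energy_upper[OF \<mu>] unfolding I_def by (auto intro: INF_lower2)
  \<comment> \<open>Finiteness is what makes the conversion through \<open>enn2real\<close>
    lossless.\<close>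
  have "I \<mu>0 \<mu>1 < \<top>" by (rule le_less_trans[OF u]) simp
  then show "I \<mu>0 \<mu>1 = ennreal ((dS \<mu>0 \<mu>1)\<^sup>2)" by (simp add: dS_eq)
qed

lemma dS_lower:
  assumes \<mu>: "\<mu>0 \<in> radon_prob" "\<mu>1 \<in> radon_prob"
  shows "sqrt (\<epsilon> / 2) * norm (Bm \<mu>0 - Bm \<mu>1) \<le> dS \<mu>0 \<mu>1"
proof -
  have "\<epsilon> / 2 * (norm (Bm \<mu>0 - Bm \<mu>1))\<^sup>2 \<le> (dS \<mu>0 \<mu>1)\<^sup>2"
    using I_bounds(1)[OF \<mu>] unfolding I_bounds(3)[OF \<mu>] by (rule ennreal_le_iff[OF zero_le_power2, THEN iffD1])
  then have "(sqrt (\<epsilon> / 2) * norm (Bm \<mu>0 - Bm \<mu>1))\<^sup>2 \<le> (dS \<mu>0 \<mu>1)\<^sup>2"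
    using eps by (simp add: power_mult_distrib)
  then show ?thesis by (rule power2_le_imp_le[OF _ dS_nonneg])
qed

lemma dS_upper:
  assumes \<mu>: "\<mu>0 \<in> radon_prob" "\<mu>1 \<in> radon_prob"
  shows "dS \<mu>0 \<mu>1 \<le> pi / 2 * sqrt (\<epsilon> / 2 * C) * norm (Bm \<mu>0 - Bm \<mu>1)"
proof -
  define n where "n = norm (Bm \<mu>0 - Bm \<mu>1)"
  have n: "n \<ge> 0" by (simp add: n_def)
  have C: "0 \<le> \<epsilon> / 2 * C" using eps by (intro mult_nonneg_nonneg add_nonneg_nonneg) auto
  then have C': "0 \<le> \<epsilon> / 2 * C * (2 * n\<^sup>2)" by (rule mult_nonneg_nonneg) simp
  have "(dS \<mu>0 \<mu>1)\<^sup>2 \<le> \<epsilon> / 2 * C * (2 * n\<^sup>2)"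
    using I_bounds(2)[OF \<mu>] unfolding I_bounds(3)[OF \<mu>] n_def[symmetric] by (rule ennreal_le_iff[OF C', THEN iffD1])
  then have "dS \<mu>0 \<mu>1 \<le> sqrt (\<epsilon> / 2 * C * (2 * n\<^sup>2))" by (rule real_le_rsqrt)
  also have "\<dots> = sqrt 2 * (sqrt (\<epsilon> / 2 * C) * n)"
    using n by (simp only: real_sqrt_mult real_sqrt_abs abs_of_nonneg) simp
  also have "\<dots> \<le> pi / 2 * (sqrt (\<epsilon> / 2 * C) * n)"
    by (rule mult_right_mono[OF sqrt_2_le_half_pi]) (rule mult_nonneg_nonneg[OF real_sqrt_ge_zero[OF C] n])
  finally show ?thesis by (simp only: n_def mult.assoc)
qed

lemma tensor_zero_product:
  assumes "m \<in> radon_prob" "Bm m \<bullet> b = 0"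
  shows "ennreal (tensor m (l *\<^sub>R b)) = ennreal (l\<^sup>2) * ennreal (tensor m b)"
  using metric_tensor_scale[OF assms(1), of b l] assms(2) by (simp add: inner_commute ennreal_mult')

lemma reverse_path:
  assumes p: "p \<in> paths \<mu>0 \<mu>1"
  shows "\<exists>p'\<in>paths \<mu>1 \<mu>0. energy p' \<le> energy p"
proof -
  have a: "admissible_path \<iota> \<epsilon> c p" using p by (simp add: paths_def)
  note D = admissible_pathD[OF a]
  define p' where "p' t = p (1 - t)" for t
  have c: "continuous_on {0..1} (\<lambda>t. Bm (p (1 - t)))"
    by (rule continuous_on_compose2[OF D(2)]) (auto intro!: continuous_intros)
  note d = has_L2_deriv_reverse[OF D(3)]
  have r: "p' t \<in> radon_prob" if "t \<in> {0..1}" for t unfolding p'_def by (rule D(1)) (use that in auto)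
  have adm: "admissible_path \<iota> \<epsilon> c p'" "AE t in leb01. speed p' t = rescale 1 (- 1) (speed p) t"
    using admissible_pathI[of p' "\<lambda>t. Bm (p (1 - t))", OF r _ c d] by (simp_all add: p'_def)
  have "energy p' \<le> (\<integral>\<^sup>+t. (\<lambda>t. ennreal (tensor (p t) (speed p t))) (1 - t) \<partial>leb01)"
    unfolding path_energy_def
  proof (rule nn_integral_mono_AE)
    show "AE t in leb01. ennreal (tensor (p' t) (speed p' t)) \<le> ennreal (tensor (p (1 - t)) (speed p (1 - t)))"
      using adm(2) admissible_pathD(4)[OF adm(1)] AE_space
    proof eventually_elim
      case (elim t)
      have v: "speed p' t = (-1) *\<^sub>R speed p (1 - t)"
        unfolding elim(1) using elim(3) by (simp add: rescale_def)
      have rt: "p (1 - t) \<in> radon_prob" using r[of t] elim(3) by (simp add: p'_def)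
      have z: "Bm (p (1 - t)) \<bullet> speed p (1 - t) = 0" using elim(2) unfolding v by (simp add: p'_def)
      have p't: "p' t = p (1 - t)" by (simp add: p'_def)
      show ?case unfolding v p't tensor_zero_product[OF rt z] by simp
    qed
  qed
  also have "\<dots> \<le> energy p" unfolding path_energy_def by (rule nn_integral_unit_reverse_le)
  finally have "energy p' \<le> energy p" .
  moreover have "p' \<in> paths \<mu>1 \<mu>0" using adm(1) p by (simp add: paths_def p'_def)
  ultimately show ?thesis by blast
qed

lemma concat_path:
  assumes p: "p \<in> paths \<mu>0 \<mu>1" and p': "p' \<in> paths \<mu>1 \<mu>2" and th: "0 < \<theta>" "\<theta> < 1"
  shows "\<exists>P\<in>paths \<mu>0 \<mu>2. energy P \<le>
    ennreal (\<theta> * (1 / \<theta>)\<^sup>2) * energy p + ennreal ((1 - \<theta>) * (1 / (1 - \<theta>))\<^sup>2) * energy p'"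
proof -
  have a: "admissible_path \<iota> \<epsilon> c p" "admissible_path \<iota> \<epsilon> c p'" using p p' by (auto simp: paths_def)
  note D = admissible_pathD[OF a(1)]
  note D' = admissible_pathD[OF a(2)]
  have j: "p 1 = p' 0" using p p' by (simp add: paths_def)
  define P where "P t = (if t \<le> \<theta> then p (t / \<theta>) else p' ((t - \<theta>) / (1 - \<theta>)))" for t
  define \<gamma> where "\<gamma> = (\<lambda>t. if t \<le> \<theta> then Bm (p (t / \<theta>)) else Bm (p' ((t - \<theta>) / (1 - \<theta>))))"
  define W where "W = (\<lambda>t. rescale 0 \<theta> (speed p) t + rescale \<theta> (1 - \<theta>) (speed p') t)"
  have r: "P t \<in> radon_prob" if "t \<in> {0..1}" for t
    unfolding P_def using th that by (auto intro!: D(1) D'(1))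
  have c: "continuous_on {0..1} \<gamma>"
    unfolding \<gamma>_def
  proof (rule continuous_on_cases_le)
    show "continuous_on {t \<in> {0..1}. t \<le> \<theta>} (\<lambda>t. Bm (p (t / \<theta>)))"
      by (rule continuous_on_compose2[OF D(2)]) (use th in \<open>auto intro!: continuous_intros\<close>)
    show "continuous_on {t \<in> {0..1}. \<theta> \<le> t} (\<lambda>t. Bm (p' ((t - \<theta>) / (1 - \<theta>))))"
      by (rule continuous_on_compose2[OF D'(2)]) (use th in \<open>auto intro!: continuous_intros\<close>)
    show "Bm (p (t / \<theta>)) = Bm (p' ((t - \<theta>) / (1 - \<theta>)))" if "t = \<theta>" for t
      using that th j by simp
  qed (auto intro: continuous_intros)
  have d: "has_L2_deriv \<gamma> W"
    unfolding \<gamma>_def W_def by (rule has_L2_deriv_concat[OF th D(3) D'(3)]) (simp add: j)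
  have adm: "admissible_path \<iota> \<epsilon> c P" "AE t in leb01. speed P t = W t"
    using admissible_pathI[of P \<gamma>, OF r _ c d] by (simp_all add: P_def \<gamma>_def)
  \<comment> \<open>At the junction \<open>P\<close> follows the first path while the bound uses the
    second, and both rescaled derivatives are cut to zero; it is a null set.\<close>
  have "AE t in lebesgue. t \<noteq> \<theta>" by (rule AE_completion[OF AE_lborel_singleton])
  then have nth: "AE t in leb01. t \<noteq> \<theta>"
    by (subst AE_restrict_space_iff) (auto elim: eventually_mono)
  have "energy P \<le> ennreal (\<theta> * (1 / \<theta>)\<^sup>2) * energy p + ennreal ((1 - \<theta>) * (1 / (1 - \<theta>))\<^sup>2) * energy p'"
    unfolding path_energy_def
  proof (rule nn_integral_unit_concat_le[OF th])
    show "0 < (1 / \<theta>)\<^sup>2" "0 < (1 / (1 - \<theta>))\<^sup>2" using th by simp_all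
    show "AE t in leb01. ennreal (tensor (P t) (speed P t)) \<le>
      (if t < \<theta> then ennreal ((1 / \<theta>)\<^sup>2) * ennreal (tensor (p (t / \<theta>)) (speed p (t / \<theta>)))
       else ennreal ((1 / (1 - \<theta>))\<^sup>2) * ennreal (tensor (p' ((t - \<theta>) / (1 - \<theta>))) (speed p' ((t - \<theta>) / (1 - \<theta>)))))"
      using adm(2) admissible_pathD(4)[OF adm(1)] AE_space nth
    proof eventually_elim
      case (elim t)
      have t: "0 < t" "t < 1" using elim(3) by auto
      show ?case
      proof (cases "t < \<theta>")
        case True
        have v: "speed P t = (1 / \<theta>) *\<^sub>R speed p (t / \<theta>)"
          unfolding elim(1) W_def rescale_def using t th True by (simp add: indicator_def divide_less_0_iff zero_less_divide_iff)
        have P: "P t = p (t / \<theta>)" using True by (simp add: P_def)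
        have "p (t / \<theta>) \<in> radon_prob" using r[of t] t unfolding P by simp
        moreover have "Bm (p (t / \<theta>)) \<bullet> speed p (t / \<theta>) = 0" using elim(2) th unfolding v P by simp
        ultimately show ?thesis using True unfolding v P by (simp add: tensor_zero_product)
      next
        case False
        then have t': "\<theta> < t" using elim(4) by simp
        have v: "speed P t = (1 / (1 - \<theta>)) *\<^sub>R speed p' ((t - \<theta>) / (1 - \<theta>))"
          unfolding elim(1) W_def rescale_def using t th t' by (simp add: indicator_def)
        have P: "P t = p' ((t - \<theta>) / (1 - \<theta>))" using t' by (simp add: P_def)
        have "p' ((t - \<theta>) / (1 - \<theta>)) \<in> radon_prob" using r[of t] t unfolding P by simp
        moreover have "Bm (p' ((t - \<theta>) / (1 - \<theta>))) \<bullet> speed p' ((t - \<theta>) / (1 - \<theta>)) = 0"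
          using elim(2) th unfolding v P by simp
        ultimately show ?thesis using False unfolding v P by (simp add: tensor_zero_product)
      qed
    qed
  qed
  moreover have "P \<in> paths \<mu>0 \<mu>2" using adm(1) p p' th by (simp add: paths_def P_def)
  ultimately show ?thesis by blast
qed

lemma dS_commute: "dS \<mu>0 \<mu>1 = dS \<mu>1 \<mu>0"
proof -
  have le: "I m n \<le> I n m" for m n
    unfolding I_def
  proof (rule INF_greatest)
    fix p assume "p \<in> paths n m"
    then obtain p' where p': "p' \<in> paths m n" "energy p' \<le> energy p" using reverse_path by blast
    show "(INF p\<in>paths m n. energy p) \<le> energy p" by (rule order_trans[OF INF_lower[of p' "paths m n" energy, OF p'(1)] p'(2)])
  qed
  have "I \<mu>0 \<mu>1 = I \<mu>1 \<mu>0" by (rule antisym[OF le le])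
  then show ?thesis by (simp add: dS_eq)
qed

lemma dS_less_path:
  assumes \<mu>: "\<mu>0 \<in> radon_prob" "\<mu>1 \<in> radon_prob" and r: "dS \<mu>0 \<mu>1 < r"
  shows "\<exists>p\<in>paths \<mu>0 \<mu>1. energy p \<le> ennreal (r\<^sup>2)"
proof -
  have "(dS \<mu>0 \<mu>1)\<^sup>2 < r\<^sup>2" using r dS_nonneg by (rule power_strict_mono) simp
  then have "I \<mu>0 \<mu>1 < ennreal (r\<^sup>2)" unfolding I_bounds(3)[OF \<mu>] by (simp add: ennreal_less_iff)
  then obtain p where "p \<in> paths \<mu>0 \<mu>1" "energy p < ennreal (r\<^sup>2)" unfolding I_def INF_less_iff by blast
  then show ?thesis using less_imp_le by blast
qed

lemma dS_triangle:
  assumes \<mu>: "\<mu>0 \<in> radon_prob" "\<mu>1 \<in> radon_prob" "\<mu>2 \<in> radon_prob"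
  shows "dS \<mu>0 \<mu>2 \<le> dS \<mu>0 \<mu>1 + dS \<mu>1 \<mu>2"
proof (rule field_le_epsilon)
  fix e :: real assume e: "e > 0"
  \<comment> \<open>The slack e/2 provides nearly optimal paths and makes both lengths positive, so
    that \<theta> lies strictly between 0 and 1 even if one distance vanishes.\<close>
  define r1 where "r1 = dS \<mu>0 \<mu>1 + e / 2"
  define r2 where "r2 = dS \<mu>1 \<mu>2 + e / 2"
  have r: "r1 > 0" "r2 > 0" using e dS_nonneg[of \<mu>0 \<mu>1] dS_nonneg[of \<mu>1 \<mu>2] unfolding r1_def r2_def by linarith+
  obtain p where p: "p \<in> paths \<mu>0 \<mu>1" "energy p \<le> ennreal (r1\<^sup>2)"
    using dS_less_path[OF \<mu>(1,2), of r1] e by (auto simp: r1_def)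
  obtain p' where p': "p' \<in> paths \<mu>1 \<mu>2" "energy p' \<le> ennreal (r2\<^sup>2)"
    using dS_less_path[OF \<mu>(2,3), of r2] e by (auto simp: r2_def)
  define \<theta> where "\<theta> = r1 / (r1 + r2)"
  have th: "0 < \<theta>" "\<theta> < 1" using r by (auto simp: \<theta>_def)
  obtain P where P: "P \<in> paths \<mu>0 \<mu>2" "energy P \<le>
    ennreal (\<theta> * (1 / \<theta>)\<^sup>2) * energy p + ennreal ((1 - \<theta>) * (1 / (1 - \<theta>))\<^sup>2) * energy p'"
    using concat_path[OF p(1) p'(1) th] by blast
  have "ennreal ((dS \<mu>0 \<mu>2)\<^sup>2) \<le> energy P"
    unfolding I_bounds(3)[OF \<mu>(1,3), symmetric] I_def by (rule INF_lower[OF P(1)])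
  also have "\<dots> \<le> ennreal ((r1 + r2)\<^sup>2)"
    by (rule order_trans[OF P(2) energy_pieces[OF r p(2) p'(2) \<theta>_def]])
  finally have "(dS \<mu>0 \<mu>2)\<^sup>2 \<le> (r1 + r2)\<^sup>2" by (rule ennreal_le_iff[OF zero_le_power2, THEN iffD1])
  then have "dS \<mu>0 \<mu>2 \<le> r1 + r2" by (rule power2_le_imp_le) (use r in linarith)
  then show "dS \<mu>0 \<mu>2 \<le> dS \<mu>0 \<mu>1 + dS \<mu>1 \<mu>2 + e" by (simp add: r1_def r2_def)
qed

section \<open>Universality and the comparison of topologies\<close>

lemma universal_approximation:
  fixes g :: "'a \<Rightarrow> real"
  assumes g: "continuous_on UNIV g" and e: "e > 0"
  obtains h where "\<And>x. \<bar>g x - h \<bullet> kx x\<bar> \<le> e"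
proof -
  have "bounded (range g)" by (rule compact_imp_bounded[OF compact_continuous_image[OF g compact_space_UNIV]])
  then have G: "apply_bcontfun (Bcontfun g) = g" using g by (intro Bcontfun_inverse) (simp add: bcontfun_def)
  have "Bcontfun g \<in> closure {f :: 'a \<Rightarrow>\<^sub>C real. apply_bcontfun f \<in> range \<iota>}"
    using univ by (simp add: universal_rkhs_def)
  then obtain f where f: "apply_bcontfun f \<in> range \<iota>" "dist f (Bcontfun g) < e"
    using e unfolding closure_approachable by blast
  then obtain h where h: "apply_bcontfun f = \<iota> h" by blast
  have "\<bar>g x - h \<bullet> kx x\<bar> \<le> e" for x
    using dist_bounded[of f x "Bcontfun g"] f(2) unfolding G h kx(2)[of h x] dist_real_def by linarith
  then show ?thesis using that by blast
qed

text \<open>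
  With \<open>\<beta> = B \<mu>\<close> one has \<open>\<integral> f d\<mu> = \<integral> f (\<beta> \<bullet> kx) a d\<mu>\<close> and \<open>\<integral> (h \<bullet> kx) a d\<mu> = h \<bullet> \<beta>\<close>; by universality
  \<open>f (\<beta>\<^sub>0 \<bullet> kx)\<close> is uniformly close to some \<open>h \<bullet> kx\<close>.
\<close>

lemma integral_continuous_in_B:
  fixes f :: "'a \<Rightarrow> real"
  assumes f: "continuous_on UNIV f" and \<mu>0: "\<mu>0 \<in> radon_prob" and e: "e > 0"
  obtains \<delta> where "\<delta> > 0"
    "\<And>\<mu>. \<mu> \<in> radon_prob \<Longrightarrow> norm (Bm \<mu> - Bm \<mu>0) < \<delta> \<Longrightarrow> \<bar>(LINT x|\<mu>. f x) - (LINT x|\<mu>0. f x)\<bar> < e"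
proof -
  obtain Cf where Cf: "\<And>x. norm (f x) \<le> Cf" using continuous_bounded_compact[OF f] by blast
  have Cf0: "0 \<le> Cf" using Cf[of undefined] norm_ge_zero order_trans by blast
  \<comment> \<open>The factor q compensates the weight 1/(\<beta> \<bullet> \<open>kx x\<close>)
    \<le> 1/q, so that each of the two approximations contributes e/4.\<close>
  define e1 where "e1 = q * (e / 4)"
  have e1: "e1 > 0" using e q_pos by (simp add: e1_def)
  obtain h where h: "\<And>x. \<bar>f x * (Bm \<mu>0 \<bullet> kx x) - h \<bullet> kx x\<bar> \<le> e1"
    using universal_approximation[OF continuous_on_mult[OF f cont_inner_kx] e1] by blast
  have app: "\<bar>(LINT x|\<mu>. f x) - Bm \<mu> \<bullet> h\<bar> \<le> 1 / q * (Cf * norm (Bm \<mu> - Bm \<mu>0) + e1)" if \<mu>: "\<mu> \<in> radon_prob" for \<mu>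
  proof -
    note s = sol_B[OF \<mu>]
    have pos: "0 < Bm \<mu> \<bullet> kx x" "q \<le> Bm \<mu> \<bullet> kx x" for x
      using sol_bounds(3)[OF \<mu> s, of x] q_pos by linarith+
    have c: "continuous_on UNIV (\<lambda>x. 1 / (Bm \<mu> \<bullet> kx x) * (h \<bullet> kx x))"
      by (intro continuous_on_mult sol_inv_cont[OF s] cont_inner_kx)
    have c': "continuous_on UNIV (\<lambda>x. f x - 1 / (Bm \<mu> \<bullet> kx x) * (h \<bullet> kx x))" by (intro continuous_on_diff f c)
    have "(LINT x|\<mu>. f x) - Bm \<mu> \<bullet> h = (LINT x|\<mu>. f x - 1 / (Bm \<mu> \<bullet> kx x) * (h \<bullet> kx x))"
      unfolding sol_inner[OF \<mu> s, of h]
      by (rule Bochner_Integration.integral_diff[symmetric]) (rule radon_prob_continuous_integrable[OF \<mu>], rule f c)+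
    also have "norm \<dots> \<le> 1 / q * (Cf * norm (Bm \<mu> - Bm \<mu>0) + e1)"
    proof (rule radon_prob_norm_integral_le[OF \<mu> radon_prob_continuous_measurable[OF \<mu> c']])
      fix x
      \<comment> \<open>The approximation h is chosen for \<mu>0 but applied to \<mu>: the first
        term is the price of replacing \<open>Bm \<mu>0\<close> by \<open>Bm \<mu>\<close>, the
        second the uniform error.\<close>
      define D where "D = f x * ((Bm \<mu> - Bm \<mu>0) \<bullet> kx x) + (f x * (Bm \<mu>0 \<bullet> kx x) - h \<bullet> kx x)"
      have "f x - 1 / (Bm \<mu> \<bullet> kx x) * (h \<bullet> kx x) = 1 / (Bm \<mu> \<bullet> kx x) * D"
        using pos(1)[of x] by (simp add: D_def inner_diff_left field_simps)
      moreover have "\<bar>D\<bar> \<le> Cf * norm (Bm \<mu> - Bm \<mu>0) + e1"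
      proof -
        have "\<bar>f x * ((Bm \<mu> - Bm \<mu>0) \<bullet> kx x)\<bar> \<le> Cf * norm (Bm \<mu> - Bm \<mu>0)"
          unfolding abs_mult using Cf[of x] inner_kx_le Cf0 by (intro mult_mono) auto
        then show ?thesis using h[of x] unfolding D_def by linarith
      qed
      moreover have "\<bar>1 / (Bm \<mu> \<bullet> kx x)\<bar> \<le> 1 / q" using pos[of x] q_pos by (simp add: frac_le)
      ultimately show "norm (f x - 1 / (Bm \<mu> \<bullet> kx x) * (h \<bullet> kx x)) \<le> 1 / q * (Cf * norm (Bm \<mu> - Bm \<mu>0) + e1)"
        unfolding real_norm_def by (simp only: abs_mult) (intro mult_mono, use q_pos in auto)
    qed
    finally show ?thesis by (simp only: real_norm_def)
  qed
  \<comment> \<open>Collects the coefficients of the norm of \<open>Bm \<mu>\<close> -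
    \<open>Bm \<mu>0\<close>: Cf/q from the change of weight and the norm of h from the change of
    the pairing, with 1 added for positivity.\<close>
  define A where "A = Cf / q + norm h + 1"
  have A: "A > 0" using Cf0 q_pos by (simp add: A_def add_nonneg_pos)
  have qe: "1 / q * e1 = e / 4" using q_pos by (simp add: e1_def)
  show ?thesis
  proof (rule that[of "e / (2 * A)"])
    show "0 < e / (2 * A)" using e A by simp
    fix \<mu> assume \<mu>: "\<mu> \<in> radon_prob" and d: "norm (Bm \<mu> - Bm \<mu>0) < e / (2 * A)"
    define n where "n = norm (Bm \<mu> - Bm \<mu>0)"
    have n0: "0 \<le> n" by (simp add: n_def)
    have "A * n < e / 2" using d A unfolding n_def[symmetric] by (simp add: field_simps)
    moreover have "A * n = Cf / q * n + norm h * n + n" by (simp add: A_def algebra_simps)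
    moreover have "\<bar>(LINT x|\<mu>. f x) - Bm \<mu> \<bullet> h\<bar> \<le> Cf / q * n + e / 4"
      using app[OF \<mu>] unfolding n_def[symmetric] distrib_left qe by simp
    moreover have "\<bar>(LINT x|\<mu>0. f x) - Bm \<mu>0 \<bullet> h\<bar> \<le> e / 4"
      using app[OF \<mu>0] unfolding distrib_left qe by simp
    moreover have "\<bar>Bm \<mu> \<bullet> h - Bm \<mu>0 \<bullet> h\<bar> \<le> norm h * n"
      using Cauchy_Schwarz_ineq2[of "Bm \<mu> - Bm \<mu>0" h] by (simp add: n_def inner_diff_left mult.commute)
    ultimately show "\<bar>(LINT x|\<mu>. f x) - (LINT x|\<mu>0. f x)\<bar> < e" using n0 by linarith
  qed
qed

lemma B_inj:
  assumes \<mu>: "\<mu> \<in> radon_prob" "\<nu> \<in> radon_prob" and eq: "Bm \<mu> = Bm \<nu>"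
  shows "\<mu> = \<nu>"
proof (rule radon_prob_eqI[OF \<mu>])
  fix f :: "'a \<Rightarrow> real" assume f: "continuous_on UNIV f"
  show "(LINT x|\<mu>. f x) = (LINT x|\<nu>. f x)"
  proof (rule ccontr)
    assume "\<not> ?thesis"
    then have e: "0 < \<bar>(LINT x|\<mu>. f x) - (LINT x|\<nu>. f x)\<bar>" by simp
    obtain \<delta> where "\<delta> > 0" "\<And>m. m \<in> radon_prob \<Longrightarrow> norm (Bm m - Bm \<nu>) < \<delta> \<Longrightarrow>
        \<bar>(LINT x|m. f x) - (LINT x|\<nu>. f x)\<bar> < \<bar>(LINT x|\<mu>. f x) - (LINT x|\<nu>. f x)\<bar>"
      using integral_continuous_in_B[OF f \<mu>(2) e] by blast
    from this(2)[OF \<mu>(1)] this(1) show False by (simp add: eq)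
  qed
qed

lemma dS_metric: "Metric_space radon_prob dS"
proof
  show "0 \<le> dS m n" for m n by (rule dS_nonneg)
  show "dS m n = dS n m" for m n by (rule dS_commute)
  show "dS m n = 0 \<longleftrightarrow> m = n" if m: "m \<in> radon_prob" "n \<in> radon_prob" for m n
  proof
    assume "dS m n = 0"
    then have "sqrt (\<epsilon> / 2) * norm (Bm m - Bm n) \<le> 0" using dS_lower[OF m] by simp
    then have "Bm m = Bm n" using eps by (simp add: mult_le_0_iff)
    then show "m = n" by (rule B_inj[OF m])
  next
    assume "m = n"
    then show "dS m n = 0" using dS_upper[OF m] dS_nonneg[of m n] by simp
  qed
  show "dS l n \<le> dS l m + dS m n" if "l \<in> radon_prob" "m \<in> radon_prob" "n \<in> radon_prob" for l m n
    using that by (rule dS_triangle)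
qed

lemma dS_weak_star: "Metric_space.mtopology radon_prob dS = weak_star_topology"
proof -
  interpret d: Metric_space radon_prob dS by (rule dS_metric)
  have sub: "openin d.mtopology {\<mu> \<in> radon_prob. (LINT x|\<mu>. f x) \<in> U}"
    if f: "continuous_on UNIV f" and U: "open U" for f :: "'a \<Rightarrow> real" and U
    unfolding d.openin_mtopology
  proof (intro conjI allI impI)
    fix \<mu>0 assume "\<mu>0 \<in> {\<mu> \<in> radon_prob. (LINT x|\<mu>. f x) \<in> U}"
    then have \<mu>0: "\<mu>0 \<in> radon_prob" "(LINT x|\<mu>0. f x) \<in> U" by auto
    obtain e where e: "e > 0" "ball (LINT x|\<mu>0. f x) e \<subseteq> U" using U \<mu>0(2) open_contains_ball by blast
    obtain \<delta> where \<delta>: "\<delta> > 0" "\<And>m. m \<in> radon_prob \<Longrightarrow> norm (Bm m - Bm \<mu>0) < \<delta> \<Longrightarrow>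
        \<bar>(LINT x|m. f x) - (LINT x|\<mu>0. f x)\<bar> < e"
      using integral_continuous_in_B[OF f \<mu>0(1) e(1)] by blast
    have s: "0 < sqrt (\<epsilon> / 2)" using eps by simp
    have "d.mball \<mu>0 (sqrt (\<epsilon> / 2) * \<delta>) \<subseteq> {\<mu> \<in> radon_prob. (LINT x|\<mu>. f x) \<in> U}"
    proof
      fix m assume "m \<in> d.mball \<mu>0 (sqrt (\<epsilon> / 2) * \<delta>)"
      then have m: "m \<in> radon_prob" "dS \<mu>0 m < sqrt (\<epsilon> / 2) * \<delta>" by auto
      have "sqrt (\<epsilon> / 2) * norm (Bm \<mu>0 - Bm m) < sqrt (\<epsilon> / 2) * \<delta>"
        by (rule le_less_trans[OF dS_lower[OF \<mu>0(1) m(1)] m(2)])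
      then have "norm (Bm m - Bm \<mu>0) < \<delta>" using s by (simp only: mult_less_cancel_left_pos norm_minus_commute)
      then have "\<bar>(LINT x|m. f x) - (LINT x|\<mu>0. f x)\<bar> < e" by (rule \<delta>(2)[OF m(1)])
      then have "(LINT x|m. f x) \<in> ball (LINT x|\<mu>0. f x) e" by (simp add: dist_real_def)
      then show "m \<in> {\<mu> \<in> radon_prob. (LINT x|\<mu>. f x) \<in> U}" using e(2) m(1) by blast
    qed
    then show "\<exists>r>0. d.mball \<mu>0 r \<subseteq> {\<mu> \<in> radon_prob. (LINT x|\<mu>. f x) \<in> U}"
      using s \<delta>(1) by (intro exI[of _ "sqrt (\<epsilon> / 2) * \<delta>"]) simp
  qed auto
  \<comment> \<open>The generated topology is the coarsest one containing its subbasic sets, so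
    openness of those in the metric topology is enough.\<close>
  have "openin d.mtopology U" if "openin weak_star_topology U" for U
  proof (rule generate_topology_on_coarsest[OF istopology_openin])
    show "generate_topology_on {{\<mu> \<in> radon_prob. (LINT x|\<mu>. f x) \<in> U} | (f :: 'a \<Rightarrow> real) U. continuous_on UNIV f \<and> open U} U"
      using that unfolding weak_star_topology_def openin_topology_generated_by_iff .
  qed (use sub in blast)
  moreover have "openin weak_star_topology U" if U: "openin d.mtopology U" for U
  proof (subst openin_subopen, intro ballI)
    fix \<mu>0 assume m0: "\<mu>0 \<in> U"
    obtain r where r: "r > 0" "d.mball \<mu>0 r \<subseteq> U" using U m0 unfolding d.openin_mtopology by blast
    have \<mu>0: "\<mu>0 \<in> radon_prob" using U m0 unfolding d.openin_mtopology by blast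
    define A where "A = pi / 2 * sqrt (\<epsilon> / 2 * C) + 1"
    have "0 \<le> \<epsilon> / 2 * C" using eps by (intro mult_nonneg_nonneg add_nonneg_nonneg) auto
    then have "0 \<le> sqrt (\<epsilon> / 2 * C)" by (rule real_sqrt_ge_zero)
    then have A: "A > 0" unfolding A_def by (intro add_nonneg_pos mult_nonneg_nonneg zero_less_one) simp_all
    \<comment> \<open>The integrand depends on \<mu>0 alone, so one neighbourhood serves all \<mu>;
      \<open>sol_stability\<close> converts closeness of these integrals into closeness of the
      images under B.\<close>
    obtain V where V: "openin weak_star_topology V" "\<mu>0 \<in> V" "V \<subseteq> radon_prob"
      "\<And>\<mu>. \<mu> \<in> V \<Longrightarrow> norm ((LINT x|\<mu>. (1 / (Bm \<mu>0 \<bullet> kx x)) *\<^sub>R kx x) - (LINT x|\<mu>0. (1 / (Bm \<mu>0 \<bullet> kx x)) *\<^sub>R kx x)) < r / A"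
      using weak_star_neighbourhood_vector_integral[OF continuous_on_scaleR[OF sol_inv_cont[OF sol_B[OF \<mu>0]] kx_cont] \<mu>0, of "r / A"] r(1) A
      by auto
    have "V \<subseteq> d.mball \<mu>0 r"
    proof
      fix \<mu> assume mV: "\<mu> \<in> V"
      then have \<mu>: "\<mu> \<in> radon_prob" using V(3) by blast
      have n: "norm (Bm \<mu>0 - Bm \<mu>) < r / A"
        using sol_stability[OF \<mu> \<mu>0 sol_B[OF \<mu>] sol_B[OF \<mu>0]] V(4)[OF mV] by (simp only: norm_minus_commute[of "Bm \<mu>0"])
      have "dS \<mu>0 \<mu> \<le> pi / 2 * sqrt (\<epsilon> / 2 * C) * norm (Bm \<mu>0 - Bm \<mu>)" by (rule dS_upper[OF \<mu>0 \<mu>])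
      also have "\<dots> \<le> A * norm (Bm \<mu>0 - Bm \<mu>)" unfolding A_def by (intro mult_right_mono) auto
      also have "\<dots> < A * (r / A)" by (rule mult_strict_left_mono[OF n A])
      finally show "\<mu> \<in> d.mball \<mu>0 r" using A \<mu> \<mu>0 by simp
    qed
    then show "\<exists>T. openin weak_star_topology T \<and> \<mu>0 \<in> T \<and> T \<subseteq> U" using V(1,2) r(2) by blast
  qed
  ultimately show ?thesis by (auto simp: topology_eq)
qed

end

theorem theorem5p2:
  fixes c :: "'a::compact_metric_space \<Rightarrow> 'a \<Rightarrow> real"
    and \<epsilon> :: real
    and \<iota> :: "'h::{real_inner, banach, second_countable_topology} \<Rightarrow> 'a \<Rightarrow> real"
  assumes "\<epsilon> > 0"
    and "continuous_on UNIV (\<lambda>(x, y). c x y)"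
    and "\<And>x y. c x y \<ge> 0"
    and "\<And>x y. c x y = c y x"
    and "positive_definite_kernel (gibbs_kernel \<epsilon> c)"
    and "is_rkhs (gibbs_kernel \<epsilon> c) \<iota>"
    and "universal_rkhs \<iota>"
  shows "Metric_space radon_prob (sinkhorn_dist \<iota> \<epsilon> c)
    \<and> Metric_space.mtopology radon_prob (sinkhorn_dist \<iota> \<epsilon> c) = weak_star_topology
    \<and> (\<forall>\<mu>0\<in>radon_prob. \<forall>\<mu>1\<in>radon_prob.
         sqrt (\<epsilon> / 2) * norm (B_map \<iota> \<epsilon> c \<mu>0 - B_map \<iota> \<epsilon> c \<mu>1)
           \<le> sinkhorn_dist \<iota> \<epsilon> c \<mu>0 \<mu>1
       \<and> sinkhorn_dist \<iota> \<epsilon> c \<mu>0 \<mu>1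
           \<le> pi / 2 * sqrt (\<epsilon> / 2 * (1 + 2 * exp (11 / (2 * \<epsilon>) * sup_norm c)))
               * norm (B_map \<iota> \<epsilon> c \<mu>0 - B_map \<iota> \<epsilon> c \<mu>1))"
proof -
  interpret gibbs_rkhs c \<epsilon> \<iota>
    by unfold_locales (use assms in auto)
  show ?thesis using dS_metric dS_weak_star dS_lower dS_upper by blast
qed

end
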